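(* Let $K$ be an algebraically closed field, let $m,t\geq1$ be integers, and let $I\subset K[\mathbf{P}^2]$ be the radical ideal of $n$ general points in $\mathbf{P}^2$, where $n=s^2$ for an integer $s\geq 3$. Let $M\subset K[\mathbf{P}^2]$ be the ideal generated by the variables. Then $$I^{(t(m+1))}\subseteq M^t(I^{(m)})^t,\qquad I^{(t(m+1)-1)}\subseteq (I^{(m)})^t,\qquad I^{(t(m+1)-1)}\subseteq M^{t-1}(I^{(m)})^t.$$
   Context: A statement (for given $m,t,n$) holds for $n$ general points of $\mathbf{P}^2$ if there is a nonempty Zariski open subset $U\subseteq(\mathbf{P}^2)^n$ (which may depend on $m,t,n$) such that it holds for all $(P_1,\ldots,P_n)\in U$. For distinct points $P_1,\ldots,P_n$ with radical ideal $I=\bigcap_i I(P_i)$, where $I(P_i)$ is the ideal generated by all forms vanishing at $P_i$, the $m$-th symbolic power is $I^{(m)}=\bigcap_i I(P_i)^m$. For any ideal $J$, $J^0$ is the whole ring. *)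

theory Defs
  imports
    "HOL-Library.Poly_Mapping"
    "HOL-Library.Numeral_Type"
    "HOL-Library.FuncSet"
    "HOL-Computational_Algebra.Polynomial"
begin

section \<open>Multivariate polynomials\<close>

text \<open>
  Monomials are finitely supported exponent vectors and polynomials are finitely supported
  coefficient functions on monomials, with the convolution product of
  \<^theory>\<open>HOL-Library.Poly_Mapping\<close>.
\<close>

type_synonym ('v, 'a) mpoly = "('v \<Rightarrow>\<^sub>0 nat) \<Rightarrow>\<^sub>0 'a"

definition mpoly_var :: "'v \<Rightarrow> ('v, 'a::comm_ring_1) mpoly" where
  "mpoly_var j = Poly_Mapping.single (Poly_Mapping.single j 1) 1"

definition mpoly_eval :: "('v, 'a::comm_ring_1) mpoly \<Rightarrow> ('v \<Rightarrow> 'a) \<Rightarrow> 'a" where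
  "mpoly_eval f x =
     (\<Sum>e\<in>Poly_Mapping.keys f. Poly_Mapping.lookup f e *
        (\<Prod>j\<in>Poly_Mapping.keys e. x j ^ Poly_Mapping.lookup e j))"

text \<open>The zero polynomial counts as a form (of every degree).\<close>

definition is_form :: "('v, 'a::comm_ring_1) mpoly \<Rightarrow> bool" where
  "is_form f \<longleftrightarrow>
     (\<exists>d. \<forall>e\<in>Poly_Mapping.keys f. (\<Sum>j\<in>Poly_Mapping.keys e. Poly_Mapping.lookup e j) = d)"


section \<open>Ideals\<close>

text \<open>Ideals of a commutative ring are its submodules as a module over itself.\<close>

lemma module_mult: "Modules.module ((*) :: 'r::comm_ring_1 \<Rightarrow> 'r \<Rightarrow> 'r)"
  by unfold_locales (simp_all add: algebra_simps)

definition ideal_gen :: "'r::comm_ring_1 set \<Rightarrow> 'r set" where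
  "ideal_gen S = module.span (*) S"

definition ideal_mult :: "'r::comm_ring_1 set \<Rightarrow> 'r set \<Rightarrow> 'r set" where
  "ideal_mult A B = ideal_gen {a * b |a b. a \<in> A \<and> b \<in> B}"

primrec ideal_power :: "'r::comm_ring_1 set \<Rightarrow> nat \<Rightarrow> 'r set" where
  "ideal_power A 0 = UNIV"
| "ideal_power A (Suc k) = ideal_mult A (ideal_power A k)"


section \<open>The projective plane\<close>

text \<open>
  A point of the projective plane is the set of all its homogeneous coordinate vectors,
  an equivalence class of nonzero vectors modulo nonzero scalars.
\<close>

type_synonym 'a point = "(3 \<Rightarrow> 'a) set"

definition proj_rel :: "((3 \<Rightarrow> 'a::field) \<times> (3 \<Rightarrow> 'a)) set" where
  "proj_rel = {(v, w). v \<noteq> (\<lambda>_. 0) \<and> (\<exists>c. c \<noteq> 0 \<and> w = (\<lambda>j. c * v j))}"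

definition proj_plane :: "'a::field point set" where
  "proj_plane = {v. v \<noteq> (\<lambda>_. 0)} // proj_rel"

definition plane_tuples :: "nat \<Rightarrow> (nat \<Rightarrow> 'a::field point) set" where
  "plane_tuples n = {..<n} \<rightarrow>\<^sub>E proj_plane"


section \<open>The Zariski topology on powers of the projective plane\<close>

text \<open>
  The multihomogeneous coordinate ring of the \<open>n\<close>-fold product has the variables \<open>(i, j)\<close>
  with \<open>i < n\<close>, where \<open>(i, j)\<close> is the \<open>j\<close>-th homogeneous coordinate of the \<open>i\<close>-th point.
\<close>

definition multihomogeneous :: "nat \<Rightarrow> (nat \<times> 3, 'a::comm_ring_1) mpoly \<Rightarrow> bool" where
  "multihomogeneous n F \<longleftrightarrow>
     (\<exists>d. \<forall>e\<in>Poly_Mapping.keys F.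
        fst ` Poly_Mapping.keys e \<subseteq> {..<n} \<and>
        (\<forall>i<n. (\<Sum>j\<in>UNIV. Poly_Mapping.lookup e (i, j)) = d i))"

definition vanishes_on_tuple ::
    "nat \<Rightarrow> (nat \<times> 3, 'a::field) mpoly \<Rightarrow> (nat \<Rightarrow> 'a point) \<Rightarrow> bool" where
  "vanishes_on_tuple n F P \<longleftrightarrow>
     (\<forall>v. (\<forall>i<n. v i \<in> P i) \<longrightarrow> mpoly_eval F (\<lambda>(i, j). v i j) = 0)"

definition zariski_closed :: "nat \<Rightarrow> (nat \<Rightarrow> 'a::field point) set \<Rightarrow> bool" where
  "zariski_closed n Z \<longleftrightarrow>
     (\<exists>S. (\<forall>F\<in>S. multihomogeneous n F) \<and>
          Z = {P \<in> plane_tuples n. \<forall>F\<in>S. vanishes_on_tuple n F P})"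

definition zariski_open :: "nat \<Rightarrow> (nat \<Rightarrow> 'a::field point) set \<Rightarrow> bool" where
  "zariski_open n U \<longleftrightarrow> U \<subseteq> plane_tuples n \<and> zariski_closed n (plane_tuples n - U)"

text \<open>
  A property of \<open>n\<close>-tuples of distinct points holds for \<open>n\<close> general points. That the points
  are distinct is itself an open condition, and is part of what is asserted on \<open>U\<close>.
\<close>

definition for_general_points ::
    "nat \<Rightarrow> ((nat \<Rightarrow> 'a::field point) \<Rightarrow> bool) \<Rightarrow> bool" where
  "for_general_points n Q \<longleftrightarrow>
     (\<exists>U. zariski_open n U \<and> U \<noteq> {} \<and> (\<forall>P\<in>U. inj_on P {..<n} \<and> Q P))"


section \<open>Ideals of points and symbolic powers\<close>

definition irrelevant_ideal :: "(3, 'a::comm_ring_1) mpoly set" where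
  "irrelevant_ideal = ideal_gen (range mpoly_var)"

definition point_ideal :: "'a::field point \<Rightarrow> (3, 'a) mpoly set" where
  "point_ideal p = ideal_gen {f. is_form f \<and> (\<forall>v\<in>p. mpoly_eval f v = 0)}"

definition points_ideal :: "nat \<Rightarrow> (nat \<Rightarrow> 'a::field point) \<Rightarrow> (3, 'a) mpoly set" where
  "points_ideal n P = (\<Inter>i<n. point_ideal (P i))"

text \<open>
  The \<open>m\<close>-th symbolic power of \<^term>\<open>points_ideal n P\<close>, for distinct points
  \<open>P 0, \<dots>, P (n - 1)\<close>.
\<close>

definition symbolic_power :: "nat \<Rightarrow> (nat \<Rightarrow> 'a::field point) \<Rightarrow> nat \<Rightarrow> (3, 'a) mpoly set" where
  "symbolic_power n P m = (\<Inter>i<n. ideal_power (point_ideal (P i)) m)"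

end

theory Submission
  imports
    Defs
    "HOL-Library.Countable_Set"
    "HOL-Library.Function_Algebras"
    "Jordan_Normal_Form.Determinant"
begin

text \<open>
  In affine coordinates let \<open>J\<^sub>k\<close> be the polynomials vanishing to order \<open>k\<close> at all \<open>n = s\<^sup>2\<close>
  points. Three facts about general points suffice. First, polynomials of degree
  \<open>d = m s + s div 2 - 1\<close> interpolate all jets of order \<open>m\<close>. Second, a nonzero element of
  \<open>J\<^sub>k\<close> has degree at least \<open>s k\<close>. Third, for even \<open>s\<close> and odd \<open>k\<close> it even has degree greater
  than \<open>s k\<close> (Nagata). The first fact says that the leading forms of the elements of \<open>J\<^sub>m\<close> of
  degree at most \<open>\<delta> = d + 1\<close> are all forms of degree \<open>\<delta>\<close>. As the syzygies of the monomials of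
  degree \<open>\<delta>\<close> are linear, an element of \<open>J\<close> with index \<open>t m\<close> and of degree \<open>e \<ge> t \<delta>\<close> is then a
  combination of products of \<open>t\<close> elements of \<open>J\<^sub>m\<close> of degree at most \<open>\<delta>\<close> with cofactors of degree
  at most \<open>e - t \<delta>\<close>. The inclusions follow by comparing degrees.

  Each of the three facts is the nonvanishing of a determinant, so it suffices to exhibit one
  configuration of points, which is done with points on unions of lines: for the first two,
  \<open>s\<close> points on each of \<open>s\<close> lines.
\<close>

section \<open>Bivariate polynomials\<close>

text \<open>Let \<open>\<delta> = m * s + s div 2\<close>. A form of degree \<open>e\<close> and
  order at least \<open>t * m\<close> leaves a cofactor of degree \<open>e - t * \<delta>\<close>,
  so a factor from \<open>M ^ c\<close> comes for free as soon as every nonzero form of the given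
  order \<open>k\<close> has degree at least \<open>t * \<delta> + c\<close>. With the bound
  \<open>s * k\<close> this reads \<open>t * (s div 2) + c \<le> s * (k - t * m)\<close>. For
  \<open>k = t * (m + 1)\<close> and \<open>c = t\<close> it is \<open>s div 2 + 1 \<le> s\<close>.
  For \<open>k = t * (m + 1) - 1\<close>, \<open>c = t - 1\<close> and \<open>t \<ge> 2\<close> it
  holds except when \<open>t = 2\<close> and \<open>s\<close> is even, where it misses by one; there
  \<open>k = 2 * m + 1\<close> is odd, and this is the only use of the third fact. The second
  inclusion follows from the third one.

  The term \<open>s div 2\<close> is the price of gluing along \<open>s\<close> lines: the
  \<open>s * (s - 1) / 2\<close> nodes require as many free coefficients, about \<open>s / 2\<close>
  on each line.\<close>

abbreviation (input) bconst :: "'a::comm_ring_1 \<Rightarrow> 'a poly poly" where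
  "bconst c \<equiv> [:[:c:]:]"

abbreviation (input) bX :: "'a::comm_ring_1 poly poly" where
  "bX \<equiv> [:[:0, 1:]:]"

abbreviation (input) bY :: "'a::comm_ring_1 poly poly" where
  "bY \<equiv> [:0, 1:]"

text \<open>\<open>h\<close> acts on the coefficients, the inner variable goes to \<open>x\<close>
  and the outer one to \<open>y\<close>. Most substitutions below are instances, so identities
  between them need only be checked on constants and the two variables.\<close>

definition beval :: "('a::comm_ring_1 \<Rightarrow> 'r::comm_ring_1) \<Rightarrow> 'r \<Rightarrow> 'r \<Rightarrow> 'a poly poly \<Rightarrow> 'r" where
  "beval h x y f = poly (map_poly (\<lambda>c. poly (map_poly h c) x) f) y"

lemma poly_map_poly_hom:
  assumes "comm_ring_hom h"
  shows "comm_ring_hom (\<lambda>c. poly (map_poly h c) x)"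
proof -
  interpret h: comm_ring_hom h by fact
  have pC: "poly (map_poly h (pCons a c)) x = h a + x * poly (map_poly h c) x" for a c
    by (simp add: map_poly_pCons)
  have add: "poly (map_poly h (p + q)) x = poly (map_poly h p) x + poly (map_poly h q) x" for p q
    by (induction p q rule: poly_induct2) (simp_all add: pC h.hom_add algebra_simps)
  have smult: "poly (map_poly h (Polynomial.smult a q)) x = h a * poly (map_poly h q) x" for a q
    by (induction q) (simp_all add: pC h.hom_mult algebra_simps)
  have mult: "poly (map_poly h (p * q)) x = poly (map_poly h p) x * poly (map_poly h q) x" for p q
    by (induction p) (simp_all add: pC add smult algebra_simps)
  show ?thesis
    by unfold_locales (simp_all add: add mult)
qed

lemma beval_hom: "comm_ring_hom h \<Longrightarrow> comm_ring_hom (beval h x y)"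
  unfolding beval_def by (intro poly_map_poly_hom)

lemma beval_generators:
  assumes "comm_ring_hom h"
  shows "beval h x y (bconst c) = h c" "beval h x y bX = x" "beval h x y bY = y"
proof -
  interpret h: comm_ring_hom h by fact
  show "beval h x y (bconst c) = h c" "beval h x y bX = x" "beval h x y bY = y"
    by (simp_all add: beval_def map_poly_pCons)
qed

lemma bipoly_induct [case_names const X Y add mult]:
  assumes const: "\<And>c. Q (bconst c)" and X: "Q bX" and Y: "Q bY"
    and add: "\<And>f g. Q f \<Longrightarrow> Q g \<Longrightarrow> Q (f + g)" and mult: "\<And>f g. Q f \<Longrightarrow> Q g \<Longrightarrow> Q (f * g)"
  shows "Q (f :: 'a::comm_ring_1 poly poly)"
proof -
  have 1: "Q [:c:]" for c
  proof (induction c)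
    case 0
    then show ?case using const[of 0] by simp
  next
    case (pCons a p)
    have "[:pCons a p:] = bconst a + bX * [:p:]" by simp
    then show ?case using pCons const X add mult by metis
  qed
  show ?thesis
  proof (induction f)
    case 0
    then show ?case using const[of 0] by simp
  next
    case (pCons a p)
    have "pCons a p = [:a:] + bY * p" by simp
    then show ?case using pCons 1 Y add mult by metis
  qed
qed

lemma hom_eqI:
  assumes "comm_ring_hom F" "comm_ring_hom G"
    and "\<And>c. F (bconst c) = G (bconst c)" "F bX = G bX" "F bY = G bY"
  shows "F f = G f"
proof -
  interpret F: comm_ring_hom F by fact
  interpret G: comm_ring_hom G by fact
  show ?thesis
    by (induction f rule: bipoly_induct)
      (use assms in \<open>simp_all add: F.hom_add G.hom_add F.hom_mult G.hom_mult\<close>)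
qed

lemma const_poly_hom: "comm_ring_hom (\<lambda>a::'a::comm_ring_1. [:a:])"
  by unfold_locales (simp_all add: one_pCons)

lemma const_poly_poly_hom: "comm_ring_hom (\<lambda>a::'a::comm_ring_1. [:[:a:]:])"
  by unfold_locales (simp_all add: one_pCons)

text \<open>
  Substituting \<open>x = p + u\<close>, \<open>y = q + w u\<close> turns the order of vanishing at \<open>(p, q)\<close> into the
  order in \<open>u\<close>, and for \<open>(p, q) = (0, 0)\<close> the total degree into the degree in \<open>u\<close>. The result is
  a polynomial in \<open>u\<close> over the polynomials in \<open>w\<close>.
\<close>

definition blow :: "'a::comm_ring_1 \<times> 'a \<Rightarrow> 'a poly poly \<Rightarrow> 'a poly poly" where
  "blow P = beval (\<lambda>a. [:[:a:]:]) [:[:fst P:], 1:] [:[:snd P:], [:0, 1:]:]"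

interpretation blow: comm_ring_hom "blow P"
  unfolding blow_def by (intro beval_hom const_poly_poly_hom)

lemma blow_generators [simp]:
  "blow P (bconst c) = [:[:c:]:]"
  "blow P bX = [:[:fst P:], 1:]"
  "blow P bY = [:[:snd P:], [:0, 1:]:]"
  unfolding blow_def by (rule beval_generators[OF const_poly_poly_hom])+

lemma degree_coeff_mult_le:
  fixes p q :: "'a::comm_ring_1 poly poly"
  assumes "\<And>D. degree (coeff p D) \<le> D" "\<And>D. degree (coeff q D) \<le> D"
  shows "degree (coeff (p * q) D) \<le> D"
proof -
  have "degree (coeff p i * coeff q (D - i)) \<le> D" if "i \<le> D" for i
  proof -
    have "degree (coeff p i * coeff q (D - i)) \<le> degree (coeff p i) + degree (coeff q (D - i))"
      by (rule degree_mult_le)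
    also have "\<dots> \<le> i + (D - i)" by (intro add_mono assms)
    finally show ?thesis using that by simp
  qed
  then show ?thesis
    unfolding coeff_mult by (intro degree_sum_le) auto
qed

text \<open>The variable \<open>w\<close> enters only through the product \<open>w u\<close>, so its
  exponent never exceeds that of \<open>u\<close>. Hence a jet of degree \<open>D\<close> has only
  \<open>D + 1\<close> coordinates.\<close>

lemma degree_coeff_blow: "degree (coeff (blow P f) D) \<le> D"
proof (induction f arbitrary: D rule: bipoly_induct)
  case (add f g)
  then show ?case by (auto simp: blow.hom_add intro: degree_add_le)
next
  case (mult f g)
  then show ?case by (simp add: blow.hom_mult degree_coeff_mult_le)
qed (auto simp: coeff_pCons split: nat.split)

lemma blow_const_poly: "coeff (blow (0, 0) [:c:]) D = [:coeff c D:]"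
proof (induction c arbitrary: D)
  case (pCons a p)
  have "[:pCons a p:] = bconst a + bX * [:p:]" by simp
  then have "blow (0, 0) [:pCons a p:] = [:[:a:]:] + [:0, 1:] * blow (0, 0) [:p:]"
    by (simp only: blow.hom_add blow.hom_mult blow_generators fst_conv)
       simp
  then show ?case using pCons by (cases D) (simp_all)
qed simp

text \<open>At the origin \<open>x ^ i * y ^ j\<close> becomes \<open>u ^ (i + j) * w ^ j\<close>:
  the substitution only relabels monomials. Its injectivity and the description of
  \<open>tdeg\<close> by monomials rest on this.\<close>

lemma coeff_coeff_blow:
  "coeff (coeff (blow (0, 0) f) D) j = (if j \<le> D then coeff (coeff f j) (D - j) else 0)"
proof (induction f arbitrary: D j)
  case (pCons c f)
  have "pCons c f = [:c:] + bY * f" by simp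
  then have *: "blow (0, 0) (pCons c f) = blow (0, 0) [:c:] + [:0, [:0, 1:]:] * blow (0, 0) f"
    by (simp only: blow.hom_add blow.hom_mult blow_generators snd_conv)
       simp
  show ?case
  proof (cases D)
    case 0
    then show ?thesis by (cases j) (simp_all add: * blow_const_poly)
  next
    case (Suc D')
    then show ?thesis
      by (cases j) (simp_all add: * blow_const_poly pCons)
  qed
qed simp

section \<open>Total degree\<close>

definition tdeg :: "'a::comm_ring_1 poly poly \<Rightarrow> nat" where
  "tdeg f = degree (blow (0, 0) f)"

lemma blow_eq_0_iff [simp]: "blow (0, 0) f = 0 \<longleftrightarrow> f = 0"
proof
  assume *: "blow (0, 0) f = 0"
  have "coeff (coeff f j) i = 0" for i j
    using coeff_coeff_blow[of f "i + j" j] by (simp add: *)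
  then show "f = 0" by (simp add: poly_eq_iff)
qed simp

lemma tdeg_mult: "f \<noteq> 0 \<Longrightarrow> g \<noteq> 0 \<Longrightarrow> tdeg (f * g) = tdeg f + tdeg (g :: 'a::idom poly poly)"
  unfolding tdeg_def by (simp add: blow.hom_mult degree_mult_eq)

lemma tdeg_mult_le: "tdeg (f * g) \<le> tdeg f + tdeg g"
  unfolding tdeg_def by (simp add: blow.hom_mult degree_mult_le)

lemma tdeg_add_le: "tdeg f \<le> e \<Longrightarrow> tdeg g \<le> e \<Longrightarrow> tdeg (f + g) \<le> e"
  unfolding tdeg_def by (simp add: blow.hom_add degree_add_le)

lemma tdeg_diff_le: "tdeg f \<le> e \<Longrightarrow> tdeg g \<le> e \<Longrightarrow> tdeg (f - g) \<le> e"
  unfolding tdeg_def by (simp add: blow.hom_minus degree_diff_le)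

lemma tdeg_0 [simp]: "tdeg 0 = 0"
  by (simp add: tdeg_def)

lemma tdeg_sum_le: "(\<And>i. i \<in> S \<Longrightarrow> tdeg (f i) \<le> e) \<Longrightarrow> tdeg (sum f S) \<le> e"
  by (induction S rule: infinite_finite_induct) (auto intro: tdeg_add_le)

lemma tdeg_const [simp]: "tdeg (bconst c) = 0"
  by (simp add: tdeg_def)

lemma tdeg_1 [simp]: "tdeg 1 = 0"
  by (simp add: tdeg_def)

lemma tdeg_X [simp]: "tdeg bX = 1" and tdeg_Y [simp]: "tdeg bY = 1"
  by (simp_all add: tdeg_def)

lemma tdeg_smult_le: "tdeg (bconst c * f) \<le> tdeg f"
  using tdeg_mult_le[of "bconst c" f] by simp

lemma tdeg_le_iff: "tdeg f \<le> e \<longleftrightarrow> (\<forall>i j. coeff (coeff f j) i \<noteq> 0 \<longrightarrow> i + j \<le> e)"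
proof
  assume *: "tdeg f \<le> e"
  show "\<forall>i j. coeff (coeff f j) i \<noteq> 0 \<longrightarrow> i + j \<le> e"
  proof (intro allI impI, rule ccontr)
    fix i j assume "coeff (coeff f j) i \<noteq> 0" "\<not> i + j \<le> e"
    moreover have "coeff (blow (0, 0) f) (i + j) = 0"
      using * \<open>\<not> i + j \<le> e\<close> by (intro coeff_eq_0) (simp add: tdeg_def)
    ultimately show False using coeff_coeff_blow[of f "i + j" j] by simp
  qed
next
  assume *: "\<forall>i j. coeff (coeff f j) i \<noteq> 0 \<longrightarrow> i + j \<le> e"
  have "coeff (blow (0, 0) f) D = 0" if "D > e" for D
    using * that by (intro poly_eqI) (force simp: coeff_coeff_blow)
  then show "tdeg f \<le> e" unfolding tdeg_def by (intro degree_le) auto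
qed

lemma tdeg_const_poly: "tdeg [:c:] = degree c"
proof -
  have "blow (0, 0) [:c:] = map_poly (\<lambda>a. [:a:]) c"
    by (simp add: poly_eq_iff[of "blow (0,0) [:c:]"] blow_const_poly coeff_map_poly)
  then show ?thesis unfolding tdeg_def by (simp add: degree_map_poly)
qed

lemma tdeg_power_le: "tdeg (f ^ i) \<le> i * tdeg f"
  unfolding tdeg_def by (metis blow.hom_power degree_power_le mult.commute)

lemma tdeg_prod_le: "tdeg (\<Prod>i\<in>S. f i) \<le> (\<Sum>i\<in>S. tdeg (f i))"
proof (induction S rule: infinite_finite_induct)
  case (insert x F)
  have "tdeg (f x * prod f F) \<le> tdeg (f x) + tdeg (prod f F)" by (rule tdeg_mult_le)
  with insert show ?case by simp
qed (simp_all)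

lemma bipoly_expand:
  assumes "tdeg f \<le> e"
  shows "f = (\<Sum>(i, j)\<in>{(i, j). i + j \<le> e}. bconst (coeff (coeff f j) i) * (bX ^ i * bY ^ j))"
proof -
  have mon: "bconst c * (bX ^ i * bY ^ j) = monom (monom c i) j" for c :: 'a and i j
  proof -
    have "[:[:0, 1:]:] ^ i = [:monom 1 i :: 'a poly:]"
      by (induction i) (simp_all add: monom_Suc one_pCons)
    moreover have "[:0, 1:] ^ j = (monom 1 j :: 'a poly poly)"
      by (simp add: monom_altdef)
    ultimately show ?thesis by (simp add: smult_monom)
  qed
  have fin: "finite {(i, j). i + j \<le> e}"
    by (rule finite_subset[of _ "{..e} \<times> {..e}"]) auto
  show ?thesis
  proof (intro poly_eqI, goal_cases)
    case (1 n m)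
    have "coeff (coeff (\<Sum>(i, j)\<in>{(i, j). i + j \<le> e}. bconst (coeff (coeff f j) i) * (bX ^ i * bY ^ j)) n) m
        = (\<Sum>x\<in>{(i, j). i + j \<le> e}. if x = (m, n) then coeff (coeff f n) m else 0)"
      unfolding mon coeff_sum case_prod_unfold
      by (intro sum.cong) (auto simp: coeff_sum)
    also have "\<dots> = coeff (coeff f n) m"
      using assms fin by (auto simp: sum.delta tdeg_le_iff)
    finally show ?case by simp
  qed
qed

lemma tdeg_induct [consumes 1, case_names mono add]:
  assumes "tdeg f \<le> e"
    and mono: "\<And>c i j. i + j \<le> e \<Longrightarrow> Q (bconst c * (bX ^ i * bY ^ j))"
    and add: "\<And>f g. Q f \<Longrightarrow> Q g \<Longrightarrow> Q (f + g)"
  shows "Q f"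
proof -
  have Q0: "Q 0" using mono[of 0 0 0] by simp
  have "Q (\<Sum>(i, j)\<in>S. bconst (coeff (coeff f j) i) * (bX ^ i * bY ^ j))"
    if "S \<subseteq> {(i, j). i + j \<le> e}" for S
    using that
  proof (induction S rule: infinite_finite_induct)
    case (insert x S)
    then have "Q (bconst (coeff (coeff f (snd x)) (fst x)) * (bX ^ fst x * bY ^ snd x))"
      by (intro mono) auto
    then show ?case using insert by (simp add: case_prod_unfold add)
  qed (simp_all add: Q0)
  from this[OF subset_refl] bipoly_expand[OF assms(1)] show ?thesis by simp
qed

section \<open>Order of vanishing at a point\<close>

definition vanish :: "'a::comm_ring_1 \<times> 'a \<Rightarrow> nat \<Rightarrow> 'a poly poly \<Rightarrow> bool" where
  "vanish P m f \<longleftrightarrow> monom 1 m dvd blow P f"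

lemma vanish_0 [simp]: "vanish P 0 f"
  by (simp add: vanish_def monom_1_dvd_iff')

lemma vanish_zero [simp]: "vanish P m 0"
  by (simp add: vanish_def)

lemma vanish_add: "vanish P m f \<Longrightarrow> vanish P m g \<Longrightarrow> vanish P m (f + g)"
  by (simp add: vanish_def blow.hom_add)

lemma vanish_diff: "vanish P m f \<Longrightarrow> vanish P m g \<Longrightarrow> vanish P m (f - g)"
  by (simp add: vanish_def blow.hom_minus)

lemma vanish_sum: "(\<And>i. i \<in> S \<Longrightarrow> vanish P m (f i)) \<Longrightarrow> vanish P m (sum f S)"
  by (induction S rule: infinite_finite_induct) (auto intro: vanish_add)

lemma vanish_mult: "vanish P m f \<Longrightarrow> vanish P k g \<Longrightarrow> vanish P (m + k) (f * g)"
proof -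
  assume "vanish P m f" "vanish P k g"
  then have "monom 1 m * monom 1 k dvd blow P f * blow P g"
    unfolding vanish_def by (rule mult_dvd_mono)
  then show ?thesis by (simp add: vanish_def mult_monom blow.hom_mult)
qed

lemma vanish_multL: "vanish P m f \<Longrightarrow> vanish P m (f * g)"
  using vanish_mult[of P m f 0 g] by simp

lemma vanish_multR: "vanish P m g \<Longrightarrow> vanish P m (f * g)"
  using vanish_mult[of P 0 f m g] by simp

lemma vanish_mono: "vanish P m f \<Longrightarrow> k \<le> m \<Longrightarrow> vanish P k f"
  by (simp add: vanish_def monom_1_dvd_iff')

lemma vanish_power: "vanish P 1 f \<Longrightarrow> vanish P m (f ^ m)"
proof (induction m)
  case (Suc m)
  then show ?case using vanish_mult[of P 1 f m "f ^ m"] by simp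
qed simp

definition bvalue :: "'a::comm_ring_1 \<times> 'a \<Rightarrow> 'a poly poly \<Rightarrow> 'a" where
  "bvalue P f = poly (poly f [:snd P:]) (fst P)"

interpretation bvalue: comm_ring_hom "bvalue P"
  by unfold_locales (simp_all add: bvalue_def)

lemma bvalue_generators:
  "bvalue P (bconst c) = c" "bvalue P bX = fst P" "bvalue P bY = snd P"
  by (simp_all add: bvalue_def)

lemma coeff_0_blow: "coeff (blow P f) 0 = [:bvalue P f:]"
proof (induction f rule: bipoly_induct)
  case (mult f g)
  then show ?case by (simp add: blow.hom_mult bvalue.hom_mult coeff_mult)
qed (simp_all add: bvalue_def blow.hom_add)

lemma vanish_1_iff: "vanish P 1 f \<longleftrightarrow> bvalue P f = 0"
  by (simp add: vanish_def monom_1_dvd_iff' coeff_0_blow)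

text \<open>A nonzero constant coefficient need not be invertible (in the applications it is a
  polynomial in \<open>w\<close>), but in a domain it suffices: the lowest coefficients are compared
  one degree at a time.\<close>

lemma monom_dvd_mult_cancel:
  fixes p q :: "'a::idom poly"
  assumes "monom 1 m dvd q * p" "coeff q 0 \<noteq> 0"
  shows "monom 1 m dvd p"
  using assms(1)
proof (induction m)
  case 0
  then show ?case by (simp add: monom_1_dvd_iff')
next
  case (Suc m)
  then have "monom 1 m dvd q * p" by (auto simp: monom_1_dvd_iff')
  then have "monom 1 m dvd p" by (rule Suc.IH)
  then obtain r where r: "p = monom 1 m * r" by blast
  have "coeff (q * p) m = 0" using Suc.prems by (auto simp: monom_1_dvd_iff')
  moreover have "q * p = monom 1 m * (q * r)" by (simp add: r)
  moreover have "coeff (monom 1 m * (q * r)) m = coeff q 0 * coeff r 0"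
    by (subst coeff_monom_mult) (simp add: coeff_mult)
  ultimately have "coeff q 0 * coeff r 0 = 0" by simp
  then have "coeff r 0 = 0" using assms(2) by simp
  then have "coeff p m = 0" by (simp add: r coeff_monom_mult)
  with \<open>monom 1 m dvd p\<close> show ?case by (auto simp: monom_1_dvd_iff' less_Suc_eq)
qed

lemma vanish_cancel_unit:
  fixes f g :: "'a::idom poly poly"
  assumes "vanish P m (g * f)" "bvalue P g \<noteq> 0"
  shows "vanish P m f"
  using assms monom_dvd_mult_cancel[of m "blow P g" "blow P f"]
  by (simp add: vanish_def blow.hom_mult coeff_0_blow)

text \<open>A factor with nonzero linear term is either nonzero at the point or vanishes there to
  order exactly one, so dividing by it costs at most one order.\<close>

lemma vanish_cancel_simple:
  fixes f g :: "'a::idom poly poly"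
  assumes "vanish P m (g * f)" "coeff (blow P g) 1 \<noteq> 0"
  shows "vanish P (m - 1) f"
proof (cases "bvalue P g = 0")
  case False
  then show ?thesis using vanish_cancel_unit[OF assms(1)] vanish_mono by fastforce
next
  case True
  then have 0: "coeff (blow P g) 0 = 0" by (simp add: coeff_0_blow)
  obtain r where r: "blow P g = [:0, 1:] * r"
    using 0 by (cases "blow P g") auto
  have *: "coeff r 0 \<noteq> 0" using assms(2) r by simp
  show ?thesis
  proof (cases m)
    case (Suc m')
    have "monom 1 1 * monom 1 m' dvd [:0, 1:] * (r * blow P f)"
      using assms(1) by (simp add: vanish_def blow.hom_mult r Suc mult_monom)
    moreover have "monom 1 1 = ([:0, 1:] :: 'a poly poly)" by (simp add: monom_altdef)
    ultimately have "monom 1 m' dvd r * blow P f"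
      by (metis dvd_mult_cancel_left pCons_eq_0_iff zero_neq_one)
    then show ?thesis using monom_dvd_mult_cancel * by (auto simp: vanish_def Suc)
  qed simp
qed

section \<open>Tangent lines of a conic\<close>

text \<open>
  The plane is the symmetric square of the line: the point \<open>(a + b, a b)\<close> corresponds to the
  unordered pair \<open>{a, b}\<close>, and the pairs containing \<open>a\<close> form the line \<open>y = a x - a\<^sup>2\<close>, with
  parameter \<open>b\<close>. Configurations of points on such lines are therefore graphs on the field.
\<close>

definition pair_point :: "'a::comm_ring_1 \<Rightarrow> 'a \<Rightarrow> 'a \<times> 'a" where
  "pair_point a b = (a + b, a * b)"

definition lform :: "'a::comm_ring_1 \<Rightarrow> 'a poly poly" where
  "lform a = [:[:a ^ 2, - a:], 1:]"

text \<open>Restriction to the line of \<open>a\<close>, parametrized by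
  \<open>b \<mapsto> pair_point a b\<close>, so that the node with the line of \<open>b\<close> has
  the parameter \<open>b\<close>.\<close>

definition rline :: "'a::comm_ring_1 \<Rightarrow> 'a poly poly \<Rightarrow> 'a poly" where
  "rline a = beval (\<lambda>c. [:c:]) [:a, 1:] [:0, a:]"

interpretation rline: comm_ring_hom "rline a"
  unfolding rline_def by (intro beval_hom const_poly_hom)

lemma rline_generators [simp]:
  "rline a (bconst c) = [:c:]" "rline a bX = [:a, 1:]" "rline a bY = [:0, a:]"
  unfolding rline_def by (rule beval_generators[OF const_poly_hom])+

lemma pair_point_commute: "pair_point a b = pair_point b a"
  by (simp add: pair_point_def algebra_simps)

lemma lform_altdef: "lform a = bY - bconst a * bX + bconst (a ^ 2)"
  by (simp add: lform_def)

lemma lform_neq_0 [simp]: "lform a \<noteq> 0"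
  by (simp add: lform_def)

lemma tdeg_lform [simp]: "tdeg (lform a) = 1"
proof -
  have "blow (0, 0) (lform a) = [:[:a ^ 2:], [:-a, 1:]:]"
    by (simp only: lform_altdef blow.hom_add blow.hom_minus blow.hom_mult blow_generators) simp
  then show ?thesis by (simp add: tdeg_def)
qed

text \<open>The linear term \<open>w - a\<close> is never zero, so
  \<open>vanish_cancel_simple\<close> applies to each line at each point. Over a domain the constant
  term vanishes exactly if \<open>a\<close> belongs to the pair.\<close>

lemma blow_lform:
  "blow (pair_point b c) (lform a) = [:[:(b - a) * (c - a):], [:-a, 1:]:]"
  by (simp only: lform_altdef blow.hom_add blow.hom_minus blow.hom_mult blow_generators)
    (simp add: pair_point_def algebra_simps power2_eq_square)

lemma bvalue_lform: "bvalue (pair_point b c) (lform a) = (b - a) * (c - a)"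
  using coeff_0_blow[of "pair_point b c" "lform a"] by (simp add: blow_lform)

lemma rline_lform: "rline c (lform a) = Polynomial.smult (c - a) [:-a, 1:]"
  by (simp only: lform_altdef rline.hom_add rline.hom_minus rline.hom_mult rline_generators)
    (simp add: algebra_simps power2_eq_square)

text \<open>The line has slope \<open>a\<close>, so setting \<open>w = a\<close> in
  \<open>blow\<close> runs along it, and \<open>u\<close> becomes \<open>z - b\<close> for the line
  parameter \<open>z\<close>. The homomorphism \<open>\<chi>\<close> performs this
  substitution.\<close>

lemma vanish_rline:
  assumes "vanish (pair_point a b) m f"
  shows "[:-b, 1:] ^ m dvd rline a f"
proof -
  define \<chi> where "\<chi> = beval (\<lambda>c. [:c:]) [:a:] [:-b, 1:]"
  interpret \<chi>: comm_ring_hom \<chi>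
    unfolding \<chi>_def by (intro beval_hom const_poly_hom)
  note \<chi>_gen = beval_generators[OF const_poly_hom, of "[:a:]" "[:-b, 1:]", folded \<chi>_def]
  have comp: "comm_ring_hom (\<lambda>f. \<chi> (blow (pair_point a b) f))"
    by unfold_locales (simp_all add: blow.hom_add \<chi>.hom_add blow.hom_mult \<chi>.hom_mult)
  have X: "\<chi> [:[:a + b:], 1:] = [:a, 1:]"
  proof -
    have "[:[:a + b:], 1:] = bconst (a + b) + bY" by simp
    then show ?thesis by (simp only: \<chi>.hom_add \<chi>_gen) simp
  qed
  have Y: "\<chi> [:[:a * b:], [:0, 1:]:] = [:0, a:]"
  proof -
    have "[:[:a * b:], [:0, 1:]:] = bconst (a * b) + bX * bY" by simp
    then show ?thesis by (simp only: \<chi>.hom_add \<chi>.hom_mult \<chi>_gen) simp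
  qed
  have "\<chi> (blow (pair_point a b) f) = rline a f"
    by (rule hom_eqI[OF comp rline.comm_ring_hom_axioms])
      (simp_all add: \<chi>_gen pair_point_def X Y)
  moreover have "\<chi> (monom 1 m) dvd \<chi> (blow (pair_point a b) f)"
    using assms unfolding vanish_def by (rule \<chi>.hom_dvd)
  moreover have "\<chi> (monom 1 m) = [:-b, 1:] ^ m"
  proof -
    have "(monom 1 m :: 'a poly poly) = bY ^ m" by (simp add: monom_altdef)
    then show ?thesis by (simp only: \<chi>.hom_power \<chi>_gen)
  qed
  ultimately show ?thesis by simp
qed

lemma rline_eq: "rline a f = pcompose (poly f [:- (a ^ 2), a:]) [:a, 1:]"
proof -
  have "comm_ring_hom (\<lambda>f. pcompose (poly f [:- (a ^ 2), a:]) [:a, 1:])"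
    by unfold_locales (simp_all add: pcompose_add pcompose_mult pcompose_1)
  then show ?thesis
    by (rule hom_eqI[OF rline.comm_ring_hom_axioms])
      (simp_all add: pcompose_pCons algebra_simps power2_eq_square)
qed

text \<open>The equation of the line is monic of degree one in \<open>y\<close>, so this is the
  factor theorem over the polynomials in \<open>x\<close>.\<close>

lemma lform_dvd_iff: "lform a dvd f \<longleftrightarrow> rline a f = (0 :: 'a::idom poly)"
proof -
  have "lform a = [:- [:- (a ^ 2), a:], 1:]" by (simp add: lform_def)
  then have "lform a dvd f \<longleftrightarrow> poly f [:- (a ^ 2), a:] = 0"
    by (simp add: poly_eq_0_iff_dvd)
  also have "\<dots> \<longleftrightarrow> rline a f = 0"
    by (simp add: rline_eq pcompose_eq_0_iff)
  finally show ?thesis .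
qed

lemma poly_rline: "poly (rline a f) b = bvalue (pair_point a b) f"
proof (induction f rule: bipoly_induct)
  case X
  show ?case by (simp add: pair_point_def bvalue_def)
next
  case Y
  show ?case by (simp add: pair_point_def bvalue_def mult.commute)
qed (simp_all add: rline.hom_add rline.hom_mult bvalue.hom_add bvalue.hom_mult bvalue_generators
      del: mult_pCons_left mult_pCons_right)

lemma degree_rline_le: "degree (rline a f) \<le> tdeg f"
proof -
  have "degree (rline a f) \<le> e" if "tdeg f \<le> e" for e
    using that
  proof (induction rule: tdeg_induct)
    case (mono c i j)
    have "degree ([:c:] * ([:a, 1:] ^ i * [:0, a:] ^ j)) \<le> degree [:c:] + degree ([:a, 1:] ^ i * [:0, a:] ^ j)"
      by (rule degree_mult_le)
    also have "\<dots> \<le> degree ([:a, 1:] ^ i) + degree ([:0, a:] ^ j)"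
      using degree_mult_le[of "[:a, 1:] ^ i" "[:0, a:] ^ j"] by simp
    also have "\<dots> \<le> 1 * i + 1 * j"
      by (intro add_mono order.trans[OF degree_power_le] mult_right_mono) auto
    finally show ?case using mono by (simp add: rline.hom_mult rline.hom_power del: mult_pCons_left)
  next
    case (add f g)
    then show ?case by (simp add: rline.hom_add degree_add_le)
  qed
  then show ?thesis by blast
qed

text \<open>Extension from the line of \<open>a\<close> to the plane, constant in the direction of
  \<open>y\<close>. Over a domain it keeps the degree, and it turns each order of vanishing on the
  line into one in the plane.\<close>

definition cone :: "'a::comm_ring_1 \<Rightarrow> 'a poly \<Rightarrow> 'a poly poly" where
  "cone a g = [:pcompose g [:-a, 1:]:]"

lemma rline_cone [simp]: "rline a (cone a g) = g"
  by (simp add: rline_eq cone_def flip: pcompose_assoc)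
    (simp add: pcompose_pCons pcompose_idR)

lemma tdeg_cone: "tdeg (cone a g) = degree (g :: 'a::idom poly)"
  by (simp add: cone_def tdeg_const_poly degree_pcompose)

lemma vanish_cone:
  assumes "[:-b, 1:] ^ m dvd g"
  shows "vanish (pair_point a b) m (cone a g)"
proof -
  from assms obtain r where r: "g = [:-b, 1:] ^ m * r" by blast
  have "cone a g = [:pcompose ([:-b, 1:] ^ m) [:-a, 1:]:] * cone a r"
    by (simp add: cone_def r pcompose_mult)
  moreover have "[:pcompose ([:-b, 1:] ^ m) [:-a, 1:]:] = [:[:-(a + b), 1:]:] ^ m"
  proof (induction m)
    case (Suc m)
    have "[:pcompose ([:-b, 1:] ^ Suc m) [:-a, 1:]:]
        = [:pcompose [:-b, 1:] [:-a, 1:]:] * [:pcompose ([:-b, 1:] ^ m) [:-a, 1:]:]"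
      by (simp only: power_Suc pcompose_mult) simp
    also have "\<dots> = [:[:-(a + b), 1:]:] ^ Suc m"
      by (simp only: Suc) (simp add: pcompose_pCons algebra_simps)
    finally show ?case .
  qed (simp add: pcompose_1)
  moreover have "vanish (pair_point a b) m ([:[:-(a + b), 1:]:] ^ m)"
    by (intro vanish_power) (simp only: vanish_1_iff, simp add: bvalue_def pair_point_def)
  ultimately show ?thesis by (simp add: vanish_multL)
qed

lemma vanish_lform_self: "vanish (pair_point a b) 1 (lform a)"
  by (simp only: vanish_1_iff bvalue_lform) simp

text \<open>Modulo a multiple of \<open>lform a\<close>, \<open>f\<close> may be replaced by the
  \<open>cone\<close> over its restriction, whose order in the plane is governed by the order on the
  line.\<close>

lemma vanish_line_decomp:
  fixes f :: "'a::idom poly poly"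
  assumes "[:-b, 1:] ^ m dvd rline a f"
  shows "\<exists>g. vanish (pair_point a b) m (f - lform a * g)"
proof -
  have "rline a (f - cone a (rline a f)) = 0" by (simp add: rline.hom_minus)
  then have "lform a dvd f - cone a (rline a f)" by (simp add: lform_dvd_iff)
  then obtain g where "f - cone a (rline a f) = lform a * g" by blast
  then have "f - lform a * g = cone a (rline a f)" by (simp add: algebra_simps)
  then show ?thesis using vanish_cone[OF assms] by metis
qed

lemma vanish_lform_cancel:
  fixes f :: "'a::idom poly poly"
  assumes "vanish (pair_point b c) m (lform a * f)"
  shows "vanish (pair_point b c) (m - (if a \<in> {b, c} then 1 else 0)) f"
proof (cases "a \<in> {b, c}")
  case True
  then show ?thesis using vanish_cancel_simple[OF assms] by (simp add: blow_lform)
next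
  case False
  then have "vanish (pair_point b c) m f"
    using vanish_cancel_unit[OF assms] by (auto simp: bvalue_lform)
  with False show ?thesis by simp
qed

text \<open>The lines are split off one after another. Those already removed restrict to a nonzero
  polynomial on the next one, so the quotient still vanishes there; each removal costs one order at
  the points of the removed line.\<close>

lemma lines_divide:
  fixes f :: "'a::idom poly poly"
  assumes "finite V" "\<And>a. a \<in> V \<Longrightarrow> rline a f = 0"
  obtains g where "f = (\<Prod>a\<in>V. lform a) * g"
    "f \<noteq> 0 \<Longrightarrow> tdeg f = card V + tdeg g"
    "\<And>b c m. b \<noteq> c \<Longrightarrow> vanish (pair_point b c) m f \<Longrightarrow>
       vanish (pair_point b c) (m - card (V \<inter> {b, c})) g"
proof -
  have "\<exists>g. f = (\<Prod>a\<in>V. lform a) * g \<and> (f \<noteq> 0 \<longrightarrow> tdeg f = card V + tdeg g) \<and>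
     (\<forall>b c m. b \<noteq> c \<longrightarrow> vanish (pair_point b c) m f \<longrightarrow>
       vanish (pair_point b c) (m - card (V \<inter> {b, c})) g)"
    using assms
  proof (induction V rule: finite_induct)
    case empty
    show ?case by (intro exI[of _ f]) simp
  next
    case (insert a V)
    then obtain g where g: "f = (\<Prod>a\<in>V. lform a) * g"
        "f \<noteq> 0 \<Longrightarrow> tdeg f = card V + tdeg g"
        "\<And>b c m. b \<noteq> c \<Longrightarrow> vanish (pair_point b c) m f \<Longrightarrow>
          vanish (pair_point b c) (m - card (V \<inter> {b, c})) g"
      by auto
    have "rline a (\<Prod>a\<in>V. lform a) \<noteq> 0"
      using insert.hyps by (auto simp: rline.hom_prod rline_lform prod_zero_iff)
    moreover have "rline a (\<Prod>a\<in>V. lform a) * rline a g = 0"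
      using insert.prems g(1) rline.hom_mult by (metis insertI1)
    ultimately have "rline a g = 0" by simp
    then obtain h where h: "g = lform a * h" using lform_dvd_iff by blast
    show ?case
    proof (intro exI[of _ h] conjI impI allI)
      show "f = (\<Prod>a\<in>insert a V. lform a) * h"
        using insert.hyps g(1) h by simp
      assume "f \<noteq> 0"
      then have "g \<noteq> 0" "h \<noteq> 0" using g(1) h by auto
      then show "tdeg f = card (insert a V) + tdeg h"
        using g(2)[OF \<open>f \<noteq> 0\<close>] insert.hyps by (simp add: h tdeg_mult)
    next
      fix b c m assume "b \<noteq> c" "vanish (pair_point b c) m f"
      then have "vanish (pair_point b c) (m - card (V \<inter> {b, c})) g" by (rule g(3))
      from vanish_lform_cancel[OF this[unfolded h]]
      have "vanish (pair_point b c) (m - card (V \<inter> {b, c}) - (if a \<in> {b, c} then 1 else 0)) h" .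
      moreover have "card (insert a V \<inter> {b, c}) = card (V \<inter> {b, c}) + (if a \<in> {b, c} then 1 else 0)"
        using insert.hyps by (auto simp: Int_insert_left)
      ultimately show "vanish (pair_point b c) (m - card (insert a V \<inter> {b, c})) h" by simp
    qed
  qed
  then show ?thesis using that by blast
qed

lemma prod_linear_power_dvd:
  fixes p :: "'a::field poly"
  assumes "finite B" "\<And>b. b \<in> B \<Longrightarrow> [:-b, 1:] ^ m dvd p"
  shows "(\<Prod>b\<in>B. [:-b, 1:]) ^ m dvd p"
  using assms
proof (induction B rule: finite_induct)
  case (insert b B)
  define Q where "Q = (\<Prod>b\<in>B. [:-b, 1:])"
  have "Q ^ m dvd p" unfolding Q_def using insert by simp
  then obtain r where r: "p = Q ^ m * r" by blast
  have dvd: "[:-b, 1:] ^ m dvd Q ^ m * r" using insert.prems[of b] unfolding r by simp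
  have Qb: "poly Q b \<noteq> 0"
    using insert.hyps by (auto simp: Q_def poly_prod prod_zero_iff)
  have "[:-b, 1:] ^ m dvd r"
  proof (cases "r = 0")
    case False
    moreover have "Q \<noteq> 0" using Qb by auto
    ultimately have "m \<le> order b (Q ^ m) + order b r"
      using dvd by (simp add: order_divides order_mult)
    moreover have "order b (Q ^ m) = 0" using Qb by (simp add: order_0I)
    ultimately show ?thesis by (simp add: order_divides)
  qed simp
  then have "[:-b, 1:] ^ m * Q ^ m dvd p"
    unfolding r by (metis dvd_refl mult.commute mult_dvd_mono)
  then show ?case using insert.hyps by (simp add: power_mult_distrib Q_def del: mult_pCons_left)
qed simp

lemma rline_dvd:
  fixes f :: "'a::field poly poly"
  assumes "finite B" "\<And>b. b \<in> B \<Longrightarrow> vanish (pair_point a b) m f"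
  shows "(\<Prod>b\<in>B. [:-b, 1:]) ^ m dvd rline a f"
  using assms by (intro prod_linear_power_dvd vanish_rline)

lemma degree_prod_linear: "degree (\<Prod>b\<in>B. [:-b, 1 :: 'a::idom:]) = card B"
proof (induction B rule: infinite_finite_induct)
  case (insert b B)
  have "(\<Prod>b\<in>B. [:-b, 1 :: 'a:]) \<noteq> 0" by (cases "finite B") (auto simp: prod_zero_iff)
  with insert show ?case by (subst prod.insert) (simp_all add: degree_mult_eq del: mult_pCons_left)
qed simp_all

section \<open>Powers of the ideal of a point\<close>

text \<open>Finite sums without ring multiples: some of the generating sets below carry degree
  bounds, which an ideal span would destroy.\<close>

inductive_set add_span :: "'r::comm_monoid_add set \<Rightarrow> 'r set" for S where
  zero [simp, intro]: "0 \<in> add_span S"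
| insert: "a \<in> S \<Longrightarrow> b \<in> add_span S \<Longrightarrow> a + b \<in> add_span S"

lemma add_span_base: "a \<in> S \<Longrightarrow> a \<in> add_span S"
  using add_span.insert[of a S 0] by auto

lemma add_span_add: "a \<in> add_span S \<Longrightarrow> b \<in> add_span S \<Longrightarrow> a + b \<in> add_span S"
  by (induction rule: add_span.induct) (auto simp: add.assoc intro: add_span.insert)

lemma add_span_sum: "(\<And>i. i \<in> I \<Longrightarrow> f i \<in> add_span S) \<Longrightarrow> sum f I \<in> add_span S"
  by (induction I rule: infinite_finite_induct) (auto intro: add_span_add)

lemma add_span_mono: "a \<in> add_span S \<Longrightarrow> S \<subseteq> S' \<Longrightarrow> a \<in> add_span S'"
  by (induction rule: add_span.induct) (auto intro: add_span.insert)

text \<open>Split off \<open>f(x, q)\<close>: the rest is divisible by \<open>y - q\<close>, and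
  \<open>f(x, q)\<close> itself by \<open>x - p\<close>. Both parts keep the order
  \<open>Suc m\<close>, so each quotient loses one order and one degree. The degree bounds make the
  decomposition compatible with homogenization.\<close>

lemma vanish_SucE:
  fixes f :: "'a::idom poly poly"
  assumes "vanish P (Suc m) f"
  obtains f1 f2 where
    "f = (bX - bconst (fst P)) * f1 + (bY - bconst (snd P)) * f2"
    "vanish P m f1" "vanish P m f2" "tdeg f1 \<le> tdeg f - 1" "tdeg f2 \<le> tdeg f - 1"
proof -
  define p q where "p = fst P" and "q = snd P"
  define g where "g = [:poly f [:q:]:]"
  have lin: "[:- [:q:], 1:] = bY - bconst q" "[:[:- p, 1:]:] = bX - bconst p" by simp_all
  have "poly (f - g) [:q:] = 0" by (simp add: g_def)
  then have "bY - bconst q dvd f - g" unfolding poly_eq_0_iff_dvd lin .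
  then obtain f2 where f2: "f - g = (bY - bconst q) * f2" by blast
  have "poly (poly f [:q:]) p = 0"
  proof -
    have "vanish P 1 f" using assms by (rule vanish_mono) simp
    then show ?thesis by (simp only: vanish_1_iff bvalue_def p_def q_def)
  qed
  then have "[:-p, 1:] dvd poly f [:q:]" by (simp add: poly_eq_0_iff_dvd)
  then obtain r where r: "poly f [:q:] = [:-p, 1:] * r" by blast
  define f1 where "f1 = [:r:]"
  have "g = [:[:-p, 1:]:] * f1" by (simp add: g_def r f1_def)
  then have g: "g = (bX - bconst p) * f1" unfolding lin .
  have eq: "f = (bX - bconst p) * f1 + (bY - bconst q) * f2"
    using f2 g by (simp add: algebra_simps)
  have van_g: "vanish P (Suc m) g"
  proof -
    \<comment> \<open>Setting \<open>w = 0\<close> replaces \<open>y\<close> by the constant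
      \<open>q\<close>; therefore \<open>f(x, q)\<close> inherits the order of
      \<open>f\<close>.\<close>
    define \<chi> where "\<chi> = beval (\<lambda>a::'a. [:[:a:]:]) 0 bY"
    interpret \<chi>: comm_ring_hom \<chi>
      unfolding \<chi>_def by (intro beval_hom const_poly_poly_hom)
    note \<chi>_gen = beval_generators[OF const_poly_poly_hom, of "0 :: 'a poly poly" bY, folded \<chi>_def]
    have "\<chi> (blow P f) = blow P [:poly f [:q:]:]"
    proof (rule hom_eqI[where F = "\<lambda>f. \<chi> (blow P f)" and G = "\<lambda>f. blow P [:poly f [:q:]:]"])
      show "comm_ring_hom (\<lambda>f. \<chi> (blow P f))"
        by unfold_locales (simp_all add: blow.hom_add \<chi>.hom_add blow.hom_mult \<chi>.hom_mult)
      have *: "[:a + b:] = [:a:] + [:b:]" "[:a * b:] = [:a:] * [:b:]" for a b :: "'a poly"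
        by simp_all
      show "comm_ring_hom (\<lambda>f. blow P [:poly f [:q:]:])"
        by unfold_locales
          (simp_all only: poly_add poly_mult poly_1 poly_0 * blow.hom_add blow.hom_mult
            flip: one_pCons, simp_all)
      show "\<chi> (blow P (bconst c)) = blow P [:poly (bconst c) [:q:]:]" for c
        by (simp add: \<chi>_gen)
      have "[:[:p:], 1:] = bconst p + bY" by simp
      then have "\<chi> [:[:p:], 1:] = bconst p + bY" by (simp only: \<chi>.hom_add \<chi>_gen)
      then show "\<chi> (blow P bX) = blow P [:poly bX [:q:]:]"
        by (simp add: p_def)
      have "[:[:q:], [:0, 1:]:] = bconst q + bX * bY" by simp
      then have "\<chi> [:[:q:], [:0, 1:]:] = bconst q"
        by (simp only: \<chi>.hom_add \<chi>.hom_mult \<chi>_gen) simp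
      then show "\<chi> (blow P bY) = blow P [:poly bY [:q:]:]"
        by (simp add: q_def)
    qed
    moreover have "\<chi> (monom 1 (Suc m)) dvd \<chi> (blow P f)"
      using assms unfolding vanish_def by (rule \<chi>.hom_dvd)
    moreover have "\<chi> (monom 1 (Suc m)) = monom 1 (Suc m)"
    proof -
      have "(monom 1 (Suc m) :: 'a poly poly) = bY ^ Suc m" by (simp add: monom_altdef)
      then show ?thesis by (simp only: \<chi>.hom_power \<chi>_gen)
    qed
    ultimately show ?thesis by (simp add: vanish_def g_def)
  qed
  have "vanish P (Suc m - 1) f1"
    using van_g unfolding g
    by (rule vanish_cancel_simple) (simp only: blow.hom_minus blow_generators, simp)
  moreover have "vanish P (Suc m - 1) f2"
    using vanish_diff[OF assms van_g] unfolding f2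
    by (rule vanish_cancel_simple) (simp only: blow.hom_minus blow_generators, simp add: q_def)
  moreover have tg: "tdeg g \<le> tdeg f"
  proof -
    have "degree (poly f [:q:]) \<le> e" if "tdeg f \<le> e" for e
      using that
    proof (induction rule: tdeg_induct)
      case (mono c i j)
      have "poly (bconst c * (bX ^ i * bY ^ j)) [:q:] = monom (c * q ^ j) i"
        by (simp add: monom_altdef mult.commute flip: power_mult_distrib)
          (simp add: poly_const_pow)
      then show ?case using mono by (simp add: order.trans[OF degree_monom_le])
    qed (auto intro: degree_add_le)
    then show ?thesis by (simp add: g_def tdeg_const_poly)
  qed
  moreover have "tdeg f1 \<le> tdeg f - 1"
  proof (cases "f1 = 0")
    case False
    have "tdeg (bX - bconst p) = 1"
      by (simp only: tdeg_def blow.hom_minus blow_generators) simp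
    moreover from this have "bX - bconst p \<noteq> 0" by (metis tdeg_0 zero_neq_one)
    ultimately have "tdeg g = 1 + tdeg f1" unfolding g using False by (subst tdeg_mult) auto
    then show ?thesis using tg by simp
  qed simp
  moreover have "tdeg f2 \<le> tdeg f - 1"
  proof (cases "f2 = 0")
    case False
    have "tdeg (bY - bconst q) = 1"
      by (simp only: tdeg_def blow.hom_minus blow_generators) simp
    moreover from this have "bY - bconst q \<noteq> 0" by (metis tdeg_0 zero_neq_one)
    ultimately have "tdeg (f - g) = 1 + tdeg f2" unfolding f2 using False by (subst tdeg_mult) auto
    then show ?thesis using tdeg_diff_le[OF order.refl tg] by simp
  qed simp
  ultimately show ?thesis using that eq by (simp add: p_def q_def)
qed

lemma vanish_X: "vanish P 1 (bX - bconst (fst P))" and vanish_Y: "vanish P 1 (bY - bconst (snd P))"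
  unfolding vanish_1_iff by (simp_all add: bvalue_def)

text \<open>The maximal ideal of the point is generated by two linear polynomials, so linear factors
  can be peeled off one at a time and collected in \<open>a\<close>.\<close>

lemma vanish_split:
  fixes f :: "'a::idom poly poly"
  assumes "vanish P (m + k) f"
  shows "f \<in> add_span {a * b | a b. vanish P m a \<and> vanish P k b}"
  using assms
proof (induction m arbitrary: f)
  case 0
  then have "f = 1 * f \<and> vanish P 0 1 \<and> vanish P k f" by simp
  then show ?case by (intro add_span_base) blast
next
  case (Suc m)
  have step: "l * g \<in> add_span {a * b |a b. vanish P (Suc m) a \<and> vanish P k b}"
    if "vanish P 1 l" "vanish P (m + k) g" for l g
  proof -
    from that(2) have "g \<in> add_span {a * b | a b. vanish P m a \<and> vanish P k b}" by (rule Suc.IH)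
    then show ?thesis
    proof (induction rule: add_span.induct)
      case (insert x y)
      then obtain a b where x: "x = a * b" "vanish P m a" "vanish P k b" by blast
      have "vanish P (Suc m) (l * a)" using vanish_mult[OF that(1) x(2)] by simp
      moreover have "l * x = (l * a) * b" by (simp add: x mult.assoc)
      ultimately have "l * x \<in> {a * b |a b. vanish P (Suc m) a \<and> vanish P k b}"
        using x by blast
      then show ?case using insert by (simp add: distrib_left add_span.insert)
    qed simp
  qed
  obtain f1 f2 where f: "f = (bX - bconst (fst P)) * f1 + (bY - bconst (snd P)) * f2"
    "vanish P (m + k) f1" "vanish P (m + k) f2"
    using Suc.prems unfolding add_Suc by (rule vanish_SucE)
  show ?case unfolding f(1)
    by (intro add_span_add step vanish_X vanish_Y f)
qed

section \<open>Several points at once\<close>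

lemma separating_idempotent:
  fixes u :: "nat \<Rightarrow> 'a::field \<times> 'a"
  assumes "inj_on u {..<n}" "i < n"
  obtains e where "vanish (u i) N (1 - e)" "\<And>j. j < n \<Longrightarrow> j \<noteq> i \<Longrightarrow> vanish (u j) N e"
proof -
  have "\<exists>l. bvalue (u i) l = 1 \<and> bvalue (u j) l = 0" if "j < n" "j \<noteq> i" for j
  proof -
    have "u i \<noteq> u j" using assms that by (auto simp: inj_on_def)
    then consider "fst (u i) \<noteq> fst (u j)" | "snd (u i) \<noteq> snd (u j)"
      by (auto simp: prod_eq_iff)
    then show ?thesis
    proof cases
      case 1
      show ?thesis
      proof (intro exI conjI)
        show "bvalue (u i) (bconst (inverse (fst (u i) - fst (u j))) * (bX - bconst (fst (u j)))) = 1"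
          by (simp only: bvalue.hom_mult bvalue.hom_minus bvalue_generators) (use 1 in simp)
        show "bvalue (u j) (bconst (inverse (fst (u i) - fst (u j))) * (bX - bconst (fst (u j)))) = 0"
          by (simp only: bvalue.hom_mult bvalue.hom_minus bvalue_generators) simp
      qed
    next
      case 2
      show ?thesis
      proof (intro exI conjI)
        show "bvalue (u i) (bconst (inverse (snd (u i) - snd (u j))) * (bY - bconst (snd (u j)))) = 1"
          by (simp only: bvalue.hom_mult bvalue.hom_minus bvalue_generators) (use 2 in simp)
        show "bvalue (u j) (bconst (inverse (snd (u i) - snd (u j))) * (bY - bconst (snd (u j)))) = 0"
          by (simp only: bvalue.hom_mult bvalue.hom_minus bvalue_generators) simp
      qed
    qed
  qed
  then obtain l where l: "\<And>j. j < n \<Longrightarrow> j \<noteq> i \<Longrightarrow> bvalue (u i) (l j) = 1 \<and> bvalue (u j) (l j) = 0"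
    by metis
  \<comment> \<open>\<open>v\<close> is one at \<open>u i\<close> and vanishes to order
    \<open>N\<close> at the other points. Passing to \<open>1 - (1 - v) ^ N\<close> keeps the latter
    and makes the difference from one vanish to order \<open>N\<close> at
    \<open>u i\<close>.\<close>
  define v where "v = (\<Prod>j\<in>{..<n} - {i}. l j ^ N)"
  define e where "e = 1 - (1 - v) ^ N"
  have v1: "bvalue (u i) v = 1"
    unfolding v_def bvalue.hom_prod bvalue.hom_power using l by (intro prod.neutral) auto
  have "vanish (u i) N (1 - e)"
    unfolding e_def using v1 by (auto intro!: vanish_power simp: vanish_1_iff bvalue.hom_minus simp del: One_nat_def)
  moreover have "vanish (u j) N e" if "j < n" "j \<noteq> i" for j
  proof -
    have "vanish (u j) N (l j ^ N)"
      using l[OF that] by (intro vanish_power) (simp add: vanish_1_iff del: One_nat_def)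
    moreover have "v = l j ^ N * (\<Prod>j\<in>{..<n} - {i} - {j}. l j ^ N)"
      unfolding v_def using that by (intro prod.remove) auto
    ultimately have "vanish (u j) N v" by (simp add: vanish_multL)
    moreover have "v dvd e"
    proof -
      have "e = v * (\<Sum>k<N. (1 - v) ^ k)"
        using one_diff_power_eq[of "1 - v" N] by (simp add: e_def)
      then show ?thesis by simp
    qed
    ultimately show ?thesis by (auto elim!: dvdE intro: vanish_multL)
  qed
  ultimately show ?thesis using that by blast
qed

definition multi_vanish :: "nat \<Rightarrow> (nat \<Rightarrow> 'a::comm_ring_1 \<times> 'a) \<Rightarrow> nat \<Rightarrow> 'a poly poly \<Rightarrow> bool" where
  "multi_vanish n u m f \<longleftrightarrow> (\<forall>i<n. vanish (u i) m f)"

text \<open>The squares \<open>e i * e i\<close> localize at single points, one factor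
  \<open>e i\<close> going to each member of a product. The error \<open>r\<close> vanishes to order
  \<open>m + k\<close> everywhere, so \<open>f * r\<close> is by itself a product of the required
  kind.\<close>

lemma multi_vanish_split:
  fixes u :: "nat \<Rightarrow> 'a::field \<times> 'a"
  assumes inj: "inj_on u {..<n}" and f: "multi_vanish n u (m + k) f"
  shows "f \<in> add_span {a * b | a b. multi_vanish n u m a \<and> multi_vanish n u k b}"
    (is "_ \<in> add_span ?S")
proof -
  define N where "N = m + k"
  have "\<exists>e. \<forall>i<n. vanish (u i) N (1 - e i) \<and> (\<forall>j<n. j \<noteq> i \<longrightarrow> vanish (u j) N (e i))"
  proof -
    have "\<exists>e. vanish (u i) N (1 - e) \<and> (\<forall>j<n. j \<noteq> i \<longrightarrow> vanish (u j) N e)" if "i < n" for i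
      using separating_idempotent[OF inj that, of N] by blast
    then show ?thesis by metis
  qed
  then obtain e where e: "\<And>i. i < n \<Longrightarrow> vanish (u i) N (1 - e i)"
      "\<And>i j. i < n \<Longrightarrow> j < n \<Longrightarrow> j \<noteq> i \<Longrightarrow> vanish (u j) N (e i)"
    by blast
  define r where "r = 1 - (\<Sum>i<n. e i * e i)"
  have r: "vanish (u j) N r" if "j < n" for j
  proof -
    have "r = (1 - e j * e j) - (\<Sum>i\<in>{..<n} - {j}. e i * e i)"
      unfolding r_def using that by (subst sum.remove[of _ j]) auto
    also have "1 - e j * e j = (1 - e j) * (1 + e j)" by (simp add: algebra_simps)
    also have "vanish (u j) N ((1 - e j) * (1 + e j) - (\<Sum>i\<in>{..<n} - {j}. e i * e i))"
      using that by (intro vanish_diff vanish_sum vanish_multL e) auto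
    finally show ?thesis .
  qed
  have part: "e i * e i * f \<in> add_span ?S" if "i < n" for i
  proof -
    have "f \<in> add_span {a * b | a b. vanish (u i) m a \<and> vanish (u i) k b}"
      using f that by (intro vanish_split) (simp add: multi_vanish_def)
    then show ?thesis
    proof (induction rule: add_span.induct)
      case (insert x y)
      then obtain a b where x: "x = a * b" "vanish (u i) m a" "vanish (u i) k b" by blast
      have mv: "multi_vanish n u l (e i * c)" if "vanish (u i) l c" "l \<le> N" for l c
        unfolding multi_vanish_def
      proof (intro allI impI)
        fix j assume "j < n"
        show "vanish (u j) l (e i * c)"
        proof (cases "j = i")
          case True
          then show ?thesis using that by (simp add: vanish_multR)
        next
          case False
          then have "vanish (u j) l (e i)"
            using e(2)[OF \<open>i < n\<close> \<open>j < n\<close>] that by (auto intro: vanish_mono)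
          then show ?thesis by (rule vanish_multL)
        qed
      qed
      have "e i * e i * x = (e i * a) * (e i * b)" by (simp add: x algebra_simps)
      moreover have "multi_vanish n u m (e i * a)" "multi_vanish n u k (e i * b)"
        using x by (auto intro!: mv simp: N_def)
      ultimately have "e i * e i * x \<in> ?S" by blast
      then show ?case using insert by (simp add: distrib_left add_span.insert)
    qed simp
  qed
  have "vanish (u i) m f" if "i < n" for i
    using f that vanish_mono[of "u i" "m + k" f m] by (simp add: multi_vanish_def)
  moreover have "vanish (u i) k r" if "i < n" for i
    using r[OF that] vanish_mono[of "u i" "m + k" r k] by (simp add: N_def)
  ultimately have "multi_vanish n u m f \<and> multi_vanish n u k r"
    by (simp add: multi_vanish_def)
  then have 1: "f * r \<in> add_span ?S" by (intro add_span_base CollectI exI conjI refl) auto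
  have 2: "(\<Sum>i<n. e i * e i * f) \<in> add_span ?S"
    by (intro add_span_sum part) simp
  have "f = (\<Sum>i<n. e i * e i * f) + f * r"
    unfolding r_def by (simp add: right_diff_distrib sum_distrib_left mult.commute[of f])
  with add_span_add[OF 2 1] show ?thesis by simp
qed

section \<open>Regularity\<close>

lemma multi_vanish_0 [simp]: "multi_vanish n u 0 f"
  by (simp add: multi_vanish_def)

lemma multi_vanish_zero [simp]: "multi_vanish n u k 0"
  by (simp add: multi_vanish_def)

lemma multi_vanish_add: "multi_vanish n u k f \<Longrightarrow> multi_vanish n u k g \<Longrightarrow> multi_vanish n u k (f + g)"
  by (simp add: multi_vanish_def vanish_add)

lemma multi_vanish_diff: "multi_vanish n u k f \<Longrightarrow> multi_vanish n u k g \<Longrightarrow> multi_vanish n u k (f - g)"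
  by (simp add: multi_vanish_def vanish_diff)

lemma multi_vanish_sum: "(\<And>i. i \<in> S \<Longrightarrow> multi_vanish n u k (f i)) \<Longrightarrow> multi_vanish n u k (sum f S)"
  by (simp add: multi_vanish_def vanish_sum)

lemma multi_vanish_mult:
  "multi_vanish n u k f \<Longrightarrow> multi_vanish n u l g \<Longrightarrow> multi_vanish n u (k + l) (f * g)"
  by (simp add: multi_vanish_def vanish_mult)

lemma multi_vanish_multR: "multi_vanish n u k g \<Longrightarrow> multi_vanish n u k (f * g)"
  by (simp add: multi_vanish_def vanish_multR)

lemma multi_vanish_mono: "multi_vanish n u k f \<Longrightarrow> l \<le> k \<Longrightarrow> multi_vanish n u l f"
  unfolding multi_vanish_def using vanish_mono by blast

text \<open>The homogeneous part of degree \<open>e\<close>, with \<open>x ^ i * y ^ j\<close>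
  recorded as \<open>w ^ j\<close>. Multiplication by \<open>x\<close> leaves it unchanged and
  multiplication by \<open>y\<close> multiplies it by \<open>w\<close>, while \<open>e\<close> goes
  up by one.\<close>

abbreviation lead :: "nat \<Rightarrow> 'a::comm_ring_1 poly poly \<Rightarrow> 'a poly" where
  "lead e f \<equiv> coeff (blow (0, 0) f) e"

lemma coeff_mult_le:
  fixes p q :: "'r::comm_ring_1 poly"
  assumes "degree p \<le> a" "degree q \<le> b"
  shows "coeff (p * q) (a + b) = coeff p a * coeff q b"
proof -
  have "coeff p i * coeff q (a + b - i) = 0" if "i \<le> a + b" "i \<noteq> a" for i
    using assms that by (cases "i < a") (auto simp: coeff_eq_0)
  then have "coeff (p * q) (a + b) = (\<Sum>i\<in>{a}. coeff p i * coeff q (a + b - i))"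
    unfolding coeff_mult by (intro sum.mono_neutral_right) auto
  then show ?thesis by simp
qed

lemma lead_mult: "tdeg f \<le> a \<Longrightarrow> tdeg g \<le> b \<Longrightarrow> lead (a + b) (f * g) = lead a f * lead b g"
  by (simp add: tdeg_def blow.hom_mult coeff_mult_le)

lemma lead_power: "tdeg f \<le> a \<Longrightarrow> lead (k * a) (f ^ k) = lead a f ^ k"
proof (induction k)
  case (Suc k)
  have "tdeg (f ^ k) \<le> k * a"
    using tdeg_power_le[of f k] Suc.prems by (meson le_trans mult_le_mono2)
  then show ?case using Suc by (simp add: lead_mult)
qed simp

lemma lead_const_mult: "lead e (bconst c * f) = Polynomial.smult c (lead e f)"
  by (simp only: blow.hom_mult blow_generators) simp

lemma lead_eq_0: "tdeg f \<le> e \<Longrightarrow> e < D \<Longrightarrow> lead D f = 0"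
  by (simp add: tdeg_def coeff_eq_0)

lemma tdeg_le_of_lead: "tdeg f \<le> Suc e \<Longrightarrow> lead (Suc e) f = 0 \<Longrightarrow> tdeg f \<le> e"
  unfolding tdeg_def by (metis degree_0 le_SucE leading_coeff_0_iff le0)

lemma tdeg_mono_le: "tdeg (bX ^ i * bY ^ j :: 'a::comm_ring_1 poly poly) \<le> i + j"
proof -
  have "tdeg (bX ^ i * bY ^ j :: 'a poly poly) \<le> tdeg (bX ^ i :: 'a poly poly) + tdeg (bY ^ j :: 'a poly poly)"
    by (rule tdeg_mult_le)
  also have "\<dots> \<le> i * tdeg (bX :: 'a poly poly) + j * tdeg (bY :: 'a poly poly)"
    by (intro add_mono tdeg_power_le)
  finally show ?thesis by simp
qed

lemma lead_mono: "lead (i + j) (bX ^ i * bY ^ j) = (monom 1 j :: 'a::comm_ring_1 poly)"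
proof -
  define x y where "x = (bX :: 'a poly poly)" and "y = (bY :: 'a poly poly)"
  have t: "tdeg x = 1" "tdeg y = 1" by (simp_all add: x_def y_def)
  have "tdeg (x ^ i) \<le> i" "tdeg (y ^ j) \<le> j"
    using tdeg_power_le[of x i] tdeg_power_le[of y j] by (simp_all add: t)
  then have "lead (i + j) (x ^ i * y ^ j) = lead i (x ^ i) * lead j (y ^ j)"
    by (rule lead_mult)
  also have "\<dots> = lead 1 x ^ i * lead 1 y ^ j"
    using lead_power[of x 1 i] lead_power[of y 1 j] by (simp add: t)
  also have "\<dots> = monom 1 j" by (simp add: monom_altdef x_def y_def)
  finally show ?thesis unfolding x_def y_def .
qed

lemma tdeg_X_mult_le: "tdeg f \<le> e \<Longrightarrow> tdeg (bX * f) \<le> Suc e"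
  and tdeg_Y_mult_le: "tdeg f \<le> e \<Longrightarrow> tdeg (bY * f) \<le> Suc e"
  using tdeg_mult_le[of bX f] tdeg_mult_le[of bY f] by (simp_all only: tdeg_X tdeg_Y)

text \<open>The fat points impose independent conditions in degree \<open>d\<close>; equivalently,
  the first cohomology of their ideal sheaf twisted by \<open>d\<close> vanishes.\<close>

definition interp :: "nat \<Rightarrow> nat \<Rightarrow> nat \<Rightarrow> (nat \<Rightarrow> 'a::comm_ring_1 \<times> 'a) \<Rightarrow> bool" where
  "interp n m d u \<longleftrightarrow> (\<forall>h. \<exists>f. tdeg f \<le> d \<and> (\<forall>i<n. vanish (u i) m (f - h i)))"

section \<open>Generators and syzygies from interpolation\<close>

locale interpolating =
  fixes n :: nat and u :: "nat \<Rightarrow> 'a::field \<times> 'a" and m d \<delta> :: nat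
  assumes inj: "inj_on u {..<n}" and interp: "interp n m d u"
  defines "\<delta> \<equiv> Suc d"
begin

text \<open>The interpolant of a monomial of degree \<open>\<delta>\<close> has degree at most
  \<open>d < \<delta>\<close>, so subtracting it does not disturb the leading form.\<close>

lemma ex_base:
  assumes "i \<le> \<delta>"
  shows "\<exists>f. multi_vanish n u m f \<and> tdeg f \<le> \<delta> \<and> lead \<delta> f = monom 1 i"
proof -
  define h where "h = (bX ^ (\<delta> - i) * bY ^ i :: 'a poly poly)"
  obtain g where g: "tdeg g \<le> d" "\<forall>j<n. vanish (u j) m (g - h)"
    using interp unfolding interp_def by (auto dest: spec[of _ "\<lambda>_. h"])
  have "multi_vanish n u m (h - g)"
    unfolding multi_vanish_def
  proof (intro allI impI)
    fix j assume "j < n"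
    have "vanish (u j) m (0 - (g - h))" using g \<open>j < n\<close> by (intro vanish_diff[of _ _ 0]) auto
    then show "vanish (u j) m (h - g)" by simp
  qed
  moreover have "tdeg h \<le> \<delta>" unfolding h_def using tdeg_mono_le[of "\<delta> - i" i] assms by simp
  then have "tdeg (h - g) \<le> \<delta>" using g by (intro tdeg_diff_le) (auto simp: \<delta>_def)
  moreover have "lead \<delta> (h - g) = monom 1 i"
    using lead_mono[of "\<delta> - i" i] assms lead_eq_0[OF g(1), of \<delta>]
    by (simp add: h_def blow.hom_minus \<delta>_def)
  ultimately show ?thesis by blast
qed

definition base :: "nat \<Rightarrow> 'a poly poly" where
  "base i = (SOME f. multi_vanish n u m f \<and> tdeg f \<le> \<delta> \<and> lead \<delta> f = monom 1 i)"

lemma base: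
  assumes "i \<le> \<delta>"
  shows "multi_vanish n u m (base i)" "tdeg (base i) \<le> \<delta>" "lead \<delta> (base i) = monom 1 i"
  using someI_ex[OF ex_base[OF assms]] unfolding base_def by blast+

text \<open>A monomial of degree \<open>E \<ge> t * \<delta>\<close> is a product of
  \<open>t\<close> monomials of degree \<open>\<delta>\<close> and a rest, and each monomial of
  degree \<open>\<delta>\<close> is the leading form of some \<open>base j\<close>.\<close>

lemma ex_lead:
  assumes "t * \<delta> \<le> E" "degree p \<le> E"
  shows "\<exists>g. multi_vanish n u (t * m) g \<and> tdeg g \<le> E \<and> lead E g = p"
proof -
  have mono: "\<exists>g. multi_vanish n u (t * m) g \<and> tdeg g \<le> E \<and> lead E g = monom 1 i" if "i \<le> E" for i
    using assms(1) that
  proof (induction t arbitrary: E i)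
    case 0
    then show ?case
      using lead_mono[of "E - i" i] tdeg_mono_le[of "E - i" i]
      by (intro exI[of _ "bX ^ (E - i) * bY ^ i"]) (simp del: mult_pCons_left)
  next
    case (Suc t)
    \<comment> \<open>The exponent of \<open>y\<close> in the next factor of degree
      \<open>\<delta>\<close>: as much of \<open>y\<close> as fits.\<close>
    define j where "j = min i \<delta>"
    have "\<exists>g. multi_vanish n u (t * m) g \<and> tdeg g \<le> E - \<delta> \<and> lead (E - \<delta>) g = monom 1 (i - j)"
      using Suc.prems by (intro Suc.IH) (auto simp: j_def)
    then obtain g where g: "multi_vanish n u (t * m) g" "tdeg g \<le> E - \<delta>"
        "lead (E - \<delta>) g = monom 1 (i - j)"
      by blast
    have j: "j \<le> \<delta>" by (simp add: j_def)
    have E: "\<delta> + (E - \<delta>) = E" using Suc.prems by simp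
    have "multi_vanish n u (Suc t * m) (base j * g)"
      using multi_vanish_mult[OF base(1)[OF j] g(1)] by simp
    moreover have "tdeg (base j * g) \<le> E"
      using tdeg_mult_le[of "base j" g] base(2)[OF j] g(2) E by linarith
    moreover have "lead E (base j * g) = monom 1 i"
    proof -
      have "j + (i - j) = i" by (simp add: j_def)
      then show ?thesis
        using lead_mult[OF base(2)[OF j] g(2)] by (simp only: E base(3)[OF j] g(3) mult_monom mult_1_left)
    qed
    ultimately show ?case by blast
  qed
  then obtain g where g: "\<And>i. i \<le> E \<Longrightarrow> multi_vanish n u (t * m) (g i)"
      "\<And>i. i \<le> E \<Longrightarrow> tdeg (g i) \<le> E" "\<And>i. i \<le> E \<Longrightarrow> lead E (g i) = monom 1 i"
    by metis
  show ?thesis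
  proof (intro exI conjI)
    show "multi_vanish n u (t * m) (\<Sum>i\<le>E. bconst (coeff p i) * g i)"
      by (intro multi_vanish_sum multi_vanish_multR g) simp
    show "tdeg (\<Sum>i\<le>E. bconst (coeff p i) * g i) \<le> E"
      by (intro tdeg_sum_le order.trans[OF tdeg_smult_le] g) simp
    have "lead E (\<Sum>i\<le>E. bconst (coeff p i) * g i) = (\<Sum>i\<le>E. monom (coeff p i) i)"
      by (simp only: blow.hom_sum coeff_sum lead_const_mult)
        (intro sum.cong, simp_all add: g smult_monom)
    then show "lead E (\<Sum>i\<le>E. bconst (coeff p i) * g i) = p"
      using assms(2) by (simp add: poly_as_sum_of_monoms')
  qed
qed

text \<open>One factor of order \<open>m\<close> is exposed, and the cofactor keeps the order
  \<open>t * m\<close>. The bound \<open>E\<close> means that no term exceeds the degree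
  \<open>\<delta> + E\<close>, so that nothing has to cancel in higher degrees.\<close>

definition products :: "nat \<Rightarrow> nat \<Rightarrow> 'a poly poly set" where
  "products t E = add_span {b * g | b g. multi_vanish n u m b \<and> tdeg b \<le> \<delta> \<and>
     multi_vanish n u (t * m) g \<and> tdeg g \<le> E}"

lemma productsI:
  assumes "multi_vanish n u m b" "tdeg b \<le> \<delta>" "multi_vanish n u (t * m) g" "tdeg g \<le> E"
  shows "b * g \<in> products t E"
  unfolding products_def using assms by (intro add_span_base) blast

lemma products_add: "f \<in> products t E \<Longrightarrow> g \<in> products t E \<Longrightarrow> f + g \<in> products t E"
  unfolding products_def by (rule add_span_add)

lemma products_mono: "f \<in> products t E \<Longrightarrow> E \<le> E' \<Longrightarrow> f \<in> products t E'"
  unfolding products_def by (erule add_span_mono) (auto intro: order.trans)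

lemma tdeg_products: "f \<in> products t E \<Longrightarrow> tdeg f \<le> \<delta> + E"
  unfolding products_def
proof (induction rule: add_span.induct)
  case (insert a b)
  then obtain x g where "a = x * g" "tdeg x \<le> \<delta>" "tdeg g \<le> E" by blast
  then have "tdeg a \<le> \<delta> + E" using tdeg_mult_le[of x g] by simp
  then show ?case using insert tdeg_add_le by blast
qed simp

text \<open>The leading forms of \<open>base 0, \<dots>, base \<delta>\<close> are all the monomials of degree \<open>\<delta>\<close>, and their
  syzygies are generated by the linear ones. So modulo \<open>products t E\<close> every element of
  \<open>products t (E + 1)\<close> has a normal form whose leading form determines it.\<close>

definition normal_forms :: "nat \<Rightarrow> nat \<Rightarrow> 'a poly poly \<Rightarrow> 'a poly poly set" where
  "normal_forms t E e = {v + (\<Sum>i<\<delta>. bconst (c i) * (base i * (bX * e))) + base \<delta> * g | v c g.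
     v \<in> products t E \<and> multi_vanish n u (t * m) g \<and> tdeg g \<le> Suc E}"

lemma normal_forms_add:
  assumes "f \<in> normal_forms t E e" "g \<in> normal_forms t E e"
  shows "f + g \<in> normal_forms t E e"
proof -
  obtain v c k where f: "f = v + (\<Sum>i<\<delta>. bconst (c i) * (base i * (bX * e))) + base \<delta> * k"
     "v \<in> products t E" "multi_vanish n u (t * m) k" "tdeg k \<le> Suc E"
    using assms(1) unfolding normal_forms_def by blast
  obtain v' c' k' where g: "g = v' + (\<Sum>i<\<delta>. bconst (c' i) * (base i * (bX * e))) + base \<delta> * k'"
     "v' \<in> products t E" "multi_vanish n u (t * m) k'" "tdeg k' \<le> Suc E"
    using assms(2) unfolding normal_forms_def by blast
  have "bconst (c i + c' i) = bconst (c i) + bconst (c' i)" for i by simp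
  then have "f + g = (v + v') + (\<Sum>i<\<delta>. bconst (c i + c' i) * (base i * (bX * e))) + base \<delta> * (k + k')"
    by (simp only: f g distrib_right sum.distrib distrib_left ac_simps)
  moreover have "v + v' \<in> products t E" "multi_vanish n u (t * m) (k + k')" "tdeg (k + k') \<le> Suc E"
    using f g by (auto intro: products_add multi_vanish_add tdeg_add_le)
  ultimately show ?thesis
    unfolding normal_forms_def
    by (intro CollectI exI[of _ "v + v'"] exI[of _ "\<lambda>i. c i + c' i"] exI[of _ "k + k'"] conjI)
qed

lemma products_normal_forms: "v \<in> products t E \<Longrightarrow> v \<in> normal_forms t E e"
  unfolding normal_forms_def
  by (intro CollectI exI[of _ v] exI[of _ "\<lambda>_. 0"] exI[of _ 0] conjI) simp_all

text \<open>In top degree \<open>g\<close> splits into a multiple of a power of \<open>x\<close>,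
  supplied by \<open>x * e\<close>, and a multiple of \<open>y\<close>. The quotient by
  \<open>y\<close> is the leading form of an element of order \<open>t * m\<close>, because by
  \<open>ex_lead\<close> all forms of degree \<open>E\<close> are.\<close>

lemma lift_lead:
  assumes E: "t * \<delta> \<le> E"
    and e: "multi_vanish n u (t * m) e" "tdeg e \<le> E" "lead E e = 1"
    and g: "multi_vanish n u (t * m) g" "tdeg g \<le> Suc E"
  obtains c g' r where "g = bconst c * (bX * e) + bY * g' + r"
    "multi_vanish n u (t * m) g'" "tdeg g' \<le> E" "multi_vanish n u (t * m) r" "tdeg r \<le> E"
proof -
  obtain c p where cp: "lead (Suc E) g = pCons c p" by (cases "lead (Suc E) g")
  have "degree p \<le> E"
    using degree_coeff_blow[of "(0,0)" g "Suc E"] by (auto simp: cp degree_pCons_eq_if split: if_splits)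
  then obtain g' where g': "multi_vanish n u (t * m) g'" "tdeg g' \<le> E" "lead E g' = p"
    using ex_lead[OF E] by blast
  define r where "r = g - (bconst c * (bX * e) + bY * g')"
  have tX: "tdeg (bX * e) \<le> Suc E" using e by (intro tdeg_X_mult_le)
  have tY: "tdeg (bY * g') \<le> Suc E" using g' by (intro tdeg_Y_mult_le)
  have lX: "lead (Suc E) (bX * e) = 1"
    using lead_mult[of bX 1 e E] e by simp
  have lY: "lead (Suc E) (bY * g') = [:0, 1:] * p"
    using lead_mult[of bY 1 g' E] g' by simp
  have "tdeg r \<le> Suc E"
    unfolding r_def by (intro tdeg_diff_le tdeg_add_le g tY order.trans[OF tdeg_smult_le tX])
  moreover have "lead (Suc E) r = 0"
    unfolding r_def blow.hom_minus blow.hom_add coeff_diff coeff_add lead_const_mult lX lY cp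
    by simp
  ultimately have "tdeg r \<le> E" by (rule tdeg_le_of_lead)
  moreover have "multi_vanish n u (t * m) r"
    unfolding r_def by (intro multi_vanish_diff multi_vanish_add multi_vanish_multR g g' e)
  moreover have "g = bconst c * (bX * e) + bY * g' + r" unfolding r_def by simp
  ultimately show ?thesis using that g' by blast
qed

text \<open>Downward from \<open>\<delta>\<close>: a factor \<open>y\<close> of the cofactor is
  traded for a factor \<open>x\<close> by passing from \<open>base i\<close> to
  \<open>base (Suc i)\<close>, until only \<open>base \<delta>\<close> carries an arbitrary
  cofactor.\<close>

lemma base_normal_forms:
  assumes E: "t * \<delta> \<le> E"
    and e: "multi_vanish n u (t * m) e" "tdeg e \<le> E" "lead E e = 1"
    and g: "multi_vanish n u (t * m) g" "tdeg g \<le> Suc E"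
    and i: "i \<le> \<delta>"
  shows "base i * g \<in> normal_forms t E e"
  using i g
proof (induction i arbitrary: g rule: inc_induct)
  case base
  have "(0 :: 'a poly poly) \<in> products t E" by (simp add: products_def)
  then show ?case
    unfolding normal_forms_def using base
    by (intro CollectI exI[of _ 0] exI[of _ "\<lambda>_. 0"] exI[of _ g]) simp
next
  case (step i)
  obtain c g' r where g: "g = bconst c * (bX * e) + bY * g' + r"
    "multi_vanish n u (t * m) g'" "tdeg g' \<le> E" "multi_vanish n u (t * m) r" "tdeg r \<le> E"
    using lift_lead[OF E e step.prems] by metis
  have i: "i \<le> \<delta>" "Suc i \<le> \<delta>" using step.hyps by auto
  \<comment> \<open>The lift of the linear syzygy between neighbouring monomials. The parts of
    degree \<open>\<delta> + 1\<close> cancel, so \<open>z\<close> is again of order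
    \<open>m\<close> and degree at most \<open>\<delta>\<close>.\<close>
  define z where "z = bY * base i - bX * base (Suc i)"
  have tz: "tdeg z \<le> Suc \<delta>"
    unfolding z_def by (intro tdeg_diff_le tdeg_X_mult_le tdeg_Y_mult_le base i)
  have "lead (Suc \<delta>) z = 0"
  proof -
    have "lead (Suc \<delta>) (bY * base i) = monom 1 (Suc i)"
      using lead_mult[of bY 1 "base i" \<delta>] base[OF i(1)] by (simp add: monom_Suc)
    moreover have "lead (Suc \<delta>) (bX * base (Suc i)) = monom 1 (Suc i)"
      using lead_mult[of bX 1 "base (Suc i)" \<delta>] base[OF i(2)] by simp
    ultimately show ?thesis unfolding z_def blow.hom_minus coeff_diff by simp
  qed
  then have "tdeg z \<le> \<delta>" using tz by (rule tdeg_le_of_lead[rotated])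
  moreover have "multi_vanish n u m z"
    unfolding z_def by (intro multi_vanish_diff multi_vanish_multR base i)
  ultimately have z: "z * g' \<in> products t E" using g by (intro productsI)
  have r: "base i * r \<in> products t E" using g i by (intro productsI base) auto
  have "tdeg (bX * g') \<le> Suc E"
    using g by (intro tdeg_X_mult_le)
  then have next_base: "base (Suc i) * (bX * g') \<in> normal_forms t E e"
    by (intro step.IH multi_vanish_multR g)
  have "bconst c * (base i * (bX * e)) \<in> normal_forms t E e"
  proof -
    have "bconst c * (base i * (bX * e)) =
        0 + (\<Sum>k<\<delta>. bconst (if k = i then c else 0) * (base k * (bX * e))) + base \<delta> * 0"
      using step.hyps by (subst sum.remove[of _ i]) auto
    moreover have "(0 :: 'a poly poly) \<in> products t E" by (simp add: products_def)
    ultimately show ?thesis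
      unfolding normal_forms_def
      by (intro CollectI exI[of _ 0] exI[of _ "\<lambda>k. if k = i then c else 0"] conjI) auto
  qed
  moreover have "base i * g = bconst c * (base i * (bX * e)) + base (Suc i) * (bX * g') + (z * g' + base i * r)"
    unfolding g(1) z_def by (simp only: algebra_simps)
  ultimately show ?case
    using next_base products_normal_forms[OF products_add[OF z r]] normal_forms_add by metis
qed

text \<open>In the normal form the part of degree \<open>\<delta> + E + 1\<close> is a polynomial in
  \<open>w\<close> of degree below \<open>\<delta>\<close> plus a multiple of
  \<open>w ^ \<delta>\<close>. If \<open>f\<close> has smaller degree both summands vanish, and what
  remains lies in \<open>products t E\<close>.\<close>

lemma products_reduce:
  assumes E: "t * \<delta> \<le> E" and f: "f \<in> products t (Suc E)" "tdeg f \<le> \<delta> + E"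
  shows "f \<in> products t E"
proof -
  obtain e where e: "multi_vanish n u (t * m) e" "tdeg e \<le> E" "lead E e = 1"
    using ex_lead[OF E, of 1] by auto
  have "f \<in> normal_forms t E e"
    using f(1) unfolding products_def
  proof (induction rule: add_span.induct)
    case zero
    show ?case by (intro products_normal_forms) (simp add: products_def)
  next
    case (insert x y)
    then obtain b g where x: "x = b * g" "multi_vanish n u m b" "tdeg b \<le> \<delta>"
       "multi_vanish n u (t * m) g" "tdeg g \<le> Suc E"
      by blast
    \<comment> \<open>Modulo the \<open>base i\<close> the factor \<open>b\<close> has degree at
      most \<open>d\<close>, one below \<open>\<delta>\<close>; this leaves room to move a variable
      from the cofactor into it.\<close>
    define h where "h = b - (\<Sum>i\<le>\<delta>. bconst (coeff (lead \<delta> b) i) * base i)"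
    have h1: "multi_vanish n u m h"
      unfolding h_def by (intro multi_vanish_diff x multi_vanish_sum multi_vanish_multR base) simp
    have "tdeg h \<le> Suc d"
      unfolding h_def
      by (intro tdeg_diff_le tdeg_sum_le order.trans[OF tdeg_smult_le])
        (use x base in \<open>auto simp: \<delta>_def\<close>)
    moreover have "lead (Suc d) h = 0"
    proof -
      have "(\<Sum>i\<le>\<delta>. Polynomial.smult (coeff (lead \<delta> b) i) (lead \<delta> (base i))) = (\<Sum>i\<le>\<delta>. monom (coeff (lead \<delta> b) i) i)"
        by (intro sum.cong) (simp_all add: base smult_monom)
      also have "\<dots> = lead \<delta> b" by (simp add: poly_as_sum_of_monoms' degree_coeff_blow)
      finally show ?thesis
        unfolding h_def blow.hom_minus coeff_diff blow.hom_sum coeff_sum lead_const_mult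
        by (simp add: \<delta>_def)
    qed
    ultimately have h2: "tdeg h \<le> d" by (rule tdeg_le_of_lead)
    have "x = (\<Sum>i\<le>\<delta>. base i * (bconst (coeff (lead \<delta> b) i) * g)) + h * g"
      unfolding x h_def by (simp only: left_diff_distrib sum_distrib_right) (simp add: algebra_simps)
    moreover have "(\<Sum>i\<in>I. base i * (bconst (coeff (lead \<delta> b) i) * g)) \<in> normal_forms t E e"
      if "I \<subseteq> {..\<delta>}" for I
      using that
    proof (induction I rule: infinite_finite_induct)
      case (insert i I)
      have "base i * (bconst (coeff (lead \<delta> b) i) * g) \<in> normal_forms t E e"
        using insert.prems x
        by (intro base_normal_forms[OF E e] multi_vanish_multR order.trans[OF tdeg_smult_le]) auto
      with insert show ?case by (simp add: normal_forms_add)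
    qed (auto intro!: products_normal_forms simp: products_def)
    moreover have "h * g \<in> normal_forms t E e"
    proof -
      obtain c g' r where g: "g = bconst c * (bX * e) + bY * g' + r"
        "multi_vanish n u (t * m) g'" "tdeg g' \<le> E" "multi_vanish n u (t * m) r" "tdeg r \<le> E"
        using lift_lead[OF E e x(4,5)] by metis
      have hg: "h * g = (bX * h) * (bconst c * e) + ((bY * h) * g' + h * r)"
        unfolding g(1) by (simp only: algebra_simps)
      have tX: "tdeg (bX * h) \<le> \<delta>"
        unfolding \<delta>_def by (intro tdeg_X_mult_le h2)
      have tY: "tdeg (bY * h) \<le> \<delta>"
        unfolding \<delta>_def by (intro tdeg_Y_mult_le h2)
      have "(bX * h) * (bconst c * e) \<in> products t E"
        using e by (intro productsI multi_vanish_multR h1 tX order.trans[OF tdeg_smult_le])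
      moreover have "(bY * h) * g' \<in> products t E"
        using g by (intro productsI multi_vanish_multR h1 tY)
      moreover have "h * r \<in> products t E"
        using g h1 h2 by (intro productsI) (auto simp: \<delta>_def)
      ultimately show ?thesis
        unfolding hg by (intro products_normal_forms products_add)
    qed
    ultimately have "x \<in> normal_forms t E e"
      by (simp only: normal_forms_add order.refl)
    then show ?case using insert normal_forms_add by blast
  qed
  then obtain v c g where vcg: "f = v + (\<Sum>i<\<delta>. bconst (c i) * (base i * (bX * e))) + base \<delta> * g"
      "v \<in> products t E" "multi_vanish n u (t * m) g" "tdeg g \<le> Suc E"
    unfolding normal_forms_def by blast
  have lead_g: "lead (\<delta> + Suc E) (base \<delta> * g) = monom 1 \<delta> * lead (Suc E) g"
    using lead_mult[OF base(2) vcg(4)] base(3) by simp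
  have lead_e: "lead (\<delta> + Suc E) (base i * (bX * e)) = monom 1 i" if "i < \<delta>" for i
  proof -
    have "tdeg (bX * e) \<le> Suc E"
      using e by (intro tdeg_X_mult_le)
    then have "lead (\<delta> + Suc E) (base i * (bX * e)) = lead \<delta> (base i) * lead (Suc E) (bX * e)"
      using that base(2)[of i] by (intro lead_mult) auto
    moreover have "lead (Suc E) (bX * e) = 1"
      using lead_mult[of bX 1 e E] e by simp
    ultimately show ?thesis using that base(3)[of i] by simp
  qed
  have "lead (\<delta> + Suc E) f = 0" using f(2) by (intro lead_eq_0) auto
  moreover have "lead (\<delta> + Suc E) v = 0"
    using tdeg_products[OF vcg(2)] by (intro lead_eq_0) auto
  moreover have "lead (\<delta> + Suc E) (\<Sum>i<\<delta>. bconst (c i) * (base i * (bX * e))) = (\<Sum>i<\<delta>. monom (c i) i)"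
    unfolding blow.hom_sum coeff_sum lead_const_mult
  proof (intro sum.cong refl)
    fix i assume "i \<in> {..<\<delta>}"
    then show "Polynomial.smult (c i) (lead (\<delta> + Suc E) (base i * (bX * e))) = monom (c i) i"
      by (simp only: lead_e lessThan_iff smult_monom mult_1_right)
  qed
  ultimately have *: "(\<Sum>i<\<delta>. monom (c i) i) + monom 1 \<delta> * lead (Suc E) g = 0"
    unfolding vcg(1) blow.hom_add coeff_add lead_g by simp
  have "c k = 0" if "k < \<delta>" for k
  proof -
    have "coeff ((\<Sum>i<\<delta>. monom (c i) i) + monom 1 \<delta> * lead (Suc E) g) k = c k"
      using that by (simp add: coeff_sum coeff_monom_mult)
    with * show ?thesis by simp
  qed
  moreover from this have "lead (Suc E) g = 0" using * by (simp add: monom_eq_0_iff)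
  then have "tdeg g \<le> E" by (rule tdeg_le_of_lead[OF vcg(4)])
  ultimately show ?thesis
    unfolding vcg(1) using products_add[OF vcg(2) productsI[OF base(1,2)[OF order.refl] vcg(3)]]
    by simp
qed

text \<open>Division by the \<open>base i\<close> lowers the degree of \<open>b\<close> to
  \<open>\<delta>\<close>. Cofactors may grow on the way; \<open>E\<close> is not controlled here
  and is brought down by \<open>products_reduce\<close>.\<close>

lemma products_ideal:
  assumes "multi_vanish n u m b" "multi_vanish n u (t * m) g"
  shows "\<exists>E. b * g \<in> products t E"
  using assms(1)
proof (induction "tdeg b" arbitrary: b rule: less_induct)
  case less
  show ?case
  proof (cases "tdeg b \<le> \<delta>")
    case True
    then show ?thesis using less assms(2) productsI by blast
  next
    case False
    define N where "N = tdeg b"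
    \<comment> \<open>The complement that makes \<open>base (min i \<delta>) * q i\<close> have
      leading form \<open>w ^ i\<close> in degree \<open>N\<close>.\<close>
    define q where "q i = (bX ^ ((N - \<delta>) - (i - min i \<delta>)) * bY ^ (i - min i \<delta>) :: 'a poly poly)" for i
    define s where "s = (\<Sum>i\<le>N. bconst (coeff (lead N b) i) * (base (min i \<delta>) * q i))"
    have N: "\<delta> + (N - \<delta>) = N" using False by (simp add: N_def)
    have q: "tdeg (q i) \<le> N - \<delta>" "lead (N - \<delta>) (q i) = monom 1 (i - min i \<delta>)" if "i \<le> N" for i
    proof -
      have "(N - \<delta>) - (i - min i \<delta>) + (i - min i \<delta>) = N - \<delta>" using that by auto
      then show "tdeg (q i) \<le> N - \<delta>" "lead (N - \<delta>) (q i) = monom 1 (i - min i \<delta>)"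
        unfolding q_def using lead_mono tdeg_mono_le by metis+
    qed
    have bq: "tdeg (base (min i \<delta>) * q i) \<le> N" "lead N (base (min i \<delta>) * q i) = monom 1 i"
      if "i \<le> N" for i
      using lead_mult[OF base(2) q(1)[OF that], of "min i \<delta>"] base(3)[of "min i \<delta>"] q(2)[OF that]
        tdeg_mult_le[of "base (min i \<delta>)" "q i"] base(2)[of "min i \<delta>"] q(1)[OF that] N
      by (simp_all add: mult_monom)
    have "tdeg (b - s) \<le> N"
      unfolding s_def N_def[symmetric]
      by (intro tdeg_diff_le tdeg_sum_le order.trans[OF tdeg_smult_le] bq) (auto simp: N_def)
    moreover have "lead N (b - s) = 0"
    proof -
      have "lead N s = (\<Sum>i\<le>N. monom (coeff (lead N b) i) i)"
        unfolding s_def blow.hom_sum coeff_sum lead_const_mult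
        by (intro sum.cong) (simp_all add: bq smult_monom)
      also have "\<dots> = lead N b" by (simp add: poly_as_sum_of_monoms' degree_coeff_blow)
      finally show ?thesis by (simp add: blow.hom_minus)
    qed
    moreover obtain N' where N': "N = Suc N'" using False unfolding N_def by (cases "tdeg b") auto
    ultimately have "tdeg (b - s) < tdeg b"
      using tdeg_le_of_lead[of "b - s" N'] by (simp add: N_def)
    moreover have "multi_vanish n u m s"
    proof -
      have "multi_vanish n u m (q i * base (min i \<delta>))" for i
        by (intro multi_vanish_multR base) simp
      then have "multi_vanish n u m (base (min i \<delta>) * q i)" for i
        by (simp only: mult.commute)
      then have "multi_vanish n u m (bconst (coeff (lead N b) i) * (base (min i \<delta>) * q i))" for i
        by (rule multi_vanish_multR)
      then show ?thesis
        unfolding s_def by (rule multi_vanish_sum)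
    qed
    ultimately obtain E where E: "(b - s) * g \<in> products t E"
      using less multi_vanish_diff by blast
    define E' where "E' = max E (N + tdeg g)"
    have "base (min i \<delta>) * (bconst (coeff (lead N b) i) * (q i * g)) \<in> products t E'" if "i \<le> N" for i
    proof (intro productsI multi_vanish_multR assms(2) base)
      have "tdeg (q i * g) \<le> N + tdeg g" using tdeg_mult_le[of "q i" g] q(1)[OF that] by linarith
      then show "tdeg (bconst (coeff (lead N b) i) * (q i * g)) \<le> E'"
        by (intro order.trans[OF tdeg_smult_le]) (simp add: E'_def)
    qed simp_all
    then have "(\<Sum>i\<le>N. base (min i \<delta>) * (bconst (coeff (lead N b) i) * (q i * g))) \<in> products t E'"
      unfolding products_def by (intro add_span_sum) auto
    moreover have "(\<Sum>i\<le>N. base (min i \<delta>) * (bconst (coeff (lead N b) i) * (q i * g))) = s * g"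
      unfolding s_def sum_distrib_right by (intro sum.cong refl) (simp only: ac_simps)
    moreover have "b * g = (b - s) * g + s * g" by (simp add: left_diff_distrib)
    moreover have "(b - s) * g \<in> products t E'" using products_mono[OF E] by (simp add: E'_def)
    ultimately have "b * g \<in> products t E'" using products_add by metis
    then show ?thesis ..
  qed
qed

text \<open>\<open>multi_vanish_split\<close> yields some \<open>E\<close>, which is lowered step by
  step to \<open>e - \<delta>\<close> because \<open>f\<close> has degree at most \<open>e\<close>.
  The bound on \<open>e\<close> gives \<open>t * \<delta> \<le> e - \<delta>\<close>, the range in
  which \<open>products_reduce\<close> applies.\<close>

theorem power_decompose:
  assumes "multi_vanish n u (Suc t * m) f" "tdeg f \<le> e" "Suc t * \<delta> \<le> e"
  shows "f \<in> products t (e - \<delta>)"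
proof -
  have "f \<in> add_span {a * b | a b. multi_vanish n u m a \<and> multi_vanish n u (t * m) b}"
    using assms(1) unfolding mult_Suc by (rule multi_vanish_split[OF inj])
  then have "\<exists>E. f \<in> products t E"
  proof (induction rule: add_span.induct)
    case zero
    then show ?case by (auto simp: products_def)
  next
    case (insert x y)
    obtain a b where "x = a * b" "multi_vanish n u m a" "multi_vanish n u (t * m) b"
      using insert.hyps(1) by blast
    then obtain E where x: "x \<in> products t E" using products_ideal by metis
    obtain E' where y: "y \<in> products t E'" using insert.IH by blast
    have "x + y \<in> products t (max E E')"
      by (intro products_add products_mono[OF x] products_mono[OF y]) auto
    then show ?case ..
  qed
  then obtain E where E: "f \<in> products t E" ..
  have "f \<in> products t ((e - \<delta>) + E)"
    by (rule products_mono[OF E]) simp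
  then show ?thesis
  proof (induction E)
    case (Suc E)
    have "t * \<delta> \<le> (e - \<delta>) + E" "tdeg f \<le> \<delta> + ((e - \<delta>) + E)"
      using assms by simp_all
    moreover have "f \<in> products t (Suc ((e - \<delta>) + E))"
      using Suc.prems by simp
    ultimately have "f \<in> products t ((e - \<delta>) + E)"
      using products_reduce by blast
    then show ?case by (rule Suc.IH)
  qed simp
qed

end

section \<open>Determinants over finite index sets\<close>

text \<open>Rows and columns are arranged by the same enumeration of \<open>S\<close>, so the value
  does not depend on it. Jets, monomials and nodes can then serve directly as indices.\<close>

definition idet :: "'i set \<Rightarrow> ('i \<Rightarrow> 'i \<Rightarrow> 'a::comm_ring_1) \<Rightarrow> 'a" where
  "idet S A = det (mat (card S) (card S) (\<lambda>(i, j). A (from_nat_into S i) (from_nat_into S j)))"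

lemma sum_from_nat_into:
  "finite S \<Longrightarrow> (\<Sum>j = 0..<card S. f (from_nat_into S j)) = (\<Sum>r\<in>S. f r)"
  using sum.reindex_bij_betw[OF bij_betw_from_nat_into_finite, of S f] by (simp add: atLeast0LessThan)

lemma from_nat_into_ex:
  assumes "finite S" "r \<in> S"
  obtains i where "i < card S" "r = from_nat_into S i"
  using bij_betw_from_nat_into_finite[OF assms(1)] assms(2) by (auto simp: bij_betw_def)

lemma from_nat_into_mem: "finite S \<Longrightarrow> i < card S \<Longrightarrow> from_nat_into S i \<in> S"
  using bij_betw_from_nat_into_finite[of S] by (auto simp: bij_betw_def)

lemma mat_from_nat_into_mult:
  assumes "finite S" "i < card S"
  shows "(mat (card S) (card S) (\<lambda>(i, j). A (from_nat_into S i) (from_nat_into S j)) *\<^sub>v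
            vec (card S) (\<lambda>j. x (from_nat_into S j))) $ i
          = (\<Sum>r'\<in>S. A (from_nat_into S i) r' * x r')"
  using assms sum_from_nat_into[OF assms(1), of "\<lambda>r'. A (from_nat_into S i) r' * x r'"]
  by (simp add: scalar_prod_def)

lemma idet_nonzero_iff:
  fixes A :: "'i \<Rightarrow> 'i \<Rightarrow> 'a::field"
  assumes "finite S"
  shows "idet S A \<noteq> 0 \<longleftrightarrow>
    (\<forall>x. (\<forall>r\<in>S. (\<Sum>r'\<in>S. A r r' * x r') = 0) \<longrightarrow> (\<forall>r\<in>S. x r = 0))"
proof -
  define N where "N = card S"
  define e where "e = from_nat_into S"
  define M where "M = mat N N (\<lambda>(i, j). A (e i) (e j))"
  have M: "M \<in> carrier_mat N N" by (simp add: M_def)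
  have bij: "bij_betw e {..<N} S"
    unfolding e_def N_def by (rule bij_betw_from_nat_into_finite[OF assms])
  have "(\<exists>v. v \<in> carrier_vec N \<and> v \<noteq> 0\<^sub>v N \<and> M *\<^sub>v v = 0\<^sub>v N) \<longleftrightarrow>
    (\<exists>x. (\<forall>r\<in>S. (\<Sum>r'\<in>S. A r r' * x r') = 0) \<and> (\<exists>r\<in>S. x r \<noteq> 0))"
  proof (intro iffI; elim exE conjE)
    fix v assume v: "v \<in> carrier_vec N" "v \<noteq> 0\<^sub>v N" "M *\<^sub>v v = 0\<^sub>v N"
    define x where "x r = v $ (the_inv_into {..<N} e r)" for r
    have x: "x (e j) = v $ j" if "j < N" for j
      using bij that by (simp add: x_def the_inv_into_f_f bij_betw_def)
    have vx: "v = vec N (\<lambda>j. x (e j))" using v(1) by (intro eq_vecI) (auto simp: x)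
    show "\<exists>x. (\<forall>r\<in>S. (\<Sum>r'\<in>S. A r r' * x r') = 0) \<and> (\<exists>r\<in>S. x r \<noteq> 0)"
    proof (intro exI[of _ x] conjI ballI)
      fix r assume "r \<in> S"
      then obtain i where i: "i < card S" "r = from_nat_into S i"
        using from_nat_into_ex[OF assms] by blast
      have "(M *\<^sub>v v) $ i = (\<Sum>r'\<in>S. A r r' * x r')"
        using mat_from_nat_into_mult[OF assms i(1), of A x] by (simp add: vx M_def N_def e_def i)
      then show "(\<Sum>r'\<in>S. A r r' * x r') = 0" using v(3) i by (simp add: N_def)
    next
      have "\<exists>j<N. v $ j \<noteq> 0" using v(1,2) by (metis eq_vecI carrier_vecD index_zero_vec)
      then obtain j where "j < N" "v $ j \<noteq> 0" by blast
      then show "\<exists>r\<in>S. x r \<noteq> 0" using x bij by (force simp: bij_betw_def)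
    qed
  next
    fix x assume x: "\<forall>r\<in>S. (\<Sum>r'\<in>S. A r r' * x r') = 0" "\<exists>r\<in>S. x r \<noteq> 0"
    show "\<exists>v. v \<in> carrier_vec N \<and> v \<noteq> 0\<^sub>v N \<and> M *\<^sub>v v = 0\<^sub>v N"
    proof (intro exI[of _ "vec N (\<lambda>j. x (e j))"] conjI)
      obtain r where "r \<in> S" "x r \<noteq> 0" using x(2) by blast
      then obtain i where "i < N" "x (e i) \<noteq> 0"
        using from_nat_into_ex[OF assms] unfolding N_def e_def by metis
      then show "vec N (\<lambda>j. x (e j)) \<noteq> 0\<^sub>v N" by (metis index_vec index_zero_vec(1))
      show "M *\<^sub>v vec N (\<lambda>j. x (e j)) = 0\<^sub>v N"
      proof (intro eq_vecI)
        fix i assume "i < dim_vec (0\<^sub>v N)"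
        then have i: "i < card S" by (simp add: N_def)
        show "(M *\<^sub>v vec N (\<lambda>j. x (e j))) $ i = 0\<^sub>v N $ i"
          using mat_from_nat_into_mult[OF assms i, of A x] x(1) from_nat_into_mem[OF assms i] i
          by (simp add: M_def N_def e_def)
      qed (simp add: M_def)
    qed simp
  qed
  then show ?thesis
    using det_0_iff_vec_prod_zero_field[OF M] by (auto simp: idet_def M_def N_def e_def)
qed

lemma idet_solve:
  fixes A :: "'i \<Rightarrow> 'i \<Rightarrow> 'a::field"
  assumes "finite S" "idet S A \<noteq> 0"
  obtains x where "\<And>r. r \<in> S \<Longrightarrow> (\<Sum>r'\<in>S. A r r' * x r') = t r"
proof -
  define N where "N = card S"
  define e where "e = from_nat_into S"
  define M where "M = mat N N (\<lambda>(i, j). A (e i) (e j))"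
  have M: "M \<in> carrier_mat N N" by (simp add: M_def)
  have bij: "bij_betw e {..<N} S"
    unfolding e_def N_def by (rule bij_betw_from_nat_into_finite[OF assms(1)])
  have "det M \<noteq> 0" using assms(2) by (simp add: M_def N_def e_def idet_def)
  then have "M \<in> Units (ring_mat TYPE('a) N ())" by (rule det_non_zero_imp_unit[OF M])
  then obtain B where B: "B \<in> carrier_mat N N" "M * B = 1\<^sub>m N"
    by (auto simp: Units_def ring_mat_def)
  define T where "T = vec N (\<lambda>j. t (e j))"
  define v where "v = B *\<^sub>v T"
  have v: "v \<in> carrier_vec N" using B by (simp add: v_def T_def)
  have "M *\<^sub>v v = (M * B) *\<^sub>v T"
    unfolding v_def using M B by (intro assoc_mult_mat_vec[symmetric]) (auto simp: T_def)
  then have Mv: "M *\<^sub>v v = T" by (simp add: B T_def)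
  define x where "x r = v $ (the_inv_into {..<N} e r)" for r
  have x: "x (e j) = v $ j" if "j < N" for j
    using bij that by (simp add: x_def the_inv_into_f_f bij_betw_def)
  have vx: "v = vec N (\<lambda>j. x (e j))" using v by (intro eq_vecI) (auto simp: x)
  show ?thesis
  proof (rule that)
    fix r assume "r \<in> S"
    then obtain i where i: "i < card S" "r = from_nat_into S i"
      using from_nat_into_ex[OF assms(1)] by blast
    have "(M *\<^sub>v v) $ i = (\<Sum>r'\<in>S. A r r' * x r')"
      using mat_from_nat_into_mult[OF assms(1) i(1), of A x] by (simp add: vx M_def N_def e_def i)
    then show "(\<Sum>r'\<in>S. A r r' * x r') = t r"
      using i by (simp add: Mv T_def e_def N_def)
  qed
qed

lemma idet_diagonal_nonzero:
  fixes A :: "'i \<Rightarrow> 'i \<Rightarrow> 'a::field"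
  assumes "finite S" "\<And>r. r \<in> S \<Longrightarrow> A r r \<noteq> 0"
    "\<And>r r'. r \<in> S \<Longrightarrow> r' \<in> S \<Longrightarrow> r \<noteq> r' \<Longrightarrow> A r r' = 0"
  shows "idet S A \<noteq> 0"
  unfolding idet_nonzero_iff[OF assms(1)]
proof (intro allI impI ballI)
  fix x r assume *: "\<forall>r\<in>S. (\<Sum>r'\<in>S. A r r' * x r') = 0" and r: "r \<in> S"
  have "(\<Sum>r'\<in>S. A r r' * x r') = A r r * x r"
  proof -
    have "(\<Sum>r'\<in>S - {r}. A r r' * x r') = 0"
      using assms(3)[OF r] by (intro sum.neutral) auto
    then show ?thesis by (simp add: sum.remove[OF assms(1) r])
  qed
  then show "x r = 0" using * r assms(2) by simp
qed

text \<open>By the Leibniz formula. The class \<open>Q\<close> is abstract because it is used both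
  for functions of a configuration and for functions of one parameter
  \<open>\<epsilon>\<close>.\<close>

lemma idet_closed:
  fixes A :: "'u \<Rightarrow> 'i \<Rightarrow> 'i \<Rightarrow> 'a::comm_ring_1"
  assumes const: "\<And>c. Q (\<lambda>_. c)"
    and add: "\<And>f g. Q f \<Longrightarrow> Q g \<Longrightarrow> Q (\<lambda>u. f u + g u)"
    and mult: "\<And>f g. Q f \<Longrightarrow> Q g \<Longrightarrow> Q (\<lambda>u. f u * g u)"
    and entries: "\<And>r r'. r \<in> S \<Longrightarrow> r' \<in> S \<Longrightarrow> Q (\<lambda>u. A u r r')"
    and fin: "finite S"
  shows "Q (\<lambda>u. idet S (A u))"
proof -
  have Qsum: "Q (\<lambda>u. \<Sum>i\<in>I. f i u)" if "\<And>i. i \<in> I \<Longrightarrow> Q (f i)" for I :: "(nat \<Rightarrow> nat) set" and f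
    using that by (induction I rule: infinite_finite_induct) (auto intro: const add)
  have Qprod: "Q (\<lambda>u. \<Prod>i\<in>I. f i u)" if "\<And>i. i \<in> I \<Longrightarrow> Q (f i)" for I :: "nat set" and f
    using that by (induction I rule: infinite_finite_induct) (auto intro: const mult)
  define e where "e = from_nat_into S"
  have e: "e i \<in> S" if "i < card S" for i using from_nat_into_mem[OF fin that] by (simp add: e_def)
  have "idet S (A u) = (\<Sum>p\<in>{p. p permutes {0..<card S}}. signof p *
      (\<Prod>i = 0..<card S. A u (e i) (e (p i))))" for u
    unfolding idet_def
    by (subst det_def'[of _ "card S"]) (auto simp: e_def intro!: sum.cong prod.cong)
  moreover have "Q (\<lambda>u. \<Sum>p\<in>{p. p permutes {0..<card S}}. signof p *
      (\<Prod>i = 0..<card S. A u (e i) (e (p i))))"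
    by (intro Qsum mult const Qprod entries e) (auto simp: permutes_in_image)
  ultimately show ?thesis by simp
qed

section \<open>Polynomial functions of a configuration\<close>

text \<open>Polynomials in the \<open>2 n\<close> affine coordinates, viewed as functions. The
  inductive form is what \<open>polyfun_homogenize\<close> follows to build a multihomogeneous
  form.\<close>

inductive polyfun :: "nat \<Rightarrow> ((nat \<Rightarrow> 'a::comm_ring_1 \<times> 'a) \<Rightarrow> 'a) \<Rightarrow> bool" for n where
  const: "polyfun n (\<lambda>_. c)"
| fst: "i < n \<Longrightarrow> polyfun n (\<lambda>u. fst (u i))"
| snd: "i < n \<Longrightarrow> polyfun n (\<lambda>u. snd (u i))"
| add: "polyfun n F \<Longrightarrow> polyfun n G \<Longrightarrow> polyfun n (\<lambda>u. F u + G u)"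
| mult: "polyfun n F \<Longrightarrow> polyfun n G \<Longrightarrow> polyfun n (\<lambda>u. F u * G u)"

lemma polyfun_sum:
  "(\<And>i. i \<in> I \<Longrightarrow> polyfun n (F i)) \<Longrightarrow> polyfun n (\<lambda>u. \<Sum>i\<in>I. F i u)"
  by (induction I rule: infinite_finite_induct) (auto intro: polyfun.intros)

lemma polyfun_idet:
  assumes "finite S" "\<And>r r'. r \<in> S \<Longrightarrow> r' \<in> S \<Longrightarrow> polyfun n (\<lambda>u. A u r r')"
  shows "polyfun n (\<lambda>u. idet S (A u))"
  by (rule idet_closed[where Q = "polyfun n" and A = A]) (auto intro: polyfun.intros assms)

lemma polyfun_on_line:
  assumes "polyfun n F"
  shows "\<exists>p. \<forall>\<tau>. F (\<lambda>i. (fst (v i) + \<tau> * fst (w i), snd (v i) + \<tau> * snd (w i))) = poly p \<tau>"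
  using assms
proof induction
  case (const c)
  show ?case by (intro exI[of _ "[:c:]"]) simp
next
  case (fst i)
  show ?case by (intro exI[of _ "[:fst (v i), fst (w i):]"]) simp
next
  case (snd i)
  show ?case by (intro exI[of _ "[:snd (v i), snd (w i):]"]) simp
next
  case (add F G)
  then obtain p q where "\<forall>\<tau>. F (\<lambda>i. (fst (v i) + \<tau> * fst (w i), snd (v i) + \<tau> * snd (w i))) = poly p \<tau>"
    "\<forall>\<tau>. G (\<lambda>i. (fst (v i) + \<tau> * fst (w i), snd (v i) + \<tau> * snd (w i))) = poly q \<tau>" by blast
  then show ?case by (intro exI[of _ "p + q"]) simp
next
  case (mult F G)
  then obtain p q where "\<forall>\<tau>. F (\<lambda>i. (fst (v i) + \<tau> * fst (w i), snd (v i) + \<tau> * snd (w i))) = poly p \<tau>"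
    "\<forall>\<tau>. G (\<lambda>i. (fst (v i) + \<tau> * fst (w i), snd (v i) + \<tau> * snd (w i))) = poly q \<tau>" by blast
  then show ?case by (intro exI[of _ "p * q"]) simp
qed

lemma alg_closed_infinite: "infinite (UNIV :: 'a::alg_closed_field set)"
proof
  assume fin: "finite (UNIV :: 'a set)"
  define p where "p = (\<Prod>a\<in>UNIV. [:-a, 1 :: 'a:]) + 1"
  have "degree (\<Prod>a\<in>UNIV. [:-a, 1 :: 'a:]) = card (UNIV :: 'a set)" by (rule degree_prod_linear)
  moreover have "card (UNIV :: 'a set) > 0" using fin by (simp add: card_gt_0_iff)
  ultimately have "degree p > 0" unfolding p_def by (subst degree_add_eq_left) simp_all
  then obtain x where "poly p x = 0" using alg_closed_imp_poly_has_root by blast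
  moreover have "poly (\<Prod>a\<in>UNIV. [:-a, 1 :: 'a:]) x = 0"
    using fin by (auto simp: poly_prod prod_zero_iff)
  ultimately show False by (simp add: p_def)
qed

text \<open>Irreducibility of affine space: on the line joining \<open>v\<close> and
  \<open>w\<close> both functions become nonzero polynomials in one variable over an infinite
  field.\<close>

lemma polyfun_mult_nonzero:
  fixes F G :: "(nat \<Rightarrow> 'a::alg_closed_field \<times> 'a) \<Rightarrow> 'a"
  assumes "polyfun n F" "polyfun n G" "F v \<noteq> 0" "G w \<noteq> 0"
  shows "\<exists>u. F u * G u \<noteq> 0"
proof -
  define x where "x i = (fst (w i) - fst (v i), snd (w i) - snd (v i))" for i
  define c where "c \<tau> i = (fst (v i) + \<tau> * fst (x i), snd (v i) + \<tau> * snd (x i))" for \<tau> i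
  obtain p where p: "\<And>\<tau>. F (c \<tau>) = poly p \<tau>"
    using polyfun_on_line[OF assms(1), of v x] unfolding c_def by blast
  obtain q where q: "\<And>\<tau>. G (c \<tau>) = poly q \<tau>"
    using polyfun_on_line[OF assms(2), of v x] unfolding c_def by blast
  have "c 0 = v" "c 1 = w" by (auto simp: c_def x_def)
  then have "poly p 0 \<noteq> 0" "poly q 1 \<noteq> 0" using assms(3,4) p q by metis+
  then have "p * q \<noteq> 0" by auto
  then have "finite {\<tau>. poly (p * q) \<tau> = 0}" by (rule poly_roots_finite)
  then obtain \<tau> where "poly (p * q) \<tau> \<noteq> 0"
    using alg_closed_infinite[where ?'a = 'a] by (metis (mono_tags, lifting) UNIV_eq_I mem_Collect_eq)
  then show ?thesis using p q by (intro exI[of _ "c \<tau>"]) simp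
qed

section \<open>Open conditions expressed by jets\<close>

definition generic :: "nat \<Rightarrow> ((nat \<Rightarrow> 'a::comm_ring_1 \<times> 'a) \<Rightarrow> bool) \<Rightarrow> bool" where
  "generic n Q \<longleftrightarrow> (\<exists>G. polyfun n G \<and> (\<exists>u. G u \<noteq> 0) \<and> (\<forall>u. G u \<noteq> 0 \<longrightarrow> Q u))"

lemma generic_conj:
  fixes Q R :: "(nat \<Rightarrow> 'a::alg_closed_field \<times> 'a) \<Rightarrow> bool"
  assumes "generic n Q" "generic n R"
  shows "generic n (\<lambda>u. Q u \<and> R u)"
proof -
  obtain F G v w where "polyfun n F" "F v \<noteq> 0" "\<forall>u. F u \<noteq> 0 \<longrightarrow> Q u"
    "polyfun n G" "G w \<noteq> 0" "\<forall>u. G u \<noteq> 0 \<longrightarrow> R u"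
    using assms unfolding generic_def by blast
  then show ?thesis
    unfolding generic_def using polyfun_mult_nonzero[of n F G v w] polyfun.mult[of n F G]
    by (intro exI[of _ "\<lambda>u. F u * G u"]) auto
qed

lemma generic_True: "generic n (\<lambda>u. True)"
  unfolding generic_def by (intro exI[of _ "\<lambda>_. 1"]) (auto intro: polyfun.intros)

text \<open>The coefficient of \<open>u ^ D * w ^ j\<close> at the \<open>i\<close>-th point. By
  \<open>degree_coeff_blow\<close> the indices with \<open>j \<le> D < m\<close> are enough to
  detect order \<open>m\<close>.\<close>

definition jet :: "(nat \<Rightarrow> 'a::comm_ring_1 \<times> 'a) \<Rightarrow> 'a poly poly \<Rightarrow> nat \<times> nat \<times> nat \<Rightarrow> 'a" where
  "jet u f = (\<lambda>(i, D, j). coeff (coeff (blow (u i) f) D) j)"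

definition jet_index :: "nat \<Rightarrow> nat \<Rightarrow> (nat \<times> nat \<times> nat) set" where
  "jet_index n m = {(i, D, j). i < n \<and> D < m \<and> j \<le> D}"

lemma finite_jet_index [simp]: "finite (jet_index n m)"
  by (rule finite_subset[of _ "{..<n} \<times> {..<m} \<times> {..m}"]) (auto simp: jet_index_def)

lemma jet_add: "jet u (f + g) r = jet u f r + jet u g r"
  by (simp add: jet_def blow.hom_add split: prod.split)

lemma jet_const_mult: "jet u (bconst c * f) r = c * jet u f r"
  unfolding jet_def blow.hom_mult blow_generators by (simp split: prod.split)

lemma jet_sum: "jet u (sum f S) r = (\<Sum>i\<in>S. jet u (f i) r)"
  by (simp add: jet_def blow.hom_sum coeff_sum split: prod.split)

lemma jet_diff: "jet u (f - g) r = jet u f r - jet u g r"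
  by (simp add: jet_def blow.hom_minus split: prod.split)

lemma vanish_iff: "vanish P m f \<longleftrightarrow> (\<forall>D<m. \<forall>j\<le>D. coeff (coeff (blow P f) D) j = 0)"
proof -
  have "coeff (blow P f) D = 0 \<longleftrightarrow> (\<forall>j\<le>D. coeff (coeff (blow P f) D) j = 0)" for D
  proof
    assume *: "\<forall>j\<le>D. coeff (coeff (blow P f) D) j = 0"
    show "coeff (blow P f) D = 0"
    proof (intro poly_eqI)
      fix j show "coeff (coeff (blow P f) D) j = coeff 0 j"
        using * degree_coeff_blow[of P f D] by (cases "j \<le> D") (auto simp: coeff_eq_0)
    qed
  qed simp
  then show ?thesis by (simp add: vanish_def monom_1_dvd_iff')
qed

lemma multi_vanish_iff_jet: "multi_vanish n u m f \<longleftrightarrow> (\<forall>r\<in>jet_index n m. jet u f r = 0)"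
  unfolding multi_vanish_def vanish_iff jet_def jet_index_def by auto

lemma polyfun_jet:
  assumes "r \<in> jet_index n m"
  shows "polyfun n (\<lambda>u. jet u f r)"
proof -
  obtain i D j where r: "r = (i, D, j)" "i < n" using assms by (auto simp: jet_index_def)
  have "polyfun n (\<lambda>u. coeff (coeff (blow (u i) f) D) j)"
  proof (induction f arbitrary: D j rule: bipoly_induct)
    case (const c)
    show ?case by (simp add: polyfun.const)
  next
    case X
    consider "D = 0" "j = 0" | "D \<noteq> 0 \<or> j \<noteq> 0" by blast
    then show ?case
    proof cases
      case 2
      then have "(\<lambda>u. coeff (coeff (blow (u i) bX) D) j) = (\<lambda>u :: nat \<Rightarrow> 'a \<times> 'a. coeff (coeff [:0, 1:] D) j)"
        by (auto simp: coeff_pCons split: nat.split)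
      then show ?thesis by (simp add: polyfun.const)
    qed (use r in \<open>simp add: polyfun.fst\<close>)
  next
    case Y
    consider "D = 0" "j = 0" | "D \<noteq> 0 \<or> j \<noteq> 0" by blast
    then show ?case
    proof cases
      case 2
      then have "(\<lambda>u. coeff (coeff (blow (u i) bY) D) j) = (\<lambda>u :: nat \<Rightarrow> 'a \<times> 'a. coeff (coeff [:0, [:0, 1:]:] D) j)"
        by (auto simp: coeff_pCons split: nat.split)
      then show ?thesis by (simp add: polyfun.const)
    qed (use r in \<open>simp add: polyfun.snd\<close>)
  next
    case (add f g)
    then show ?case by (simp add: blow.hom_add polyfun.add)
  next
    case (mult f g)
    then show ?case
      by (simp add: blow.hom_mult coeff_mult[of "blow _ _"] coeff_sum coeff_mult polyfun_sum polyfun.mult)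
  qed
  then show ?thesis by (simp add: jet_def r)
qed

text \<open>The product of \<open>(x - p) ^ (D - j)\<close> and \<open>(y - q) ^ j\<close> becomes
  exactly \<open>u ^ D * w ^ j\<close> at \<open>(p, q)\<close>.\<close>

lemma jet_dual:
  assumes "r' \<in> jet_index n m"
  obtains h where "\<And>r. r \<in> jet_index n m \<Longrightarrow> fst r = fst r' \<Longrightarrow> jet u h r = (if r = r' then 1 else 0)"
proof -
  obtain i D j where r': "r' = (i, D, j)" "i < n" "D < m" "j \<le> D"
    using assms by (auto simp: jet_index_def)
  define h where "h = (bX - bconst (fst (u i))) ^ (D - j) * (bY - bconst (snd (u i))) ^ j"
  have "blow (u i) (bX - bconst (fst (u i))) = [:0, 1:]"
    unfolding blow.hom_minus blow_generators by simp
  moreover have "blow (u i) (bY - bconst (snd (u i))) = [:0, [:0, 1:]:]"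
    unfolding blow.hom_minus blow_generators by simp
  ultimately have "blow (u i) h = [:0, 1:] ^ (D - j) * [:0, [:0, 1:]:] ^ j"
    unfolding h_def by (simp only: blow.hom_mult blow.hom_power)
  also have "[:0, [:0, 1:]:] = monom [:0, 1 :: 'a:] 1" by (simp add: monom_altdef)
  also have "[:0, 1 :: 'a poly:] = monom 1 1" by (simp add: monom_altdef)
  finally have "blow (u i) h = monom ([:0, 1:] ^ j) D"
    using r' by (simp add: monom_power mult_monom)
  also have "[:0, 1:] ^ j = monom (1 :: 'a) j" by (simp add: monom_altdef)
  finally have "jet u h (i, D', j') = (if (i, D', j') = r' then 1 else 0)" for D' j'
    by (auto simp: jet_def r')
  then show ?thesis by (intro that[of h]) (auto simp: r' split: if_splits)
qed

text \<open>Polynomials \<open>f r'\<close> dual to the jets at \<open>u0\<close> are kept fixed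
  while the points move. Their jet matrix is the identity at \<open>u0\<close>, and they still
  interpolate wherever its determinant is nonzero.\<close>

theorem generic_interp:
  fixes u0 :: "nat \<Rightarrow> 'a::field \<times> 'a"
  assumes "interp n m d u0"
  shows "generic n (interp n m d :: (nat \<Rightarrow> 'a \<times> 'a) \<Rightarrow> bool)"
proof -
  define R where "R = jet_index n m"
  have fin: "finite R" by (simp add: R_def)
  have "\<exists>f. tdeg f \<le> d \<and> (\<forall>r\<in>R. jet u0 f r = (if r = r' then 1 else 0))" if r': "r' \<in> R" for r'
  proof -
    obtain h where h: "\<And>r. r \<in> R \<Longrightarrow> fst r = fst r' \<Longrightarrow> jet u0 h r = (if r = r' then 1 else 0)"
      using jet_dual[of r' n m u0] r' unfolding R_def by blast
    obtain f where f: "tdeg f \<le> d" "\<forall>i<n. vanish (u0 i) m (f - (if i = fst r' then h else 0))"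
      using assms unfolding interp_def by (auto dest: spec[of _ "\<lambda>i. if i = fst r' then h else 0"])
    have "jet u0 f r = (if r = r' then 1 else 0)" if r: "r \<in> R" for r
    proof -
      obtain i D j where ij: "r = (i, D, j)" "i < n" "D < m" "j \<le> D"
        using r by (auto simp: R_def jet_index_def)
      have "jet u0 (f - (if i = fst r' then h else 0)) r = 0"
        using f(2) ij by (auto simp: vanish_iff jet_def)
      then have "jet u0 f r = jet u0 (if i = fst r' then h else 0) r" by (simp add: jet_diff)
      then show ?thesis
        using h[OF r] ij by (cases "i = fst r'") (auto simp: jet_def)
    qed
    then show ?thesis using f(1) by blast
  qed
  then obtain f where f: "\<And>r'. r' \<in> R \<Longrightarrow> tdeg (f r') \<le> d"
      "\<And>r r'. r' \<in> R \<Longrightarrow> r \<in> R \<Longrightarrow> jet u0 (f r') r = (if r = r' then 1 else 0)"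
    by metis
  define A where "A u r r' = jet u (f r') r" for u r r'
  show ?thesis
    unfolding generic_def
  proof (rule exI[where x = "\<lambda>u. idet R (A u)"], intro conjI allI impI)
    show "polyfun n (\<lambda>u. idet R (A u))"
      unfolding A_def by (intro polyfun_idet fin) (auto simp: R_def intro: polyfun_jet)
    show "\<exists>u. idet R (A u) \<noteq> 0"
      by (intro exI[of _ u0] idet_diagonal_nonzero fin) (auto simp: A_def f)
  next
    fix u assume u: "idet R (A u) \<noteq> 0"
    show "interp n m d u"
      unfolding interp_def
    proof
      fix h :: "nat \<Rightarrow> 'a poly poly"
      obtain x where x: "\<And>r. r \<in> R \<Longrightarrow> (\<Sum>r'\<in>R. A u r r' * x r') = jet u (h (fst r)) r"
        using idet_solve[OF fin u, of "\<lambda>r. jet u (h (fst r)) r"] by blast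
      define g where "g = (\<Sum>r'\<in>R. bconst (x r') * f r')"
      have "jet u g r = jet u (h (fst r)) r" if "r \<in> R" for r
        unfolding g_def jet_sum jet_const_mult x[OF that, symmetric] by (simp add: A_def mult.commute)
      then have "vanish (u i) m (g - h i)" if "i < n" for i
        using that by (force simp: vanish_iff R_def jet_index_def jet_def blow.hom_minus)
      moreover have "tdeg g \<le> d"
        unfolding g_def by (intro tdeg_sum_le order.trans[OF tdeg_smult_le] f)
      ultimately show "\<exists>f. tdeg f \<le> d \<and> (\<forall>i<n. vanish (u i) m (f - h i))" by blast
    qed
  qed
qed

definition nonvanishing :: "nat \<Rightarrow> nat \<Rightarrow> nat \<Rightarrow> (nat \<Rightarrow> 'a::comm_ring_1 \<times> 'a) \<Rightarrow> bool" where
  "nonvanishing n k e u \<longleftrightarrow> (\<forall>f. tdeg f \<le> e \<and> multi_vanish n u k f \<longrightarrow> f = 0)"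

text \<open>The jet map is injective in degree at most \<open>e\<close>; a linear left inverse
  recovers the coefficients from the jets.\<close>

lemma jet_left_inverse:
  fixes u :: "nat \<Rightarrow> 'a::field \<times> 'a"
  assumes "nonvanishing n k e u"
  obtains y where "\<And>f i j. tdeg f \<le> e \<Longrightarrow>
    (\<Sum>r\<in>jet_index n k. jet u f r * y (i, j) r) = coeff (coeff f j) i"
proof -
  define R where "R = jet_index n k"
  define s1 where "s1 c f = bconst c * f" for c and f :: "'a poly poly"
  define s2 where "s2 c g = (\<lambda>r. c * g r)" for c :: 'a and g :: "nat \<times> nat \<times> nat \<Rightarrow> 'a"
  have vs1: "vector_space s1"
  proof unfold_locales
    fix a b :: 'a and f :: "'a poly poly"
    have "bconst (a + b) = bconst a + bconst b" by simp
    then show "s1 (a + b) f = s1 a f + s1 b f" by (simp only: s1_def distrib_right)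
    have "bconst 1 = (1 :: 'a poly poly)" by (simp add: one_pCons)
    then show "s1 1 f = f" by (simp only: s1_def mult_1_left)
  qed (simp_all add: s1_def smult_add_right)
  have vs2: "vector_space s2"
    by unfold_locales (simp_all add: s2_def fun_eq_iff algebra_simps)
  interpret vs1: vector_space s1 by (rule vs1)
  interpret vs2: vector_space s2 by (rule vs2)
  interpret vector_space_pair s1 s2 ..
  define F where "F f = (\<lambda>r. if r \<in> R then jet u f r else 0)" for f
  have lin: "Vector_Spaces.linear s1 s2 F"
    unfolding Vector_Spaces.linear_iff using vs1 vs2
    by (auto simp: F_def s1_def s2_def fun_eq_iff jet_add jet_const_mult simp del: mult_pCons_left)
  define V where "V = {f :: 'a poly poly. tdeg f \<le> e}"
  have sub: "vs1.subspace V"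
    unfolding vs1.subspace_def V_def s1_def
    by (auto intro: tdeg_add_le order.trans[OF tdeg_smult_le] simp del: mult_pCons_left)
  have inj: "inj_on F V"
  proof (rule inj_onI)
    fix f g assume fg: "f \<in> V" "g \<in> V" "F f = F g"
    have "jet u (f - g) r = 0" if "r \<in> R" for r
      using fun_cong[OF fg(3), of r] that by (simp add: F_def jet_diff)
    then have "multi_vanish n u k (f - g)" by (simp add: multi_vanish_iff_jet R_def)
    moreover have "tdeg (f - g) \<le> e" using fg by (auto simp: V_def intro: tdeg_diff_le)
    ultimately show "f = g" using assms unfolding nonvanishing_def by auto
  qed
  obtain G where G: "Vector_Spaces.linear s2 s1 G" "\<And>f. f \<in> V \<Longrightarrow> G (F f) = f"
    using linear_exists_left_inverse_on[OF lin sub inj] by blast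
  interpret G: Vector_Spaces.linear s2 s1 G by (rule G(1))
  define \<delta> where "\<delta> r = (\<lambda>r'. if r' = r then 1 else 0 :: 'a)" for r :: "nat \<times> nat \<times> nat"
  define y where "y = (\<lambda>(i, j) r. coeff (coeff (G (\<delta> r)) j) i)"
  have "(\<Sum>r\<in>R. jet u f r * y (i, j) r) = coeff (coeff f j) i" if "tdeg f \<le> e" for f i j
  proof -
    have "F f = (\<Sum>r\<in>R. s2 (jet u f r) (\<delta> r))"
    proof
      fix r
      have "(\<Sum>r\<in>R. s2 (jet u f r) (\<delta> r)) r = (\<Sum>r'\<in>R. jet u f r' * \<delta> r' r)"
        by (induction R rule: infinite_finite_induct) (simp_all add: s2_def)
      also have "\<dots> = F f r"
        by (simp add: F_def \<delta>_def R_def if_distrib cong: if_cong)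
      finally show "F f r = (\<Sum>r\<in>R. s2 (jet u f r) (\<delta> r)) r" ..
    qed
    moreover have "G (F f) = f" using that by (intro G) (simp add: V_def)
    ultimately have "f = (\<Sum>r\<in>R. s1 (jet u f r) (G (\<delta> r)))"
      by (simp only: G.sum G.scale)
    then have "coeff (coeff f j) i = coeff (coeff (\<Sum>r\<in>R. s1 (jet u f r) (G (\<delta> r))) j) i"
      by (rule arg_cong)
    also have "\<dots> = (\<Sum>r\<in>R. jet u f r * y (i, j) r)"
      by (simp add: coeff_sum s1_def y_def)
    finally show ?thesis ..
  qed
  then show ?thesis using that unfolding R_def by blast
qed

text \<open>The jet matrix need not be square, as there may be more jets than monomials. Composing
  it with the left inverse found at \<open>u0\<close> makes it square, and the identity at
  \<open>u0\<close>; where its determinant is nonzero the jet map is injective.\<close>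

theorem generic_nonvanishing:
  fixes u0 :: "nat \<Rightarrow> 'a::field \<times> 'a"
  assumes "nonvanishing n k e u0"
  shows "generic n (nonvanishing n k e :: (nat \<Rightarrow> 'a \<times> 'a) \<Rightarrow> bool)"
proof -
  obtain y where y: "\<And>f i j. tdeg f \<le> e \<Longrightarrow>
    (\<Sum>r\<in>jet_index n k. jet u0 f r * y (i, j) r) = coeff (coeff f j) i"
    using jet_left_inverse[OF assms] by blast
  define B where "B = {(i, j). i + j \<le> e}"
  have fin: "finite B"
    by (rule finite_subset[of _ "{..e} \<times> {..e}"]) (auto simp: B_def)
  define mon :: "nat \<times> nat \<Rightarrow> 'a poly poly" where "mon b = bX ^ fst b * bY ^ snd b" for b
  have tmon: "tdeg (mon b) \<le> e" if "b \<in> B" for b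
    using tdeg_mono_le[of "fst b" "snd b", where ?'a = 'a] that unfolding mon_def B_def by auto
  define A where "A u b b' = (\<Sum>r\<in>jet_index n k. jet u (mon b') r * y b r)" for u b b'
  have expand: "f = (\<Sum>b\<in>B. bconst (coeff (coeff f (snd b)) (fst b)) * mon b)" if "tdeg f \<le> e" for f
    using bipoly_expand[OF that] by (simp only: B_def mon_def case_prod_unfold)
  have Ax: "(\<Sum>b'\<in>B. A u b b' * x b') = (\<Sum>r\<in>jet_index n k. jet u (\<Sum>b'\<in>B. bconst (x b') * mon b') r * y b r)"
    for u b x
    unfolding A_def jet_sum jet_const_mult sum_distrib_right
    by (subst sum.swap) (simp add: mult_ac)
  show ?thesis
    unfolding generic_def
  proof (rule exI[where x = "\<lambda>u. idet B (A u)"], intro conjI allI impI)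
    show "polyfun n (\<lambda>u. idet B (A u))"
      unfolding A_def
      by (intro polyfun_idet fin polyfun_sum polyfun.mult polyfun.const polyfun_jet)
    show "\<exists>u. idet B (A u) \<noteq> 0"
    proof (intro exI[of _ u0], subst idet_nonzero_iff[OF fin], intro allI impI ballI)
      fix x b assume x: "\<forall>b\<in>B. (\<Sum>b'\<in>B. A u0 b b' * x b') = 0" and b: "b \<in> B"
      define f where "f = (\<Sum>b'\<in>B. bconst (x b') * mon b')"
      have tf: "tdeg f \<le> e"
        unfolding f_def by (intro tdeg_sum_le order.trans[OF tdeg_smult_le] tmon)
      have "(\<Sum>b'\<in>B. A u0 b b' * x b') = coeff (coeff f (snd b)) (fst b)"
        using y[OF tf, of "fst b" "snd b"] unfolding Ax f_def by simp
      moreover have "coeff (coeff f (snd b)) (fst b) = x b"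
      proof -
        have "coeff (coeff (bconst (x b') * mon b') (snd b)) (fst b) = (if b' = b then x b' else 0)" for b'
        proof -
          have "[:[:0, 1:]:] ^ i = [:monom 1 i :: 'a poly:]" for i
            by (induction i) (simp_all add: monom_Suc one_pCons)
          moreover have "[:0, 1:] ^ j = (monom 1 j :: 'a poly poly)" for j
            by (simp add: monom_altdef)
          ultimately have "bconst (x b') * mon b' = monom (monom (x b') (fst b')) (snd b')"
            by (simp add: mon_def smult_monom)
          then show ?thesis by (auto simp: prod_eq_iff)
        qed
        then show ?thesis using b fin by (simp add: f_def coeff_sum)
      qed
      ultimately show "x b = 0" using x b by simp
    qed
  next
    fix u assume u: "idet B (A u) \<noteq> 0"
    show "nonvanishing n k e u"
      unfolding nonvanishing_def
    proof (intro allI impI; elim conjE)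
      fix f assume f: "tdeg f \<le> e" "multi_vanish n u k f"
      define x where "x b = coeff (coeff f (snd b)) (fst b)" for b
      have fx: "f = (\<Sum>b\<in>B. bconst (x b) * mon b)"
        using expand[OF f(1)] by (simp only: x_def)
      have "(\<Sum>b'\<in>B. A u b b' * x b') = 0" for b
        unfolding Ax fx[symmetric] using f(2) by (simp add: multi_vanish_iff_jet)
      then have "\<forall>b\<in>B. x b = 0" using u unfolding idet_nonzero_iff[OF fin] by blast
      then show "f = 0" unfolding fx by (intro sum.neutral) simp
    qed
  qed
qed

section \<open>Special configurations\<close>

lemma ex_inj_nat: "\<exists>e :: nat \<Rightarrow> 'a::alg_closed_field. inj e"
  using infinite_countable_subset[OF alg_closed_infinite] by blast

text \<open>A nonzero restriction would have \<open>card B * k\<close> zeros counted with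
  multiplicity, more than its degree.\<close>

lemma rline_eq_0:
  fixes f :: "'a::field poly poly"
  assumes "finite B" "\<And>b. b \<in> B \<Longrightarrow> vanish (pair_point a b) k f" "tdeg f < card B * k"
  shows "rline a f = 0"
proof (rule ccontr)
  assume "rline a f \<noteq> 0"
  then have "degree ((\<Prod>b\<in>B. [:-b, 1:]) ^ k) \<le> degree (rline a f)"
    using rline_dvd[OF assms(1,2)] by (intro dvd_imp_degree_le)
  also have "\<dots> \<le> tdeg f" by (rule degree_rline_le)
  finally have "k * card B \<le> tdeg f"
    by (subst (asm) degree_power_eq) (auto simp: degree_prod_linear prod_zero_iff assms(1))
  then show False using assms(3) by (simp add: mult.commute)
qed

text \<open>Each line of \<open>V\<close> carries \<open>s\<close> points of order \<open>k\<close>,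
  too many for the degree, so all \<open>s\<close> lines split off. As \<open>V\<close> and
  \<open>B\<close> are disjoint, each point lies on exactly one of them; the order drops by one, the
  degree by \<open>s\<close>, and the estimate persists.\<close>

lemma grid_nonvanishing:
  fixes f :: "'a::field poly poly"
  assumes "finite V" "finite B" "V \<inter> B = {}" "card V = s" "card B = s"
    and "\<And>a b. a \<in> V \<Longrightarrow> b \<in> B \<Longrightarrow> vanish (pair_point a b) k f" "tdeg f < s * k"
  shows "f = 0"
  using assms(6,7)
proof (induction k arbitrary: f)
  case (Suc k)
  show ?case
  proof (rule ccontr)
    assume f: "f \<noteq> 0"
    have "rline a f = 0" if "a \<in> V" for a
      using Suc.prems that assms(2,5) by (intro rline_eq_0[of B _ "Suc k"]) auto
    then obtain g where g: "f = (\<Prod>a\<in>V. lform a) * g" "tdeg f = card V + tdeg g"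
      "\<And>b c m. b \<noteq> c \<Longrightarrow> vanish (pair_point b c) m f \<Longrightarrow>
         vanish (pair_point b c) (m - card (V \<inter> {b, c})) g"
      using lines_divide[OF assms(1), of f] f by metis
    have "vanish (pair_point a b) k g" if "a \<in> V" "b \<in> B" for a b
    proof -
      have "V \<inter> {a, b} = {a}" "a \<noteq> b" using that assms(3) by auto
      then show ?thesis using g(3)[of a b "Suc k"] Suc.prems(1)[OF that] by simp
    qed
    moreover have "tdeg g < s * k" using Suc.prems(2) g(2) assms(4) by simp
    ultimately have "g = 0" by (rule Suc.IH)
    then show False using f g(1) by simp
  qed
qed simp

lemma ex_nonvanishing:
  assumes "k \<ge> 1" "s \<ge> 1"
  shows "\<exists>u :: nat \<Rightarrow> 'a::alg_closed_field \<times> 'a. nonvanishing (s ^ 2) k (s * k - 1) u"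
proof -
  obtain e :: "nat \<Rightarrow> 'a" where e: "inj e" using ex_inj_nat by blast
  define u where "u i = pair_point (e (i div s)) (e (s + i mod s))" for i
  have "nonvanishing (s ^ 2) k (s * k - 1) u"
    unfolding nonvanishing_def
  proof (intro allI impI; elim conjE)
    fix f assume f: "tdeg f \<le> s * k - 1" "multi_vanish (s ^ 2) u k f"
    show "f = 0"
    proof (rule grid_nonvanishing)
      show "e ` {..<s} \<inter> e ` {s..<2 * s} = {}" using e by (auto dest: injD)
      show "card (e ` {..<s}) = s" "card (e ` {s..<2 * s}) = s"
        using e by (simp_all add: card_image inj_on_subset)
      show "tdeg f < s * k" using f(1) assms by (cases "s * k") auto
    next
      fix a b assume "a \<in> e ` {..<s}" "b \<in> e ` {s..<2 * s}"
      then obtain i j where ij: "a = e i" "i < s" "b = e j" "s \<le> j" "j < 2 * s" by auto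
      define l where "l = j - s"
      have l: "l < s" "b = e (s + l)" using ij by (auto simp: l_def)
      have "i * s + l < s ^ 2"
      proof -
        have "i * s + l < Suc i * s" using l by simp
        also have "\<dots> \<le> s * s" using ij by (intro mult_right_mono) auto
        finally show ?thesis by (simp add: power2_eq_square)
      qed
      moreover have "u (i * s + l) = pair_point a b"
        using l by (simp add: u_def ij(1))
      ultimately show "vanish (pair_point a b) k f"
        using f(2) unfolding multi_vanish_def by metis
    qed auto
  qed
  then show ?thesis by blast
qed

text \<open>
  For even \<open>s\<close> one needs a configuration carrying no form of degree \<open>s k\<close> and order \<open>k\<close>, where
  \<open>k\<close> is odd. The lines through the points below have total degree \<open>2 s\<close> and pass twice through
  each point (the private lines being counted twice). Such a form is a constant multiple of a fixed
  one on each line, and the compatibility conditions at the nodes outside the configuration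
  force all these constants to vanish.
\<close>

locale cocktail =
  fixes C P B :: "'a::field set" and N :: "'a \<Rightarrow> 'a set" and r :: nat and a0 a1 c0 :: 'a
  assumes fin: "finite C" "finite P" "finite B"
    and disj: "C \<inter> P = {}" "C \<inter> B = {}" "P \<inter> B = {}"
    and card_C: "card C = 2 * r + 2" and card_P: "card P = r - 1" and card_B: "card B = 2 * r"
    and r: "r \<ge> 1"
    and N: "\<And>a. a \<in> C \<Longrightarrow> N a \<subseteq> C - {a}" "\<And>a. a \<in> C \<Longrightarrow> card (N a) = 2 * r"
    and N_P: "\<And>a. a \<in> P \<Longrightarrow> N a = B"
    and special: "c0 \<in> P" "a0 \<in> C" "a1 \<in> C" "a0 \<noteq> a1" "N a0 = C - {a0, a1}" "N a1 = C - {a0, a1}"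
begin

definition A :: "'a \<Rightarrow> 'a poly" where
  "A a = (\<Prod>b\<in>N a. [:-b, 1:])"

lemma N_props: "a \<in> C \<union> P \<Longrightarrow> finite (N a)" "a \<in> C \<union> P \<Longrightarrow> card (N a) = 2 * r"
  "a \<in> C \<union> P \<Longrightarrow> N a \<subseteq> C \<union> B"
  using N N_P fin card_B by (auto intro: finite_subset)

text \<open>By degree, the restriction to the line of \<open>a\<close> is \<open>\<kappa> a\<close>
  times \<open>A a ^ k\<close>. The lines of \<open>c0\<close>, \<open>a0\<close>, \<open>a1\<close>
  form a triangle whose corners are outside the configuration, and going around it multiplies
  \<open>\<kappa> c0\<close> by a factor different from one. So \<open>\<kappa> c0\<close> is zero,
  and the nodes on the line of \<open>c0\<close> transfer this to all other lines.\<close>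

lemma lines_vanish:
  assumes f: "tdeg f \<le> 2 * r * k" "\<And>a b. a \<in> C \<union> P \<Longrightarrow> b \<in> N a \<Longrightarrow> vanish (pair_point a b) k f"
    and holonomy: "(poly (A c0) a0 * poly (A a0) a1) ^ k \<noteq> (poly (A c0) a1 * poly (A a0) a0) ^ k"
    and a: "a \<in> C \<union> P"
  shows "rline a f = 0"
proof -
  have "\<exists>\<kappa>. rline a f = Polynomial.smult \<kappa> (A a ^ k)" if "a \<in> C \<union> P" for a
  proof -
    have "A a ^ k dvd rline a f"
      unfolding A_def using that N_props by (intro rline_dvd f) auto
    then obtain q where q: "rline a f = A a ^ k * q" by blast
    show ?thesis
    proof (cases "q = 0")
      case True
      then show ?thesis by (intro exI[of _ 0]) (simp add: q)
    next
      case False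
      have "A a \<noteq> 0" unfolding A_def using N_props(1)[OF that] by (auto simp: prod_zero_iff)
      then have "degree (rline a f) = k * (2 * r) + degree q"
        unfolding q using False N_props(2)[OF that]
        by (simp add: degree_mult_eq degree_power_eq) (simp add: A_def degree_prod_linear)
      moreover have "degree (rline a f) \<le> 2 * r * k"
        using degree_rline_le[of a f] f(1) by simp
      ultimately have "degree q = 0" by (simp add: mult.commute)
      then obtain c where "q = [:c:]" by (rule degree_eq_zeroE)
      then show ?thesis by (intro exI[of _ c]) (simp add: q)
    qed
  qed
  then obtain \<kappa> where \<kappa>: "\<And>a. a \<in> C \<union> P \<Longrightarrow> rline a f = Polynomial.smult (\<kappa> a) (A a ^ k)"
    by metis
  have node: "\<kappa> a * poly (A a) b ^ k = \<kappa> b * poly (A b) a ^ k" if "a \<in> C \<union> P" "b \<in> C \<union> P" for a b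
    using poly_rline[of a f b] poly_rline[of b f a] \<kappa>[OF that(1)] \<kappa>[OF that(2)] pair_point_commute[of a b]
    by (simp add: poly_power)
  have c0: "c0 \<in> C \<union> P" and a01: "a0 \<in> C \<union> P" "a1 \<in> C \<union> P" using special by auto
  have AA: "A a1 = A a0" using special by (simp add: A_def)
  have "\<kappa> c0 * (poly (A c0) a0 * poly (A a0) a1) ^ k = \<kappa> a0 * poly (A a0) c0 ^ k * poly (A a0) a1 ^ k"
    using node[OF c0 a01(1)] by (simp add: power_mult_distrib mult_ac)
  also have "\<dots> = (\<kappa> a0 * poly (A a0) a1 ^ k) * poly (A a0) c0 ^ k" by (simp add: mult_ac)
  also have "\<dots> = \<kappa> a1 * poly (A a0) a0 ^ k * poly (A a0) c0 ^ k"
    using node[OF a01] by (simp add: AA)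
  also have "\<dots> = (\<kappa> a1 * poly (A a1) c0 ^ k) * poly (A a0) a0 ^ k" by (simp add: mult_ac AA)
  also have "\<dots> = \<kappa> c0 * (poly (A c0) a1 * poly (A a0) a0) ^ k"
    using node[OF c0 a01(2)] by (simp add: power_mult_distrib mult_ac)
  finally have \<kappa>0: "\<kappa> c0 = 0" using holonomy by simp
  have "\<kappa> a = 0"
  proof -
    have "c0 \<notin> N a" using N_props(3)[OF a] special disj by auto
    then have "poly (A a) c0 \<noteq> 0"
      unfolding A_def using N_props(1)[OF a] by (auto simp: poly_prod prod_zero_iff)
    moreover have "\<kappa> a * poly (A a) c0 ^ k = 0" using node[OF a c0] \<kappa>0 by simp
    ultimately show ?thesis by simp
  qed
  then show ?thesis using \<kappa>[OF a] by simp
qed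

text \<open>All \<open>3 r + 1\<close> lines split off once. This costs two orders at the points
  given by pairs in \<open>C\<close>, but only one at the points on the lines of \<open>P\<close>,
  which therefore split off again; altogether the order drops by \<open>2\<close> and the degree by
  \<open>4 r\<close>. Parity matters: in order \<open>2\<close> the product of these
  \<open>4 r\<close> lines is itself a nonzero polynomial of degree \<open>2 r * 2\<close>.\<close>

lemma odd_nonvanishing:
  assumes "tdeg f \<le> 2 * r * (2 * l + 1)"
    "\<And>a b. a \<in> C \<union> P \<Longrightarrow> b \<in> N a \<Longrightarrow> vanish (pair_point a b) (2 * l + 1) f"
    "\<And>k. k \<ge> 1 \<Longrightarrow> k \<le> 2 * l + 1 \<Longrightarrow>
      (poly (A c0) a0 * poly (A a0) a1) ^ k \<noteq> (poly (A c0) a1 * poly (A a0) a0) ^ k"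
  shows "f = 0"
  using assms
proof (induction l arbitrary: f)
  case (0 f)
  show ?case
  proof (rule ccontr)
    assume f: "f \<noteq> 0"
    have "rline a f = 0" if "a \<in> C \<union> P" for a
      using 0 that by (intro lines_vanish[of f 1]) auto
    then obtain g where "f = (\<Prod>a\<in>C \<union> P. lform a) * g" "tdeg f = card (C \<union> P) + tdeg g"
      using lines_divide[of "C \<union> P" f] f fin by (metis finite_UnI)
    moreover have "card (C \<union> P) = 3 * r + 1"
      using fin disj card_C card_P r by (simp add: card_Un_disjoint)
    ultimately show False using 0(1) r by simp
  qed
next
  case (Suc l f)
  show ?case
  proof (rule ccontr)
    assume f: "f \<noteq> 0"
    define k where "k = 2 * l + 1"
    have k: "2 * Suc l + 1 = k + 2" by (simp add: k_def)
    have "rline a f = 0" if "a \<in> C \<union> P" for a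
      by (rule lines_vanish[OF Suc.prems(1,2) Suc.prems(3)[OF _ order.refl] that]) auto
    then obtain g where g: "f = (\<Prod>a\<in>C \<union> P. lform a) * g" "tdeg f = card (C \<union> P) + tdeg g"
      "\<And>b c m. b \<noteq> c \<Longrightarrow> vanish (pair_point b c) m f \<Longrightarrow>
         vanish (pair_point b c) (m - card ((C \<union> P) \<inter> {b, c})) g"
      using lines_divide[of "C \<union> P" f] f fin by (metis finite_UnI)
    have cardCP: "card (C \<union> P) = 3 * r + 1"
      using fin disj card_C card_P r by (simp add: card_Un_disjoint)
    have gP: "vanish (pair_point c b) (k + 1) g" if "c \<in> P" "b \<in> B" for b c
    proof -
      have eq: "(C \<union> P) \<inter> {c, b} = {c}" and "c \<noteq> b" using that disj by auto
      then show ?thesis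
        using g(3)[of c b "k + 2", unfolded eq] Suc.prems(2)[of c b] N_P that k by simp
    qed
    have gC: "vanish (pair_point a b) k g" if "a \<in> C" "b \<in> N a" for a b
    proof -
      have eq: "(C \<union> P) \<inter> {a, b} = {a, b}" and "a \<noteq> b" using that N(1) by auto
      then show ?thesis
        using g(3)[of a b "k + 2", unfolded eq] Suc.prems(2)[of a b] that k by simp
    qed
    have g0: "g \<noteq> 0" using f g(1) by auto
    have tg: "tdeg g + (3 * r + 1) \<le> 2 * r * (k + 2)"
      using Suc.prems(1)[unfolded k] unfolding g(2) cardCP by linarith
    have "rline c g = 0" if "c \<in> P" for c
    proof (rule rline_eq_0[OF fin(3) gP[OF that]])
      \<comment> \<open>The degree has dropped by \<open>3 r + 1 > 2 r\<close>, which is too much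
        for \<open>2 r\<close> points of remaining order \<open>k + 1\<close> on a line of
        \<open>P\<close>.\<close>
      have "2 * r * (k + 2) = 2 * r * (k + 1) + 2 * r" by (simp add: algebra_simps)
      then show "tdeg g < card B * (k + 1)" unfolding card_B using tg by linarith
    qed
    then obtain h where h: "g = (\<Prod>a\<in>P. lform a) * h" "tdeg g = card P + tdeg h"
      "\<And>b c m. b \<noteq> c \<Longrightarrow> vanish (pair_point b c) m g \<Longrightarrow>
         vanish (pair_point b c) (m - card (P \<inter> {b, c})) h"
      using lines_divide[of P g] g0 fin(2) by metis
    have hP: "vanish (pair_point c b) k h" if "c \<in> P" "b \<in> B" for b c
    proof -
      have eq: "P \<inter> {c, b} = {c}" and "c \<noteq> b" using that disj by auto
      then show ?thesis using h(3)[of c b "k + 1", unfolded eq] gP that by simp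
    qed
    have hC: "vanish (pair_point a b) k h" if "a \<in> C" "b \<in> N a" for a b
    proof -
      have eq: "P \<inter> {a, b} = {}" and "a \<noteq> b" using that N(1) disj by auto
      then show ?thesis using h(3)[of a b k, unfolded eq] gC that by simp
    qed
    have "tdeg h \<le> 2 * r * k" using tg h(2) card_P r by (simp add: algebra_simps)
    then have "h = 0"
      using hP hC N_P Suc.prems(3) unfolding k_def by (intro Suc.IH) auto
    then show False using h(1) g0 by simp
  qed
qed

end

text \<open>Indices from \<open>card E\<close> on carry no requirement; surplus points only add
  vanishing conditions.\<close>

lemma pair_enumeration:
  fixes E :: "('a::comm_ring_1 \<times> 'a) set"
  assumes "finite E" "card E \<le> n"
  obtains u where "\<And>a b. (a, b) \<in> E \<Longrightarrow> \<exists>i<n. u i = pair_point a b"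
proof (rule that)
  fix a b assume "(a, b) \<in> E"
  then obtain i where "i < card E" "(a, b) = from_nat_into E i"
    using from_nat_into_ex[OF assms(1)] by blast
  then show "\<exists>i<n. (case from_nat_into E i of (a, b) \<Rightarrow> pair_point a b) = pair_point a b"
    using assms(2) by (intro exI[of _ i]) (auto split: prod.split)
qed

text \<open>The vertices in \<open>C\<close> form \<open>r + 1\<close> couples
  \<open>e (2 * i)\<close>, \<open>e (2 * i + 1)\<close>, and each is joined to everything in
  \<open>C\<close> outside its couple; the \<open>r - 1\<close> vertices in \<open>P\<close> are
  joined to all of \<open>B\<close>. These are \<open>2 r (r + 1) + 2 r (r - 1) = (2 r) ^ 2\<close>
  edges, the required number of points. One member \<open>\<beta>\<close> of \<open>B\<close> stays
  free in order to make the holonomy nontrivial.\<close>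

lemma ex_odd_nonvanishing:
  assumes "r \<ge> 2" "odd k"
  shows "\<exists>u :: nat \<Rightarrow> 'a::alg_closed_field \<times> 'a. nonvanishing ((2 * r) ^ 2) k (2 * r * k) u"
proof -
  obtain e :: "nat \<Rightarrow> 'a" where e: "inj e" using ex_inj_nat by blast
  have inj: "e x = e y \<longleftrightarrow> x = y" for x y using e by (auto dest: injD)
  have inj_on_e: "inj_on e S" for S using e by (rule inj_on_subset) simp
  define C where "C = e ` {..<2 * r + 2}"
  define P where "P = e ` {2 * r + 2..<3 * r + 1}"
  define B' where "B' = e ` {3 * r + 1..<5 * r}"
  define N0 where "N0 x = e ` {y. y < 2 * r + 2 \<and> y div 2 \<noteq> x div 2}" for x
  define Q where "Q = (\<Prod>b\<in>N0 0. [:-b, 1:])"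
  define A' where "A' = (\<Prod>b\<in>B'. [:-b, 1:])"
  \<comment> \<open>As a polynomial in \<open>\<beta>\<close>, the difference of the two sides of
    the holonomy condition. At \<open>\<beta> = e 0\<close> the first term vanishes and the second
    does not, so only finitely many \<open>\<beta>\<close> are bad.\<close>
  define p where "p k' = ([:e 0, -1:] * [:poly A' (e 0) * poly Q (e 1):]) ^ k' -
      ([:e 1, -1:] * [:poly A' (e 1) * poly Q (e 0):]) ^ k'" for k'
  have finN0: "finite (N0 0)" and finB': "finite B'" by (auto simp: N0_def B'_def)
  have Q0: "poly Q (e 0) \<noteq> 0" 
    unfolding Q_def poly_prod using finN0 by (auto simp: prod_zero_iff N0_def inj)
  have A1: "poly A' (e 1) \<noteq> 0"
    unfolding A'_def poly_prod using finB' by (auto simp: prod_zero_iff B'_def inj)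
  have pk: "p k' \<noteq> 0" if "k' \<ge> 1" for k'
  proof -
    have "poly (p k') (e 0) = - (((e 1 - e 0) * (poly A' (e 1) * poly Q (e 0))) ^ k')"
    proof -
      have "poly (p k') (e 0) = ((e 0 - e 0) * (poly A' (e 0) * poly Q (e 1))) ^ k' -
          ((e 1 - e 0) * (poly A' (e 1) * poly Q (e 0))) ^ k'"
        unfolding p_def poly_diff poly_power poly_mult by simp
      then show ?thesis using that by (simp add: zero_power)
    qed
    moreover have "e 1 \<noteq> e 0" by (simp add: inj)
    ultimately have "poly (p k') (e 0) \<noteq> 0" using Q0 A1 by simp
    then show ?thesis by auto
  qed
  have "finite (e ` {..<5 * r} \<union> (\<Union>k'\<in>{1..k}. {x. poly (p k') x = 0}))"
    using pk by (auto intro!: poly_roots_finite)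
  then obtain \<beta> where "\<beta> \<notin> e ` {..<5 * r} \<union> (\<Union>k'\<in>{1..k}. {x. poly (p k') x = 0})"
    using ex_new_if_finite[OF alg_closed_infinite] by blast
  then have \<beta>: "\<beta> \<notin> e ` {..<5 * r}" "\<And>k'. k' \<in> {1..k} \<Longrightarrow> poly (p k') \<beta> \<noteq> 0"
    by blast+
  define B where "B = insert \<beta> B'"
  define N where "N a = (if a \<in> P then B else N0 (the_inv e a))" for a
  have Ne: "N (e x) = N0 x" if "x < 2 * r + 2" for x
    using that by (auto simp: N_def P_def the_inv_f_f[OF e] inj)
  have NP: "N a = B" if "a \<in> P" for a using that by (simp add: N_def)
  have N0card: "card (N0 x) = 2 * r" if "x < 2 * r + 2" for x
  proof -
    have eq: "{y. y < 2 * r + 2 \<and> y div 2 \<noteq> x div 2} = {..<2 * r + 2} - {2 * (x div 2), 2 * (x div 2) + 1}"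
      by auto
    have "2 * (x div 2) + 1 < 2 * r + 2" using that by presburger
    then have "{2 * (x div 2), 2 * (x div 2) + 1} \<subseteq> {..<2 * r + 2}" by auto
    then have "card ({..<2 * r + 2} - {2 * (x div 2), 2 * (x div 2) + 1}) = 2 * r"
      by (subst card_Diff_subset) auto
    then show ?thesis
      unfolding N0_def eq by (simp add: card_image[OF inj_on_e])
  qed
  have N00: "N0 0 = C - {e 0, e 1}"
  proof -
    have "{y. y < 2 * r + 2 \<and> y div 2 \<noteq> (0::nat)} = {..<2 * r + 2} - {0, 1}" by auto
    then show ?thesis unfolding N0_def C_def using image_set_diff[OF e] by simp
  qed
  have B'card: "card B' = 2 * r - 1"
    using assms by (simp add: B'_def card_image[OF inj_on_e])
  have \<beta>B': "\<beta> \<notin> B'" using \<beta> by (auto simp: B'_def)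
  interpret cocktail C P B N r "e 0" "e 1" "e (2 * r + 2)"
  proof
    show "finite C" "finite P" "finite B" by (auto simp: C_def P_def B_def B'_def)
    show "C \<inter> P = {}" by (auto simp: C_def P_def inj)
    show "C \<inter> B = {}" using \<beta> assms by (auto simp: C_def B_def B'_def inj)
    show "P \<inter> B = {}" using \<beta> assms by (auto simp: P_def B_def B'_def inj)
    show "card C = 2 * r + 2" "card P = r - 1"
      using assms by (simp_all add: C_def P_def card_image[OF inj_on_e])
    show "card B = 2 * r" using B'card \<beta>B' finB' assms by (simp add: B_def)
    show "r \<ge> 1" using assms by simp
    show "N a \<subseteq> C - {a}" "card (N a) = 2 * r" if a: "a \<in> C" for a
    proof -
      obtain x where x: "x < 2 * r + 2" "a = e x" using a by (auto simp: C_def)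
      show "N a \<subseteq> C - {a}" using x by (auto simp: Ne N0_def C_def inj)
      show "card (N a) = 2 * r" using x by (simp add: Ne N0card)
    qed
    show "e (2 * r + 2) \<in> P" using assms by (auto simp: P_def)
    show "e 0 \<in> C" "e 1 \<in> C" using assms by (auto simp: C_def)
    show "e 0 \<noteq> e 1" by (simp add: inj)
    show "N (e 0) = C - {e 0, e 1}" using N00 by (simp add: Ne)
    have "N0 1 = N0 0" by (simp add: N0_def)
    then show "N (e 1) = C - {e 0, e 1}" using N00 by (simp add: Ne)
  qed (rule NP)
  have A_eval: "poly (A (e (2 * r + 2))) z = (z - \<beta>) * poly A' z" for z
  proof -
    have "e (2 * r + 2) \<in> P" by (rule special(1))
    then have "A (e (2 * r + 2)) = [:-\<beta>, 1:] * A'"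
      using \<beta>B' finB' by (simp add: A_def NP B_def A'_def)
    then show ?thesis by (simp del: mult_pCons_left)
  qed
  have A0: "A (e 0) = Q" by (simp add: A_def Ne Q_def)
  have holonomy: "(poly (A (e (2 * r + 2))) (e 0) * poly (A (e 0)) (e 1)) ^ k' \<noteq>
      (poly (A (e (2 * r + 2))) (e 1) * poly (A (e 0)) (e 0)) ^ k'" if "k' \<ge> 1" "k' \<le> k" for k'
  proof -
    have "poly (p k') \<beta> \<noteq> 0" using \<beta>(2) that by simp
    moreover have "poly (p k') \<beta> = ((e 0 - \<beta>) * (poly A' (e 0) * poly Q (e 1))) ^ k' -
        ((e 1 - \<beta>) * (poly A' (e 1) * poly Q (e 0))) ^ k'"
      unfolding p_def poly_diff poly_power poly_mult by simp
    ultimately show ?thesis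
      unfolding A_eval A0 by (simp only: mult.assoc right_minus_eq not_False_eq_True)
  qed
  \<comment> \<open>Each edge inside \<open>C\<close> is listed once, directed towards the couple
    with the larger index \<open>j\<close>; this keeps the count at
    \<open>(2 * r) ^ 2\<close>.\<close>
  define core where "core = (\<lambda>((j, i), (a, b)). (e (2 * i + a), e (2 * j + b))) `
      ((SIGMA j:{..r}. {..<j}) \<times> ({..<2 :: nat} \<times> {..<2 :: nat}))"
  define E where "E = core \<union> P \<times> B"
  have "finite E" using fin by (auto simp: E_def core_def)
  moreover have "card E \<le> (2 * r) ^ 2"
  proof -
    have "card core \<le> card ((SIGMA j:{..r}. {..<j}) \<times> ({..<2 :: nat} \<times> {..<2 :: nat}))"
      unfolding core_def by (rule card_image_le) auto
    also have "\<dots> = (\<Sum>j\<le>r. j) * 4" by (simp add: card_cartesian_product)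
    also have "\<dots> = 2 * (r * (r + 1))"
    proof -
      have "2 * (\<Sum>j\<le>r. j) = r * (r + 1)" by (induction r) auto
      then show ?thesis by simp
    qed
    finally have "card E \<le> 2 * (r * (r + 1)) + (r - 1) * (2 * r)"
      unfolding E_def using card_Un_le[of core "P \<times> B"] by (simp add: card_cartesian_product card_P card_B)
    also have "\<dots> = (2 * r) ^ 2"
    proof -
      obtain r' where "r = Suc r'" using assms by (cases r) auto
      then show ?thesis by (simp add: power2_eq_square algebra_simps)
    qed
    finally show ?thesis .
  qed
  ultimately obtain u where u: "\<And>a b. (a, b) \<in> E \<Longrightarrow> \<exists>i<(2 * r) ^ 2. u i = pair_point a b"
    using pair_enumeration by blast
  have edge: "\<exists>i<(2 * r) ^ 2. u i = pair_point a b" if a: "a \<in> C \<union> P" and b: "b \<in> N a" for a b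
  proof (cases "a \<in> P")
    case True
    then show ?thesis using u[of a b] b NP by (simp add: E_def)
  next
    case False
    then obtain x where x: "x < 2 * r + 2" "a = e x" using a by (auto simp: C_def)
    then obtain y where y: "y < 2 * r + 2" "b = e y" "y div 2 \<noteq> x div 2"
      using b by (auto simp: Ne N0_def)
    have core: "(e x', e y') \<in> core" if "x' < 2 * r + 2" "y' < 2 * r + 2" "x' div 2 < y' div 2" for x' y'
      unfolding core_def using that
      by (intro image_eqI[of _ _ "((y' div 2, x' div 2), (x' mod 2, y' mod 2))"]) auto
    show ?thesis
    proof (cases "x div 2 < y div 2")
      case True
      then show ?thesis using u[of a b] core[of x y] x y by (simp add: E_def)
    next
      case False
      then show ?thesis
        using u[of b a] core[of y x] x y pair_point_commute[of a b] by (simp add: E_def)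
    qed
  qed
  obtain l where l: "k = 2 * l + 1" using assms(2) by (rule oddE)
  have "nonvanishing ((2 * r) ^ 2) k (2 * r * k) u"
    unfolding nonvanishing_def
  proof (intro allI impI; elim conjE)
    fix f assume f: "tdeg f \<le> 2 * r * k" "multi_vanish ((2 * r) ^ 2) u k f"
    show "f = 0"
    proof (rule odd_nonvanishing)
      show "tdeg f \<le> 2 * r * (2 * l + 1)" using f(1) l by simp
      show "vanish (pair_point a b) (2 * l + 1) f" if "a \<in> C \<union> P" "b \<in> N a" for a b
        using edge[OF that] f(2) unfolding multi_vanish_def l by metis
    qed (use holonomy l in auto)
  qed
  then show ?thesis by blast
qed

section \<open>Gluing on a configuration of lines\<close>

text \<open>\<open>Q\<close> is invertible modulo powers of the linear factor at \<open>b\<close>;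
  each further term of \<open>g\<close> corrects one further coefficient.\<close>

lemma solve_mod_power:
  fixes Q h :: "'a::field poly"
  assumes "poly Q b \<noteq> 0"
  shows "\<exists>g. degree g \<le> m \<and> [:-b, 1:] ^ m dvd Q * g - h"
proof (induction m)
  case 0
  show ?case by (intro exI[of _ 0]) simp
next
  case (Suc m)
  then obtain g where g: "degree g \<le> m" "[:-b, 1:] ^ m dvd Q * g - h" by blast
  then obtain r where r: "Q * g - h = [:-b, 1:] ^ m * r" by blast
  define c where "c = - (poly r b / poly Q b)"
  define g' where "g' = g + Polynomial.smult c ([:-b, 1:] ^ m)"
  have "Q * g' - h = [:-b, 1:] ^ m * (r + Polynomial.smult c Q)"
    using r by (simp add: g'_def algebra_simps)
  moreover have "poly (r + Polynomial.smult c Q) b = 0" using assms by (simp add: c_def)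
  then have "[:-b, 1:] dvd r + Polynomial.smult c Q" by (simp only: poly_eq_0_iff_dvd)
  ultimately have "[:-b, 1:] ^ Suc m dvd Q * g' - h"
    by (simp only: power_Suc2 mult_dvd_mono dvd_refl)
  moreover have "degree ([:-b, 1:] ^ m) \<le> m"
    using degree_power_le[of "[:-b, 1:]" m] by simp
  then have "degree g' \<le> Suc m"
    unfolding g'_def using g(1) by (intro degree_add_le) (auto intro: order.trans[OF degree_smult_le])
  ultimately show ?case by blast
qed

lemma hermite_interpolation:
  fixes b :: "nat \<Rightarrow> 'a::field" and h :: "nat \<Rightarrow> 'a poly"
  assumes "inj_on b {..<s}"
  shows "\<exists>y. degree y \<le> s * m \<and> (\<forall>l<s. [:-b l, 1:] ^ m dvd y - h l)"
  using assms
proof (induction s)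
  case 0
  show ?case by (intro exI[of _ 0]) simp
next
  case (Suc s)
  then obtain y where y: "degree y \<le> s * m" "\<And>l. l < s \<Longrightarrow> [:-b l, 1:] ^ m dvd y - h l"
    by (auto simp: lessThan_Suc)
  define Q where "Q = (\<Prod>l<s. [:-b l, 1:]) ^ m"
  have "b s \<noteq> b l" if "l < s" for l
    using inj_onD[OF Suc.prems, of s l] that by auto
  then have "poly Q (b s) \<noteq> 0"
    by (auto simp: Q_def poly_power poly_prod prod_zero_iff)
  then obtain g where g: "degree g \<le> m" "[:-b s, 1:] ^ m dvd Q * g - (h s - y)"
    using solve_mod_power by blast
  have "degree (\<Prod>l<s. [:-b l, 1:]) \<le> s"
    using degree_prod_sum_le[of "{..<s}" "\<lambda>l. [:-b l, 1:]"] by simp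
  then have "degree Q \<le> s * m"
    unfolding Q_def by (intro order.trans[OF degree_power_le]) simp
  then have "degree (Q * g) \<le> Suc s * m"
    using degree_mult_le[of Q g] g(1) by simp
  then have "degree (y + Q * g) \<le> Suc s * m" using y(1) by (intro degree_add_le) auto
  moreover have "[:-b l, 1:] ^ m dvd y + Q * g - h l" if l: "l < Suc s" for l
  proof (cases "l = s")
    case True
    then show ?thesis using g(2) by (simp add: algebra_simps)
  next
    case False
    then have "l < s" using l by simp
    then have "[:-b l, 1:] dvd (\<Prod>l<s. [:-b l, 1:])" by (intro dvd_prodI) auto
    then have "[:-b l, 1:] ^ m dvd Q" unfolding Q_def by (rule dvd_power_same)
    then have "[:-b l, 1:] ^ m dvd (y - h l) + Q * g"
      using y(2)[OF \<open>l < s\<close>] by (intro dvd_add dvd_mult2)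
    then show ?thesis by (simp add: algebra_simps)
  qed
  ultimately show ?case by blast
qed

text \<open>Lines are added one at a time: the error on the new line vanishes at its nodes with the
  earlier ones, hence is divisible by the restriction of their product, and extending the quotient
  by \<open>cone\<close> costs no extra degree.\<close>

lemma lines_lift:
  fixes e :: "nat \<Rightarrow> 'a::field" and F :: "nat \<Rightarrow> 'a poly"
  assumes "inj e" "\<And>i. i < s \<Longrightarrow> degree (F i) \<le> d"
    "\<And>i j. i < s \<Longrightarrow> j < s \<Longrightarrow> i \<noteq> j \<Longrightarrow> poly (F i) (e j) = poly (F j) (e i)"
  shows "\<exists>f. tdeg f \<le> d \<and> (\<forall>i<s. rline (e i) f = F i)"
  using assms(2,3)
proof (induction s)
  case 0
  show ?case by (intro exI[of _ 0]) simp
next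
  case (Suc s)
  have inj_on_e: "inj_on e S" for S using assms(1) by (rule inj_on_subset) simp
  from Suc obtain f where f: "tdeg f \<le> d" "\<And>i. i < s \<Longrightarrow> rline (e i) f = F i"
    by (metis less_SucI)
  define D where "D = F s - rline (e s) f"
  define W where "W = (\<Prod>b\<in>e ` {..<s}. [:-b, 1:])"
  have "[:-b, 1:] ^ 1 dvd D" if b: "b \<in> e ` {..<s}" for b
  proof -
    obtain i where i: "i < s" "b = e i" using b by blast
    have "poly (rline (e s) f) (e i) = poly (rline (e i) f) (e s)"
      by (simp add: poly_rline pair_point_commute)
    then have "poly D b = 0"
      using Suc.prems(2)[of s i] i f(2)[OF i(1)] by (simp add: D_def)
    then show ?thesis by (simp add: poly_eq_0_iff_dvd)
  qed
  then have "W ^ 1 dvd D" unfolding W_def by (intro prod_linear_power_dvd) auto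
  then obtain g where g: "D = W * g" by (auto elim: dvdE)
  define c where "c = (\<Prod>i<s. e s - e i)"
  have c: "c \<noteq> 0" using assms(1) by (auto simp: c_def prod_zero_iff dest: injD)
  define f' where "f' = f + (\<Prod>i<s. lform (e i)) * cone (e s) (Polynomial.smult (inverse c) g)"
  have dD: "degree D \<le> d"
    unfolding D_def using Suc.prems(1)[of s] order.trans[OF degree_rline_le f(1)]
    by (intro degree_diff_le) auto
  have "tdeg f' \<le> d"
  proof (cases "g = 0")
    case True
    then show ?thesis using f(1) by (simp add: f'_def cone_def)
  next
    case False
    have W0: "W \<noteq> 0" by (auto simp: W_def prod_zero_iff)
    have "degree W = s"
      by (simp add: W_def degree_prod_linear card_image[OF inj_on_e])
    then have "s + degree g \<le> d"
      using dD unfolding g by (simp add: degree_mult_eq[OF W0 False])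
    moreover have "tdeg (\<Prod>i<s. lform (e i)) \<le> s"
      using tdeg_prod_le[of "\<lambda>i. lform (e i)" "{..<s}"] by simp
    moreover have "tdeg (cone (e s) (Polynomial.smult (inverse c) g)) \<le> degree g"
      by (simp add: tdeg_cone degree_smult_le)
    ultimately show ?thesis
      unfolding f'_def
      by (intro tdeg_add_le f(1) order.trans[OF tdeg_mult_le]) linarith
  qed
  moreover have "rline (e i) f' = F i" if i: "i < Suc s" for i
  proof (cases "i = s")
    case True
    have "rline (e s) (\<Prod>i<s. lform (e i)) = Polynomial.smult c W"
    proof -
      have "W = (\<Prod>i<s. [:- e i, 1:])"
        unfolding W_def by (simp add: prod.reindex[OF inj_on_e])
      then show ?thesis by (simp only: rline.hom_prod rline_lform prod_smult c_def)
    qed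
    then have "rline (e s) f' = rline (e s) f + W * g"
      using c by (simp add: f'_def rline.hom_add rline.hom_mult)
    then show ?thesis using True by (simp flip: g) (simp add: D_def)
  next
    case False
    then have "i < s" using i by simp
    then have "rline (e i) (\<Prod>i<s. lform (e i)) = 0"
      by (auto simp: rline.hom_prod rline_lform prod_zero_iff)
    then show ?thesis using f(2)[OF \<open>i < s\<close>] by (simp add: f'_def rline.hom_add rline.hom_mult)
  qed
  ultimately show ?case by blast
qed

text \<open>A truncated geometric series, after the value at the point has been scaled to
  one.\<close>

lemma inverse_mod_vanish:
  fixes f :: "'a::field poly poly"
  assumes "bvalue P f \<noteq> 0"
  shows "\<exists>g. vanish P m (f * g - 1)"
proof -
  define f' where "f' = bconst (inverse (bvalue P f)) * f"
  define g where "g = bconst (inverse (bvalue P f)) * (\<Sum>j<m. (1 - f') ^ j)"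
  have "bvalue P f' = 1"
    unfolding f'_def bvalue.hom_mult bvalue_generators using assms by simp
  then have "vanish P 1 (1 - f')" unfolding vanish_1_iff bvalue.hom_minus by simp
  then have "vanish P m (0 - (1 - f') ^ m)" by (intro vanish_diff[OF vanish_zero] vanish_power)
  moreover have "f * g - 1 = 0 - (1 - f') ^ m"
  proof -
    have "f * g = f' * (\<Sum>j<m. (1 - f') ^ j)" unfolding g_def f'_def by (simp only: ac_simps)
    also have "\<dots> = 1 - (1 - f') ^ m" using one_diff_power_eq[of "1 - f'" m] by simp
    finally show ?thesis by simp
  qed
  ultimately show ?thesis by metis
qed

section \<open>A balanced tournament\<close>

definition arrow :: "nat \<Rightarrow> nat \<Rightarrow> bool" where
  "arrow i j \<longleftrightarrow> (i < j \<and> odd (i + j)) \<or> (j < i \<and> even (i + j))"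

lemma arrow_irrefl: "\<not> arrow i i"
  by (simp add: arrow_def)

lemma arrow_asym: "arrow i j \<Longrightarrow> \<not> arrow j i"
  by (auto simp: arrow_def add.commute)

lemma arrow_total: "i \<noteq> j \<Longrightarrow> arrow i j \<or> arrow j i"
  by (auto simp: arrow_def add.commute)

text \<open>Delete \<open>j\<close> and shift the larger indices down by one. The \<open>i\<close>
  with \<open>arrow i j\<close> become the indices of parity opposite to \<open>j\<close> among
  \<open>s - 1\<close> consecutive numbers, and halving is injective on them.\<close>

lemma card_arrow_le:
  assumes "j < s"
  shows "card {i. i < s \<and> arrow i j} \<le> s div 2"
proof -
  define \<phi> where "\<phi> i = (if i < j then i div 2 else (i - 1) div 2)" for i :: nat
  have "inj_on \<phi> {i. i < s \<and> arrow i j}"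
  proof (rule inj_onI)
    fix x y assume "x \<in> {i. i < s \<and> arrow i j}" "y \<in> {i. i < s \<and> arrow i j}" and eq: "\<phi> x = \<phi> y"
    then consider "x < j" "odd (x + j)" "y < j" "odd (y + j)" | "x < j" "odd (x + j)" "j < y" "even (y + j)"
      | "j < x" "even (x + j)" "y < j" "odd (y + j)" | "j < x" "even (x + j)" "j < y" "even (y + j)"
      by (auto simp: arrow_def)
    then show "x = y"
    proof cases
      case 1
      then have "x div 2 = y div 2" using eq by (simp add: \<phi>_def)
      then show ?thesis using 1 by presburger
    next
      case 2
      have "j + 2 \<le> y" using 2(3,4) by presburger
      then have "(j + 1) div 2 \<le> (y - 1) div 2" by (intro div_le_mono) simp
      moreover have "(x + 2) div 2 \<le> (j + 1) div 2" using 2 by (intro div_le_mono) simp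
      moreover have "x div 2 = (y - 1) div 2" using eq 2 by (simp add: \<phi>_def)
      ultimately show ?thesis by simp
    next
      case 3
      have "j + 2 \<le> x" using 3(1,2) by presburger
      then have "(j + 1) div 2 \<le> (x - 1) div 2" by (intro div_le_mono) simp
      moreover have "(y + 2) div 2 \<le> (j + 1) div 2" using 3 by (intro div_le_mono) simp
      moreover have "(x - 1) div 2 = y div 2" using eq 3 by (simp add: \<phi>_def)
      ultimately show ?thesis by simp
    next
      case 4
      have "(x - 1) div 2 = (y - 1) div 2" using eq 4 by (simp add: \<phi>_def)
      moreover have "(x - 1) mod 2 = (y - 1) mod 2" using 4 by (auto simp: mod2_eq_if)
      ultimately have "x - 1 = y - 1" by (metis div_mult_mod_eq)
      then show ?thesis using 4 by simp
    qed
  qed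
  moreover have "\<phi> ` {i. i < s \<and> arrow i j} \<subseteq> {..<s div 2}"
  proof
    fix x assume "x \<in> \<phi> ` {i. i < s \<and> arrow i j}"
    then obtain i where i: "x = \<phi> i" "i < s" "arrow i j" by blast
    then consider "i < j" "odd (i + j)" | "j < i" "even (i + j)" by (auto simp: arrow_def)
    then show "x \<in> {..<s div 2}"
    proof cases
      case 1
      then have "i div 2 < s div 2" using assms by presburger
      then show ?thesis using 1 i by (simp add: \<phi>_def)
    next
      case 2
      then have "(i - 1) div 2 < s div 2" using i by presburger
      then show ?thesis using 2 i by (simp add: \<phi>_def)
    qed
  qed
  ultimately show ?thesis using card_inj_on_le[of \<phi> _ "{..<s div 2}"] by simp
qed

definition polynomial_fun :: "('a::comm_ring_1 \<Rightarrow> 'a) \<Rightarrow> bool" where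
  "polynomial_fun f \<longleftrightarrow> (\<exists>p. \<forall>x. f x = poly p x)"

lemma polynomial_fun_const: "polynomial_fun (\<lambda>_. c)"
  unfolding polynomial_fun_def by (intro exI[of _ "[:c:]"]) auto

lemma polynomial_fun_id: "polynomial_fun (\<lambda>x. x)"
  unfolding polynomial_fun_def by (intro exI[of _ "[:0, 1:]"]) auto

lemma polynomial_fun_add:
  "polynomial_fun f \<Longrightarrow> polynomial_fun g \<Longrightarrow> polynomial_fun (\<lambda>x. f x + g x)"
  unfolding polynomial_fun_def by (metis poly_add)

lemma polynomial_fun_mult:
  "polynomial_fun f \<Longrightarrow> polynomial_fun g \<Longrightarrow> polynomial_fun (\<lambda>x. f x * g x)"
  unfolding polynomial_fun_def by (metis poly_mult)

lemma polynomial_fun_diff: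
  "polynomial_fun f \<Longrightarrow> polynomial_fun g \<Longrightarrow> polynomial_fun (\<lambda>x. f x - g x)"
  unfolding polynomial_fun_def by (metis poly_diff)

lemma polynomial_fun_power: "polynomial_fun f \<Longrightarrow> polynomial_fun (\<lambda>x. f x ^ k)"
  by (induction k) (auto intro: polynomial_fun_const polynomial_fun_mult)

lemma polynomial_fun_prod:
  "(\<And>i. i \<in> S \<Longrightarrow> polynomial_fun (f i)) \<Longrightarrow> polynomial_fun (\<lambda>x. \<Prod>i\<in>S. f i x)"
  by (induction S rule: infinite_finite_induct) (auto intro: polynomial_fun_const polynomial_fun_mult)

text \<open>
  On each of \<open>s\<close> lines \<open>s\<close> points are placed such that polynomials \<open>q j\<close> of degree less than
  \<open>s div 2\<close> on the lines can be chosen to correct any incompatibility at the nodes. The lines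
  are the players of a tournament without big winners; when \<open>i\<close> beats \<open>l\<close>, one of the points on
  the \<open>i\<close>-th line is placed near its node with the \<open>l\<close>-th. In the limit \<open>\<epsilon> \<rightarrow> 0\<close> the
  linear system at the nodes becomes diagonal.
\<close>

lemma gluing:
  fixes e :: "nat \<Rightarrow> 'a::alg_closed_field" and s M :: nat
  assumes e: "inj e"
  obtains b :: "nat \<Rightarrow> nat \<Rightarrow> 'a" where
    "\<And>i. i < s \<Longrightarrow> inj_on (b i) {..<s}"
    "\<And>i l j. i < s \<Longrightarrow> l < s \<Longrightarrow> j < s \<Longrightarrow> b i l \<noteq> e j"
    "\<And>m \<tau>. m \<in> {1..M} \<Longrightarrow> \<exists>q. (\<forall>j<s. degree (q j) \<le> s div 2 - 1) \<and>
       (\<forall>i<s. \<forall>j<s. arrow i j \<longrightarrow>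
          (\<Prod>l<s. e j - b i l) ^ m * poly (q i) (e j) - (\<Prod>l<s. e i - b j l) ^ m * poly (q j) (e i) = \<tau> i j)"
proof -
  have inj: "e x = e y \<longleftrightarrow> x = y" for x y using e by (auto dest: injD)
  \<comment> \<open>For \<open>\<epsilon> = 0\<close> the points chosen along arrows sit at the
    nodes. The other points take spare parameters, distinct from each other and from those of the
    lines.\<close>
  define b where "b \<epsilon> i l = (if l \<noteq> i \<and> arrow i l then e l + \<epsilon> else e (s + i * s + l))" for \<epsilon> i l
  define A where "A \<epsilon> i z = (\<Prod>l<s. z - b \<epsilon> i l)" for \<epsilon> i z
  define In where "In j = {i. i < s \<and> arrow i j}" for j
  have finIn: "finite (In j)" for j by (simp add: In_def)
  define I where "I = {(i, j). i < s \<and> j < s \<and> arrow i j}"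
  have finI: "finite I"
    by (rule finite_subset[of _ "{..<s} \<times> {..<s}"]) (auto simp: I_def)
  \<comment> \<open>Lagrange polynomials, up to scaling, for the parameters \<open>e i\<close> with
    \<open>arrow i j\<close>. They are the basis in which \<open>q j\<close> is sought, so there is
    one unknown per arrow, hence per node.\<close>
  define N where "N j i = (\<Prod>i'\<in>In j - {i}. [:- e i', 1:])" for j i
  define mat where "mat m \<epsilon> = (\<lambda>(i, j) (i', j').
     (if j' = i then A \<epsilon> i (e j) ^ m * poly (N i i') (e j) else 0) -
     (if j' = j then A \<epsilon> j (e i) ^ m * poly (N j i') (e i) else 0))" for m \<epsilon>
  have poly_A: "polynomial_fun (\<lambda>\<epsilon>. A \<epsilon> i z)" for i z
  proof -
    have "polynomial_fun (\<lambda>\<epsilon>. z - b \<epsilon> i l)" for l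
      by (cases "l \<noteq> i \<and> arrow i l")
        (auto simp: b_def intro!: polynomial_fun_const polynomial_fun_diff polynomial_fun_add polynomial_fun_id)
    then show ?thesis unfolding A_def by (intro polynomial_fun_prod)
  qed
  have poly_det: "polynomial_fun (\<lambda>\<epsilon>. idet I (mat m \<epsilon>))" for m
  proof (rule idet_closed[OF polynomial_fun_const polynomial_fun_add polynomial_fun_mult _ finI])
    fix r r' :: "nat \<times> nat"
    obtain i j i' j' where r: "r = (i, j)" "r' = (i', j')" by (cases r, cases r')
    have 1: "polynomial_fun (\<lambda>\<epsilon>. if j' = i then A \<epsilon> i (e j) ^ m * poly (N i i') (e j) else 0)"
      by (cases "j' = i") (simp_all add: polynomial_fun_const polynomial_fun_mult polynomial_fun_power poly_A)
    have 2: "polynomial_fun (\<lambda>\<epsilon>. if j' = j then A \<epsilon> j (e i) ^ m * poly (N j i') (e i) else 0)"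
      by (cases "j' = j") (simp_all add: polynomial_fun_const polynomial_fun_mult polynomial_fun_power poly_A)
    show "polynomial_fun (\<lambda>\<epsilon>. mat m \<epsilon> r r')"
      using polynomial_fun_diff[OF 1 2] by (simp add: mat_def r)
  qed
  have det_0: "idet I (mat m 0) \<noteq> 0" if m: "m \<ge> 1" for m
  proof (rule idet_diagonal_nonzero[OF finI])
    \<comment> \<open>In the limit the term with \<open>q i\<close> drops out along an arrow from
      \<open>i\<close> to \<open>j\<close>. Only the value of \<open>q j\<close> at
      \<open>e i\<close> is left, and a single Lagrange coefficient controls it.\<close>
    have A_zero: "A 0 i (e j) = 0" if "arrow i j" "j < s" for i j
      unfolding A_def using that arrow_irrefl by (intro prod_zero) (auto simp: b_def)
    have A_nonzero: "A 0 j (e i) \<noteq> 0" if "arrow i j" "i < s" for i j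
      using that arrow_asym by (auto simp: A_def prod_zero_iff b_def inj)
    fix r assume r: "r \<in> I"
    obtain i j where ij: "r = (i, j)" by (cases r)
    have "i \<noteq> j" using r ij arrow_irrefl by (auto simp: I_def)
    then have "mat m 0 r r = - (A 0 j (e i) ^ m * poly (N j i) (e i))"
      by (simp add: mat_def ij)
    moreover have "poly (N j i) (e i) \<noteq> 0"
      using finIn by (auto simp: N_def poly_prod prod_zero_iff inj)
    ultimately show "mat m 0 r r \<noteq> 0" using A_nonzero r ij by (auto simp: I_def)
    fix r' assume r': "r' \<in> I" "r \<noteq> r'"
    obtain i' j' where ij': "r' = (i', j')" by (cases r')
    have "poly (N j i') (e i) = 0" if "j' = j"
    proof -
      have "i \<in> In j - {i'}" using r r' ij ij' that by (auto simp: I_def In_def)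
      then show ?thesis using finIn by (auto simp: N_def poly_prod prod_zero_iff)
    qed
    moreover have "A 0 i (e j) ^ m = 0" using A_zero r ij m by (simp add: I_def)
    ultimately show "mat m 0 r r' = 0" using \<open>i \<noteq> j\<close> by (simp add: mat_def ij ij')
  qed
  have "\<exists>p. \<forall>\<epsilon>. idet I (mat m \<epsilon>) = poly p \<epsilon>" for m
    using poly_det[of m] unfolding polynomial_fun_def .
  then obtain p where p: "\<And>m \<epsilon>. idet I (mat m \<epsilon>) = poly (p m) \<epsilon>" by metis
  have p0: "p m \<noteq> 0" if "m \<ge> 1" for m
    using det_0[OF that] p[of m 0] by auto
  \<comment> \<open>One \<open>\<epsilon>\<close> serves all orders up to \<open>M\<close>, since
    the induction in \<open>lines_interpolate\<close> passes through all of them. It also has to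
    avoid coincidences of points with each other and with nodes.\<close>
  define bad where "bad = (\<Union>m\<in>{1..M}. {\<epsilon>. poly (p m) \<epsilon> = 0}) \<union>
    (\<lambda>(x, l). e x - e l) ` ({..<s + s * s} \<times> {..<s})"
  have "finite bad" unfolding bad_def using p0 by (auto intro!: poly_roots_finite)
  then obtain \<epsilon> where \<epsilon>: "\<epsilon> \<notin> bad" using ex_new_if_finite[OF alg_closed_infinite] by blast
  have \<epsilon>_sum: "e l + \<epsilon> \<noteq> e x" if "l < s" "x < s + s * s" for l x
  proof
    assume "e l + \<epsilon> = e x"
    then have "\<epsilon> = (\<lambda>(x, l). e x - e l) (x, l)" by (simp add: algebra_simps)
    then have "\<epsilon> \<in> bad" unfolding bad_def using that by (intro UnI2 image_eqI[of _ _ "(x, l)"]) auto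
    then show False using \<epsilon> by simp
  qed
  have index: "s + i * s + l < s + s * s" if "i < s" "l < s" for i l
  proof -
    have "i * s + l < Suc i * s" using that by simp
    also have "\<dots> \<le> s * s" using that by (intro mult_right_mono) auto
    finally show ?thesis by simp
  qed
  show ?thesis
  proof (rule that[of "b \<epsilon>"])
    fix i assume i: "i < s"
    show "inj_on (b \<epsilon> i) {..<s}"
    proof (rule inj_onI)
      fix l l' assume l: "l \<in> {..<s}" "l' \<in> {..<s}" "b \<epsilon> i l = b \<epsilon> i l'"
      then show "l = l'"
        using \<epsilon>_sum[of l "s + i * s + l'"] \<epsilon>_sum[of l' "s + i * s + l"] index[of i l] index[of i l'] i
        by (auto simp: b_def inj split: if_splits)
    qed
    fix l j assume "l < s" "j < s"
    then show "b \<epsilon> i l \<noteq> e j"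
      using \<epsilon>_sum[of l j] by (auto simp: b_def inj)
  next
    fix m \<tau> assume m: "m \<in> {1..M}"
    have "idet I (mat m \<epsilon>) \<noteq> 0" using \<epsilon> m p by (auto simp: bad_def)
    then obtain x where x: "\<And>r. r \<in> I \<Longrightarrow> (\<Sum>r'\<in>I. mat m \<epsilon> r r' * x r') = (case r of (i, j) \<Rightarrow> \<tau> i j)"
      using idet_solve[OF finI, of "mat m \<epsilon>" "\<lambda>r. case r of (i, j) \<Rightarrow> \<tau> i j"] by blast
    define q where "q j = (\<Sum>i'\<in>In j. Polynomial.smult (x (i', j)) (N j i'))" for j
    have sum_I: "(\<Sum>r'\<in>I. (case r' of (i', j') \<Rightarrow> if j' = j then c * poly (N j i') z else 0) * x r') = c * poly (q j) z"
      if "j < s" for j c z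
    proof -
      have "(\<Sum>r'\<in>I. (case r' of (i', j') \<Rightarrow> if j' = j then c * poly (N j i') z else 0) * x r') =
          (\<Sum>r'\<in>(\<lambda>i'. (i', j)) ` In j. (case r' of (i', j') \<Rightarrow> if j' = j then c * poly (N j i') z else 0) * x r')"
        using that by (intro sum.mono_neutral_right finI) (auto simp: I_def In_def)
      also have "\<dots> = (\<Sum>i'\<in>In j. c * poly (N j i') z * x (i', j))"
        by (subst sum.reindex) (auto simp: inj_on_def)
      also have "\<dots> = c * poly (q j) z"
        by (simp add: q_def poly_sum sum_distrib_left mult_ac)
      finally show ?thesis .
    qed
    show "\<exists>q. (\<forall>j<s. degree (q j) \<le> s div 2 - 1) \<and>
       (\<forall>i<s. \<forall>j<s. arrow i j \<longrightarrow>
          (\<Prod>l<s. e j - b \<epsilon> i l) ^ m * poly (q i) (e j) - (\<Prod>l<s. e i - b \<epsilon> j l) ^ m * poly (q j) (e i) = \<tau> i j)"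
    proof (intro exI[of _ q] conjI allI impI)
      fix j assume j: "j < s"
      have "degree (N j i') \<le> s div 2 - 1" if "i' \<in> In j" for i'
      proof -
        have inj_on_e: "inj_on e (In j - {i'})" using e by (rule inj_on_subset) simp
        have "N j i' = (\<Prod>b\<in>e ` (In j - {i'}). [:-b, 1:])"
          unfolding N_def by (simp add: prod.reindex[OF inj_on_e])
        then have "degree (N j i') = card (In j) - 1"
          using that by (simp add: degree_prod_linear card_image[OF inj_on_e])
        then show ?thesis using card_arrow_le[OF j] by (simp add: In_def)
      qed
      then show "degree (q j) \<le> s div 2 - 1"
        unfolding q_def by (intro degree_sum_le finIn order.trans[OF degree_smult_le]) auto
    next
      fix i j assume ij: "i < s" "j < s" "arrow i j"
      have "\<tau> i j = (\<Sum>r'\<in>I. mat m \<epsilon> (i, j) r' * x r')"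
        using x[of "(i, j)"] ij by (simp add: I_def)
      also have "\<dots> = (\<Sum>r'\<in>I. (case r' of (i', j') \<Rightarrow> if j' = i then A \<epsilon> i (e j) ^ m * poly (N i i') (e j) else 0) * x r') -
         (\<Sum>r'\<in>I. (case r' of (i', j') \<Rightarrow> if j' = j then A \<epsilon> j (e i) ^ m * poly (N j i') (e i) else 0) * x r')"
        unfolding sum_subtractf[symmetric] by (intro sum.cong) (auto simp: mat_def left_diff_distrib)
      also have "\<dots> = A \<epsilon> i (e j) ^ m * poly (q i) (e j) - A \<epsilon> j (e i) ^ m * poly (q j) (e i)"
        using sum_I ij by simp
      finally show "(\<Prod>l<s. e j - b \<epsilon> i l) ^ m * poly (q i) (e j) - (\<Prod>l<s. e i - b \<epsilon> j l) ^ m * poly (q j) (e i) = \<tau> i j"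
        by (simp add: A_def)
    qed
  qed
qed

text \<open>Each step of the induction on the order peels off all lines once. Hermite interpolation
  on the lines, corrected by multiples of \<open>A i ^ Suc m\<close> until the nodes agree,
  prescribes the restrictions, and \<open>f0\<close> extends them. What is missing at a point is
  locally a multiple of its line, and is supplied in order \<open>m\<close> by the product of all
  lines times a polynomial of \<open>s\<close> degrees less.\<close>

lemma lines_interpolate:
  fixes e :: "nat \<Rightarrow> 'a::field" and b :: "nat \<Rightarrow> nat \<Rightarrow> 'a"
  assumes e: "inj e"
    and b: "\<And>i. i < s \<Longrightarrow> inj_on (b i) {..<s}"
      "\<And>i l j. i < s \<Longrightarrow> l < s \<Longrightarrow> j < s \<Longrightarrow> b i l \<noteq> e j"
    and glue: "\<And>m \<tau>. m \<in> {1..M} \<Longrightarrow> \<exists>q. (\<forall>j<s. degree (q j) \<le> k) \<and>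
       (\<forall>i<s. \<forall>j<s. arrow i j \<longrightarrow>
          (\<Prod>l<s. e j - b i l) ^ m * poly (q i) (e j) - (\<Prod>l<s. e i - b j l) ^ m * poly (q j) (e i) = \<tau> i j)"
    and m: "m \<le> M"
  shows "\<exists>f. tdeg f \<le> m * s + k \<and> (\<forall>i<s. \<forall>l<s. vanish (pair_point (e i) (b i l)) m (f - h i l))"
  using m
proof (induction m arbitrary: h)
  case 0
  show ?case by (intro exI[of _ 0]) simp
next
  case (Suc m)
  define d where "d = Suc m * s + k"
  have inj: "e x = e y \<longleftrightarrow> x = y" for x y using e by (auto dest: injD)
  define A where "A i = (\<Prod>l<s. [:- b i l, 1:])" for i
  have "\<exists>y. degree y \<le> s * Suc m \<and> (\<forall>l<s. [:-b i l, 1:] ^ Suc m dvd y - rline (e i) (h i l))" if "i < s" for i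
    using hermite_interpolation[OF b(1)[OF that]] .
  then obtain y where y: "\<And>i. i < s \<Longrightarrow> degree (y i) \<le> s * Suc m"
      "\<And>i l. i < s \<Longrightarrow> l < s \<Longrightarrow> [:-b i l, 1:] ^ Suc m dvd y i - rline (e i) (h i l)"
    by metis
  obtain q where q: "\<And>j. j < s \<Longrightarrow> degree (q j) \<le> k"
    "\<And>i j. i < s \<Longrightarrow> j < s \<Longrightarrow> arrow i j \<Longrightarrow>
      (\<Prod>l<s. e j - b i l) ^ Suc m * poly (q i) (e j) - (\<Prod>l<s. e i - b j l) ^ Suc m * poly (q j) (e i)
       = poly (y j) (e i) - poly (y i) (e j)"
    using glue[of "Suc m" "\<lambda>i j. poly (y j) (e i) - poly (y i) (e j)"] Suc.prems by auto
  define F where "F i = y i + A i ^ Suc m * q i" for i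
  have F_eval: "poly (F i) (e j) = poly (y i) (e j) + (\<Prod>l<s. e j - b i l) ^ Suc m * poly (q i) (e j)" for i j
    by (simp add: F_def A_def poly_prod poly_power)
  have F_arrow: "poly (F i) (e j) = poly (F j) (e i)" if "i < s" "j < s" "arrow i j" for i j
    using q(2)[OF that] unfolding F_eval by (simp add: algebra_simps)
  have degF: "degree (F i) \<le> d" if i: "i < s" for i
  proof -
    have "degree (A i) \<le> s"
      unfolding A_def using degree_prod_sum_le[of "{..<s}" "\<lambda>l. [:- b i l, 1:]"] by simp
    then have "degree (A i ^ Suc m) \<le> s * Suc m"
      by (meson degree_power_le le_trans mult_le_mono1)
    then have "degree (A i ^ Suc m * q i) \<le> s * Suc m + k"
      using degree_mult_le[of "A i ^ Suc m" "q i"] q(1)[OF i] by linarith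
    moreover have "s * Suc m + k = d" "s * Suc m \<le> d" by (simp_all add: d_def)
    ultimately show ?thesis unfolding F_def using y(1)[OF i] by (intro degree_add_le) simp_all
  qed
  have "poly (F i) (e j) = poly (F j) (e i)" if "i < s" "j < s" "i \<noteq> j" for i j
    using F_arrow[of i j] F_arrow[of j i] arrow_total[OF that(3)] that by auto
  then have "\<exists>f. tdeg f \<le> d \<and> (\<forall>i<s. rline (e i) f = F i)"
    by (intro lines_lift[OF e] degF)
  then obtain f0 where f0: "tdeg f0 \<le> d" "\<And>i. i < s \<Longrightarrow> rline (e i) f0 = F i" by blast
  have "\<exists>g. vanish (pair_point (e i) (b i l)) (Suc m) (h i l - f0 - lform (e i) * g)" if "i < s" "l < s" for i l
  proof (rule vanish_line_decomp)
    have "[:-b i l, 1:] dvd A i" unfolding A_def using that by (intro dvd_prodI) auto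
    then have "[:-b i l, 1:] ^ Suc m dvd A i ^ Suc m * q i" by (intro dvd_mult2 dvd_power_same)
    then have "[:-b i l, 1:] ^ Suc m dvd - (y i - rline (e i) (h i l)) - A i ^ Suc m * q i"
      using y(2)[OF that] by (intro dvd_diff) (simp_all only: dvd_minus_iff)
    moreover have "rline (e i) (h i l - f0) = - (y i - rline (e i) (h i l)) - A i ^ Suc m * q i"
      using f0(2)[OF that(1)] by (simp add: rline.hom_minus F_def)
    ultimately show "[:-b i l, 1:] ^ Suc m dvd rline (e i) (h i l - f0)" by simp
  qed
  then obtain g where g: "\<And>i l. i < s \<Longrightarrow> l < s \<Longrightarrow>
      vanish (pair_point (e i) (b i l)) (Suc m) (h i l - f0 - lform (e i) * g i l)"
    by metis
  \<comment> \<open>At the points of the \<open>i\<close>-th line the other lines do not vanish, so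
    \<open>E i\<close> is invertible there up to order \<open>m\<close>; the residual problem asks
    for \<open>g i l\<close> divided by \<open>E i\<close>.\<close>
  define E where "E i = (\<Prod>j\<in>{..<s} - {i}. lform (e j))" for i
  have "\<exists>v. vanish (pair_point (e i) (b i l)) m (E i * v - 1)" if "i < s" "l < s" for i l
  proof (rule inverse_mod_vanish)
    show "bvalue (pair_point (e i) (b i l)) (E i) \<noteq> 0"
      using b(2)[OF that] by (auto simp: E_def bvalue.hom_prod bvalue_lform prod_zero_iff inj)
  qed
  then obtain v where v: "\<And>i l. i < s \<Longrightarrow> l < s \<Longrightarrow> vanish (pair_point (e i) (b i l)) m (E i * v i l - 1)"
    by metis
  obtain f1 where f1: "tdeg f1 \<le> m * s + k"
      "\<And>i l. i < s \<Longrightarrow> l < s \<Longrightarrow> vanish (pair_point (e i) (b i l)) m (f1 - g i l * v i l)"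
    using Suc.IH[of "\<lambda>i l. g i l * v i l"] Suc.prems by auto
  define f where "f = f0 + (\<Prod>j<s. lform (e j)) * f1"
  have "tdeg (\<Prod>j<s. lform (e j)) \<le> s"
    using tdeg_prod_le[of "\<lambda>j. lform (e j)" "{..<s}"] by simp
  then have "tdeg ((\<Prod>j<s. lform (e j)) * f1) \<le> d"
    using tdeg_mult_le[of "\<Prod>j<s. lform (e j)" f1] f1(1) by (simp add: d_def)
  then have "tdeg f \<le> Suc m * s + k"
    unfolding f_def d_def[symmetric] by (intro tdeg_add_le f0(1))
  moreover have "vanish (pair_point (e i) (b i l)) (Suc m) (f - h i l)" if il: "i < s" "l < s" for i l
  proof -
    let ?P = "pair_point (e i) (b i l)"
    have "vanish ?P m (E i * (f1 - g i l * v i l) + g i l * (E i * v i l - 1))"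
      by (intro vanish_add vanish_multR f1(2) v il)
    moreover have "E i * (f1 - g i l * v i l) + g i l * (E i * v i l - 1) = E i * f1 - g i l"
      by (simp add: algebra_simps)
    ultimately have "vanish ?P (1 + m) (lform (e i) * (E i * f1 - g i l))"
      by (intro vanish_mult vanish_lform_self) simp
    then have "vanish ?P (Suc m) (lform (e i) * (E i * f1 - g i l) - (h i l - f0 - lform (e i) * g i l))"
      by (intro vanish_diff g il) simp
    moreover have "(\<Prod>j<s. lform (e j)) = lform (e i) * E i"
      unfolding E_def using il by (intro prod.remove) auto
    then have "lform (e i) * (E i * f1 - g i l) - (h i l - f0 - lform (e i) * g i l) = f - h i l"
      unfolding f_def by (simp add: algebra_simps)
    ultimately show ?thesis by simp
  qed
  ultimately show ?case by blast
qed

lemma ex_interp: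
  "\<exists>u :: nat \<Rightarrow> 'a::alg_closed_field \<times> 'a. interp (s ^ 2) m (m * s + (s div 2 - 1)) u"
proof -
  obtain e :: "nat \<Rightarrow> 'a" where e: "inj e" using ex_inj_nat by blast
  obtain b :: "nat \<Rightarrow> nat \<Rightarrow> 'a" where b:
    "\<And>i. i < s \<Longrightarrow> inj_on (b i) {..<s}"
    "\<And>i l j. i < s \<Longrightarrow> l < s \<Longrightarrow> j < s \<Longrightarrow> b i l \<noteq> e j"
    "\<And>m' \<tau>. m' \<in> {1..m} \<Longrightarrow> \<exists>q. (\<forall>j<s. degree (q j) \<le> s div 2 - 1) \<and>
       (\<forall>i<s. \<forall>j<s. arrow i j \<longrightarrow>
          (\<Prod>l<s. e j - b i l) ^ m' * poly (q i) (e j) - (\<Prod>l<s. e i - b j l) ^ m' * poly (q j) (e i) = \<tau> i j)"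
    using gluing[OF e, of s m] by blast
  define u where "u i = pair_point (e (i div s)) (b (i div s) (i mod s))" for i
  have "interp (s ^ 2) m (m * s + (s div 2 - 1)) u"
    unfolding interp_def
  proof
    fix h :: "nat \<Rightarrow> 'a poly poly"
    obtain f where f: "tdeg f \<le> m * s + (s div 2 - 1)"
      "\<And>i l. i < s \<Longrightarrow> l < s \<Longrightarrow> vanish (pair_point (e i) (b i l)) m (f - h (i * s + l))"
      using lines_interpolate[OF e b order.refl, where h = "\<lambda>i l. h (i * s + l)"] by blast
    have "vanish (u i) m (f - h i)" if "i < s ^ 2" for i
    proof -
      have "i div s < s" using that by (simp add: less_mult_imp_div_less power2_eq_square)
      moreover have "i mod s < s" using that by (cases "s = 0") auto
      ultimately show ?thesis using f(2)[of "i div s" "i mod s"] by (simp add: u_def)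
    qed
    then show "\<exists>f. tdeg f \<le> m * s + (s div 2 - 1) \<and> (\<forall>i<s ^ 2. vanish (u i) m (f - h i))"
      using f(1) by blast
  qed
  then show ?thesis by blast
qed

section \<open>Evaluation of multivariate polynomials\<close>

lemma mpoly_sum_single:
  "f = (\<Sum>e\<in>Poly_Mapping.keys f. Poly_Mapping.single e (Poly_Mapping.lookup f e))"
proof (rule poly_mapping_eqI)
  fix k
  show "Poly_Mapping.lookup f k =
      Poly_Mapping.lookup (\<Sum>e\<in>Poly_Mapping.keys f. Poly_Mapping.single e (Poly_Mapping.lookup f e)) k"
    by (simp add: lookup_sum lookup_single when_def in_keys_iff)
qed

lemma mpoly_induct [case_names single add]:
  fixes Q :: "('k \<Rightarrow>\<^sub>0 'b::comm_monoid_add) \<Rightarrow> bool"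
  assumes "\<And>e c. Q (Poly_Mapping.single e c)" "\<And>f g. Q f \<Longrightarrow> Q g \<Longrightarrow> Q (f + g)"
  shows "Q f"
proof -
  have "Q (\<Sum>e\<in>S. Poly_Mapping.single e (Poly_Mapping.lookup f e))" if "finite S" for S
    using that
  proof (induction S rule: finite_induct)
    case empty
    show ?case using assms(1)[of _ 0] by simp
  qed (simp add: assms)
  then show ?thesis by (metis finite_keys mpoly_sum_single)
qed

definition mon_eval :: "('v \<Rightarrow> 'r::comm_ring_1) \<Rightarrow> ('v \<Rightarrow>\<^sub>0 nat) \<Rightarrow> 'r" where
  "mon_eval V e = (\<Prod>j\<in>Poly_Mapping.keys e. V j ^ Poly_Mapping.lookup e j)"

lemma mon_eval_superset:
  assumes "finite S" "Poly_Mapping.keys e \<subseteq> S"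
  shows "mon_eval V e = (\<Prod>j\<in>S. V j ^ Poly_Mapping.lookup e j)"
  unfolding mon_eval_def using assms by (intro prod.mono_neutral_left) (auto simp: in_keys_iff)

lemma mon_eval_0 [simp]: "mon_eval V 0 = 1"
  by (simp add: mon_eval_def)

lemma mon_eval_single [simp]: "mon_eval V (Poly_Mapping.single j k) = V j ^ k"
  by (cases "k = 0") (simp_all add: mon_eval_def)

lemma mon_eval_add: "mon_eval V (e + e') = mon_eval V e * mon_eval V e'"
proof -
  let ?S = "Poly_Mapping.keys e \<union> Poly_Mapping.keys e'"
  have "mon_eval V (e + e') = (\<Prod>j\<in>?S. V j ^ Poly_Mapping.lookup (e + e') j)"
    using Poly_Mapping.keys_add[of e e'] by (intro mon_eval_superset) auto
  also have "\<dots> = (\<Prod>j\<in>?S. V j ^ Poly_Mapping.lookup e j) * (\<Prod>j\<in>?S. V j ^ Poly_Mapping.lookup e' j)"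
    by (simp add: lookup_add power_add prod.distrib)
  also have "\<dots> = mon_eval V e * mon_eval V e'"
    by (simp add: mon_eval_superset[of ?S])
  finally show ?thesis .
qed

lemma mon_eval_sum: "mon_eval V (sum f S) = (\<Prod>i\<in>S. mon_eval V (f i))"
  by (induction S rule: infinite_finite_induct) (simp_all add: mon_eval_add)

text \<open>The universal property of the polynomial ring; both \<open>mpoly_eval\<close> and
  \<open>graded\<close> are instances.\<close>

definition mev :: "('a::comm_ring_1 \<Rightarrow> 'r::comm_ring_1) \<Rightarrow> ('v \<Rightarrow> 'r) \<Rightarrow> ('v, 'a) mpoly \<Rightarrow> 'r" where
  "mev h V f = (\<Sum>e\<in>Poly_Mapping.keys f. h (Poly_Mapping.lookup f e) * mon_eval V e)"

lemma mpoly_eval_eq_mev: "mpoly_eval f x = mev (\<lambda>a. a) x f"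
  by (simp add: mpoly_eval_def mev_def mon_eval_def)

lemma mev_superset:
  assumes "comm_ring_hom h" "finite S" "Poly_Mapping.keys f \<subseteq> S"
  shows "mev h V f = (\<Sum>e\<in>S. h (Poly_Mapping.lookup f e) * mon_eval V e)"
proof -
  interpret h: comm_ring_hom h by fact
  show ?thesis
    unfolding mev_def using assms by (intro sum.mono_neutral_left) (auto simp: in_keys_iff)
qed

lemma mev_single:
  assumes "comm_ring_hom h"
  shows "mev h V (Poly_Mapping.single e c) = h c * mon_eval V e"
  using mev_superset[OF assms, of "{e}" "Poly_Mapping.single e c" V] by simp

lemma mev_add:
  assumes "comm_ring_hom h"
  shows "mev h V (f + g) = mev h V f + mev h V g"
proof -
  interpret h: comm_ring_hom h by fact
  let ?S = "Poly_Mapping.keys f \<union> Poly_Mapping.keys g"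
  have "mev h V (f + g) = (\<Sum>e\<in>?S. h (Poly_Mapping.lookup (f + g) e) * mon_eval V e)"
    using Poly_Mapping.keys_add[of f g] by (intro mev_superset[OF assms]) auto
  also have "\<dots> = mev h V f + mev h V g"
    by (simp add: lookup_add h.hom_add distrib_right sum.distrib mev_superset[OF assms, of ?S])
  finally show ?thesis .
qed

lemma mev_hom:
  assumes "comm_ring_hom h"
  shows "comm_ring_hom (mev h V)"
proof -
  interpret h: comm_ring_hom h by fact
  have mev_single_mult: "mev h V (Poly_Mapping.single e c * g) = mev h V (Poly_Mapping.single e c) * mev h V g" for e c g
  proof (induction g rule: mpoly_induct)
    case (single e' c')
    show ?case by (simp add: mult_single mev_single[OF assms] mon_eval_add h.hom_mult mult_ac)
  next
    case (add f g)
    then show ?case by (simp add: distrib_left mev_add[OF assms])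
  qed
  have "mev h V (f * g) = mev h V f * mev h V g" for f g
  proof (induction f rule: mpoly_induct)
    case (single e c)
    show ?case by (rule mev_single_mult)
  next
    case (add f f')
    then show ?case by (simp add: distrib_right mev_add[OF assms])
  qed
  moreover have "mev h V 0 = 0" by (simp add: mev_def)
  moreover have "mev h V 1 = 1"
    using mev_single[OF assms, of V 0 1] by (simp add: single_one)
  ultimately show ?thesis by unfold_locales (simp_all add: mev_add[OF assms])
qed

lemma id_hom: "comm_ring_hom (\<lambda>a::'a::comm_ring_1. a)"
  by unfold_locales auto

interpretation mpoly_eval: comm_ring_hom "\<lambda>f. mpoly_eval f x"
  unfolding mpoly_eval_eq_mev by (intro mev_hom id_hom)

section \<open>Dehomogenization\<close>

lemma exhaust_3': "(j :: 3) = 0 \<or> j = 1 \<or> j = 2"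
proof (induction j)
  case (of_int z)
  then have "z = 0 \<or> z = 1 \<or> z = 2" by fastforce
  then show ?case by auto
qed

lemma UNIV_3': "(UNIV :: 3 set) = {0, 1, 2}"
  using exhaust_3' by auto

text \<open>\<open>graded f\<close> is the polynomial in \<open>u\<close> whose \<open>d\<close>-th coefficient is the dehomogenization of the
  component of \<open>f\<close> of degree \<open>d\<close>.\<close>

definition graded :: "(3, 'a::comm_ring_1) mpoly \<Rightarrow> 'a poly poly poly" where
  "graded = mev (\<lambda>a. [:[:[:a:]:]:]) (\<lambda>j. if j = 0 then [:0, bX:] else if j = 1 then [:0, bY:] else [:0, 1:])"

lemma const_poly3_hom: "comm_ring_hom (\<lambda>a::'a::comm_ring_1. [:[:[:a:]:]:])"
  by unfold_locales (simp_all add: one_pCons)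

interpretation graded: comm_ring_hom graded
  unfolding graded_def by (intro mev_hom const_poly3_hom)

abbreviation mdeg :: "(3 \<Rightarrow>\<^sub>0 nat) \<Rightarrow> nat" where
  "mdeg e \<equiv> Poly_Mapping.lookup e 0 + Poly_Mapping.lookup e 1 + Poly_Mapping.lookup e 2"

lemma mon_eval_3: "mon_eval V e = V 0 ^ Poly_Mapping.lookup e 0 * V 1 ^ Poly_Mapping.lookup e 1 *
    V (2 :: 3) ^ Poly_Mapping.lookup e 2"
proof -
  have "mon_eval V e = (\<Prod>j\<in>UNIV. V j ^ Poly_Mapping.lookup e j)"
    by (rule mon_eval_superset) (rule finite, rule subset_UNIV)
  then show ?thesis unfolding UNIV_3' by (simp add: mult.assoc)
qed

lemma keys_sum_3: "(\<Sum>j\<in>Poly_Mapping.keys e. Poly_Mapping.lookup e j) = mdeg e"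
proof -
  have "(\<Sum>j\<in>Poly_Mapping.keys e. Poly_Mapping.lookup e j) = (\<Sum>j\<in>UNIV. Poly_Mapping.lookup e j)"
    by (intro sum.mono_neutral_left) (auto simp: in_keys_iff)
  then show ?thesis unfolding UNIV_3' by (simp add: add.assoc)
qed

lemma graded_single:
  "graded (Poly_Mapping.single e c) =
    monom (monom (monom c (Poly_Mapping.lookup e 0)) (Poly_Mapping.lookup e 1)) (mdeg e)"
proof -
  have "bX ^ k = monom (monom (1 :: 'a) k) 0" for k
    by (induction k) (simp_all add: monom_Suc monom_0 one_pCons)
  moreover have "[:0, bX :: 'a poly poly:] = monom bX 1" "[:0, bY :: 'a poly poly:] = monom bY 1"
    by (simp_all add: monom_Suc monom_0)
  moreover have "bY ^ k = monom (1 :: 'a poly) k" for k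
    by (simp add: monom_altdef)
  ultimately have X: "[:0, bX:] ^ k = monom (monom (monom (1::'a) k) 0) k"
    and Y: "[:0, bY:] ^ k = monom (monom (1 :: 'a poly) k) k" for k
    by (simp_all only: monom_power mult_1_left)
  have Z: "[:0, 1:] ^ k = monom (1 :: 'a poly poly) k" for k
    by (simp add: monom_altdef)
  have "graded (Poly_Mapping.single e c) =
      [:[:[:c:]:]:] * ([:0, bX:] ^ Poly_Mapping.lookup e 0 * [:0, bY:] ^ Poly_Mapping.lookup e 1 *
        [:0, 1:] ^ Poly_Mapping.lookup e 2)"
    unfolding graded_def by (subst mev_single[OF const_poly3_hom]) (simp add: mon_eval_3)
  also have "\<dots> = monom (monom (monom c (Poly_Mapping.lookup e 0)) (Poly_Mapping.lookup e 1)) (mdeg e)"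
    unfolding X Y Z by (simp add: mult_monom smult_monom)
  finally show ?thesis .
qed

lemma graded_sum:
  "graded f = (\<Sum>e\<in>Poly_Mapping.keys f. monom (monom (monom (Poly_Mapping.lookup f e)
     (Poly_Mapping.lookup e 0)) (Poly_Mapping.lookup e 1)) (mdeg e))"
  by (subst mpoly_sum_single[of f]) (simp only: graded.hom_sum graded_single)

text \<open>The total degree and the exponents of the variables \<open>0\<close> and
  \<open>1\<close> determine the third exponent, so distinct monomials have distinct images.\<close>

lemma graded_inj: "graded f = graded g \<Longrightarrow> f = g"
proof -
  assume "graded f = graded g"
  define h where "h = f - g"
  have h0: "graded h = 0" using \<open>graded f = graded g\<close> by (simp add: h_def graded.hom_minus)
  have "Poly_Mapping.lookup h e = 0" for e
  proof (cases "e \<in> Poly_Mapping.keys h")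
    case True
    have eq: "e' = e \<longleftrightarrow> mdeg e' = mdeg e \<and> Poly_Mapping.lookup e' 1 = Poly_Mapping.lookup e 1 \<and>
        Poly_Mapping.lookup e' 0 = Poly_Mapping.lookup e 0" for e'
    proof
      assume *: "mdeg e' = mdeg e \<and> Poly_Mapping.lookup e' 1 = Poly_Mapping.lookup e 1 \<and>
        Poly_Mapping.lookup e' 0 = Poly_Mapping.lookup e 0"
      show "e' = e"
      proof (rule poly_mapping_eqI)
        fix j show "Poly_Mapping.lookup e' j = Poly_Mapping.lookup e j"
          using exhaust_3'[of j] * by auto
      qed
    qed simp
    have "0 = coeff (coeff (coeff (graded h) (mdeg e)) (Poly_Mapping.lookup e 1)) (Poly_Mapping.lookup e 0)"
      by (simp add: h0)
    also have "\<dots> = (\<Sum>e'\<in>Poly_Mapping.keys h. if e' = e then Poly_Mapping.lookup h e' else 0)"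
      unfolding graded_sum coeff_sum
      by (intro sum.cong refl) (subst eq, auto)
    also have "\<dots> = Poly_Mapping.lookup h e" using True by simp
    finally show ?thesis by simp
  qed (simp add: in_keys_iff)
  then have "h = 0" by (intro poly_mapping_eqI) simp
  then show "f = g" by (simp add: h_def)
qed

lemma tdeg_coeff_graded: "tdeg (coeff (graded f) d) \<le> d"
proof -
  have "tdeg (monom (monom c (Poly_Mapping.lookup e 0)) (Poly_Mapping.lookup e 1)) \<le> mdeg e" for c :: 'a and e
    by (auto simp: tdeg_le_iff coeff_monom split: if_splits)
  then show ?thesis
    unfolding graded_sum coeff_sum by (intro tdeg_sum_le) auto
qed

lemma graded_var:
  "graded (mpoly_var 0) = monom bX 1" "graded (mpoly_var 1) = monom bY 1" "graded (mpoly_var 2) = monom 1 1"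
  unfolding mpoly_var_def graded_single
  by (simp_all add: lookup_single monom_0 monom_Suc when_def one_pCons)

lemma graded_const: "graded (Poly_Mapping.single 0 c) = monom (bconst c) 0"
  by (simp add: graded_single monom_0)

section \<open>Ideals\<close>

lemma ideal_gen_base: "a \<in> S \<Longrightarrow> a \<in> ideal_gen S"
  unfolding ideal_gen_def by (rule module.span_base[OF module_mult])

lemma ideal_gen_0: "0 \<in> ideal_gen S"
  unfolding ideal_gen_def by (rule module.span_zero[OF module_mult])

lemma ideal_gen_add: "a \<in> ideal_gen S \<Longrightarrow> b \<in> ideal_gen S \<Longrightarrow> a + b \<in> ideal_gen S"
  unfolding ideal_gen_def by (rule module.span_add[OF module_mult])

lemma ideal_gen_mult: "a \<in> ideal_gen S \<Longrightarrow> c * a \<in> ideal_gen S"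
  unfolding ideal_gen_def by (rule module.span_scale[OF module_mult])

lemma ideal_gen_induct [consumes 1, case_names zero add mult base]:
  assumes "a \<in> ideal_gen S" "Q 0" "\<And>a b. Q a \<Longrightarrow> Q b \<Longrightarrow> Q (a + b)"
    "\<And>c a. Q a \<Longrightarrow> Q (c * a)" "\<And>a. a \<in> S \<Longrightarrow> Q a"
  shows "Q a"
  using assms(1) unfolding ideal_gen_def
proof (rule module.span_induct[OF module_mult])
  show "module.subspace (*) {a. Q a}"
    unfolding module.subspace_def[OF module_mult] using assms by auto
qed (use assms in auto)

definition is_ideal :: "'r::comm_ring_1 set \<Rightarrow> bool" where
  "is_ideal I \<longleftrightarrow> 0 \<in> I \<and> (\<forall>a\<in>I. \<forall>b\<in>I. a + b \<in> I) \<and> (\<forall>a\<in>I. \<forall>c. c * a \<in> I)"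

lemma is_ideal_gen: "is_ideal (ideal_gen S)"
  unfolding is_ideal_def by (auto intro: ideal_gen_0 ideal_gen_add ideal_gen_mult)

lemma is_ideal_mult: "is_ideal (ideal_mult A B)"
  unfolding ideal_mult_def by (rule is_ideal_gen)

lemma is_ideal_power: "is_ideal (ideal_power A k)"
  by (cases k) (simp_all add: is_ideal_mult, simp add: is_ideal_def)

lemma is_ideal_D:
  assumes "is_ideal I"
  shows "0 \<in> I" "a \<in> I \<Longrightarrow> b \<in> I \<Longrightarrow> a + b \<in> I" "a \<in> I \<Longrightarrow> c * a \<in> I"
  using assms unfolding is_ideal_def by blast+

lemma is_ideal_sum: "is_ideal I \<Longrightarrow> (\<And>i. i \<in> S \<Longrightarrow> f i \<in> I) \<Longrightarrow> sum f S \<in> I"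
  by (induction S rule: infinite_finite_induct) (auto intro: is_ideal_D)

lemma ideal_multI: "a \<in> A \<Longrightarrow> b \<in> B \<Longrightarrow> a * b \<in> ideal_mult A B"
  unfolding ideal_mult_def by (intro ideal_gen_base) blast

lemma ideal_mult_induct [consumes 1, case_names zero add mult base]:
  assumes "x \<in> ideal_mult A B" "Q 0" "\<And>a b. Q a \<Longrightarrow> Q b \<Longrightarrow> Q (a + b)"
    "\<And>c a. Q a \<Longrightarrow> Q (c * a)" "\<And>a b. a \<in> A \<Longrightarrow> b \<in> B \<Longrightarrow> Q (a * b)"
  shows "Q x"
  using assms(1) unfolding ideal_mult_def by (induction rule: ideal_gen_induct) (use assms in auto)

lemma ideal_mult_mono:
  assumes "x \<in> ideal_mult A B" "A \<subseteq> A'"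
  shows "x \<in> ideal_mult A' B"
  using assms(1)
  by (induction rule: ideal_mult_induct)
    (use assms(2) in \<open>auto intro: is_ideal_D[OF is_ideal_mult] ideal_multI\<close>)

lemma ideal_mult_subset_right: "ideal_mult A (ideal_power B k) \<subseteq> ideal_power B k"
proof
  fix x assume "x \<in> ideal_mult A (ideal_power B k)"
  then show "x \<in> ideal_power B k"
    by (induction rule: ideal_mult_induct) (auto intro: is_ideal_D[OF is_ideal_power])
qed

lemma ideal_power_antimono: "k \<le> l \<Longrightarrow> ideal_power A l \<subseteq> ideal_power A k"
proof (induction l rule: dec_induct)
  case (step l)
  have "ideal_power A (Suc l) \<subseteq> ideal_power A l"
    using ideal_mult_subset_right[of A A l] by simp
  with step show ?case by blast
qed simp

text \<open>Moves a newly exposed factor past the power of the irrelevant ideal to join the other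
  factors.\<close>

lemma ideal_mult_left_commute:
  assumes "x \<in> S" "y \<in> ideal_mult A B"
  shows "x * y \<in> ideal_mult A (ideal_mult S B)"
  using assms(2)
proof (induction rule: ideal_mult_induct)
  case (mult c a)
  have eq: "x * (c * a) = c * (x * a)" by (simp add: mult_ac)
  show ?case unfolding eq by (rule is_ideal_D(3)[OF is_ideal_mult mult])
next
  case (base a b)
  have eq: "x * (a * b) = a * (x * b)" by (simp add: mult_ac)
  show ?case unfolding eq by (intro ideal_multI base assms(1))
qed (auto simp: distrib_left intro: is_ideal_D[OF is_ideal_mult])

section \<open>Forms and symbolic powers\<close>

definition affine_vec :: "'a::comm_ring_1 \<times> 'a \<Rightarrow> 3 \<Rightarrow> 'a" where
  "affine_vec P = (\<lambda>j. if j = 0 then fst P else if j = 1 then snd P else 1)"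

definition affine_point :: "'a::field \<times> 'a \<Rightarrow> 'a point" where
  "affine_point P = {w. \<exists>c. c \<noteq> 0 \<and> w = (\<lambda>j. c * affine_vec P j)}"

lemma affine_vec_simps [simp]: "affine_vec P 0 = fst P" "affine_vec P 1 = snd P" "affine_vec P 2 = 1"
  by (simp_all add: affine_vec_def)

lemma affine_vec_in_point: "affine_vec P \<in> affine_point P"
  unfolding affine_point_def by (intro CollectI exI[of _ 1]) simp

lemma affine_point_eq_iff: "affine_point P = affine_point Q \<longleftrightarrow> P = Q"
proof
  assume "affine_point P = affine_point Q"
  then obtain c where c: "affine_vec P = (\<lambda>j. c * affine_vec Q j)"
    using affine_vec_in_point[of P] unfolding affine_point_def by auto
  have "c = 1" using fun_cong[OF c, of 2] by simp
  then show "P = Q"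
    using fun_cong[OF c, of 0] fun_cong[OF c, of 1] by (simp add: prod_eq_iff)
qed simp

lemma bvalue_monom: "bvalue P (monom (monom c a) b) = c * fst P ^ a * snd P ^ b"
  by (simp add: bvalue_def poly_monom)

lemma form_graded:
  assumes "is_form f"
  obtains d where "\<And>e. e \<noteq> d \<Longrightarrow> coeff (graded f) e = 0"
    "bvalue P (coeff (graded f) d) = mpoly_eval f (affine_vec P)"
proof -
  obtain d where d: "\<And>e. e \<in> Poly_Mapping.keys f \<Longrightarrow> mdeg e = d"
    using assms unfolding is_form_def keys_sum_3 by blast
  show ?thesis
  proof (rule that[of d])
    show "coeff (graded f) e = 0" if "e \<noteq> d" for e
      unfolding graded_sum coeff_sum using d that by (intro sum.neutral) auto
    have "coeff (graded f) d = (\<Sum>e\<in>Poly_Mapping.keys f. monom (monom (Poly_Mapping.lookup f e)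
         (Poly_Mapping.lookup e 0)) (Poly_Mapping.lookup e 1))"
      unfolding graded_sum coeff_sum using d by (intro sum.cong) auto
    then show "bvalue P (coeff (graded f) d) = mpoly_eval f (affine_vec P)"
      by (simp add: bvalue.hom_sum bvalue_monom mpoly_eval_eq_mev mev_def mon_eval_3 mult.assoc)
  qed
qed

lemma vanish_coeff_mult:
  assumes "\<And>d. vanish P j (coeff p d)" "\<And>d. vanish P k (coeff q d)"
  shows "vanish P (j + k) (coeff (p * q) d)"
  unfolding coeff_mult by (intro vanish_sum vanish_mult assms)

lemma point_ideal_graded:
  assumes "f \<in> point_ideal (affine_point P)"
  shows "vanish P 1 (coeff (graded f) d)"
  using assms unfolding point_ideal_def
proof (induction arbitrary: d rule: ideal_gen_induct)
  case (mult c a)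
  show ?case
    using vanish_coeff_mult[of P 0 "graded c" 1 "graded a" d] mult by (simp add: graded.hom_mult)
next
  case (base a)
  then obtain e where e: "\<And>e'. e' \<noteq> e \<Longrightarrow> coeff (graded a) e' = 0"
    "bvalue P (coeff (graded a) e) = mpoly_eval a (affine_vec P)"
    using form_graded[of a P] by blast
  show ?case
  proof (cases "d = e")
    case True
    then show ?thesis
      using e(2) base affine_vec_in_point[of P] by (simp only: vanish_1_iff) auto
  qed (use e(1) in simp)
qed (auto simp: graded.hom_add intro: vanish_add)

text \<open>The point ideal is generated by forms and \<open>graded\<close> is multiplicative, so
  the order can be read off each homogeneous component separately.\<close>

lemma ideal_power_graded:
  assumes "f \<in> ideal_power (point_ideal (affine_point P)) k"
  shows "vanish P k (coeff (graded f) d)"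
  using assms
proof (induction k arbitrary: f d)
  case (Suc k)
  then have "f \<in> ideal_mult (point_ideal (affine_point P)) (ideal_power (point_ideal (affine_point P)) k)"
    by simp
  then show ?case
  proof (induction arbitrary: d rule: ideal_mult_induct)
    case (mult c a)
    show ?case
      using vanish_coeff_mult[of P 0 "graded c" "Suc k" "graded a" d] mult by (simp add: graded.hom_mult)
  next
    case (base a b)
    show ?case
      using vanish_coeff_mult[of P 1 "graded a" k "graded b" d] point_ideal_graded[OF base(1)] Suc.IH[OF base(2)]
      by (simp add: graded.hom_mult)
  qed (auto simp: graded.hom_add intro: vanish_add)
qed simp

lemma monomial_in_irrelevant_power:
  "mpoly_var 0 ^ i * mpoly_var 1 ^ j * mpoly_var 2 ^ k \<in> ideal_power irrelevant_ideal (i + j + k)"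
proof -
  have var: "mpoly_var l \<in> irrelevant_ideal" for l
    unfolding irrelevant_ideal_def by (intro ideal_gen_base) simp
  have 1: "mpoly_var 2 ^ k \<in> ideal_power irrelevant_ideal k" for k
    by (induction k) (simp_all add: ideal_multI var)
  have 2: "mpoly_var 1 ^ j * mpoly_var 2 ^ k \<in> ideal_power irrelevant_ideal (j + k)" for j k
    by (induction j) (simp_all add: 1 mult.assoc ideal_multI var)
  have "mpoly_var 0 ^ i * (mpoly_var 1 ^ j * mpoly_var 2 ^ k) \<in> ideal_power irrelevant_ideal (i + (j + k))"
    by (induction i) (simp_all add: 2 mult.assoc ideal_multI var)
  then show ?thesis by (simp add: mult.assoc add.assoc)
qed

text \<open>Homogenization to degree exactly \<open>c\<close>: the third variable fills up each
  monomial, which makes it a product of \<open>c\<close> variables.\<close>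

lemma graded_lift:
  assumes "tdeg g \<le> c"
  shows "\<exists>F\<in>ideal_power irrelevant_ideal c. graded F = monom g c"
  using assms
proof (induction rule: tdeg_induct)
  case (mono a i j)
  define F :: "(3, 'a) mpoly" where
    "F = Poly_Mapping.single 0 a * (mpoly_var 0 ^ i * mpoly_var 1 ^ j * mpoly_var 2 ^ (c - i - j))"
  have "F \<in> ideal_power irrelevant_ideal c"
  proof -
    have "mpoly_var 0 ^ i * mpoly_var 1 ^ j * mpoly_var 2 ^ (c - i - j) \<in> ideal_power irrelevant_ideal c"
      using monomial_in_irrelevant_power[of i j "c - i - j"] mono by simp
    then show ?thesis unfolding F_def by (rule is_ideal_D(3)[OF is_ideal_power])
  qed
  moreover have "graded F = monom (bconst a * (bX ^ i * bY ^ j)) c"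
    using mono
    unfolding F_def graded.hom_mult graded.hom_power graded_var graded_const monom_power mult_monom
    by simp
  ultimately show ?case by blast
next
  case (add f g)
  then obtain F G where "F \<in> ideal_power irrelevant_ideal c" "graded F = monom f c"
    "G \<in> ideal_power irrelevant_ideal c" "graded G = monom g c" by blast
  then show ?case
    by (intro bexI[of _ "F + G"] is_ideal_D[OF is_ideal_power]) (simp_all add: graded.hom_add add_monom)
qed

text \<open>Follows \<open>vanish_SucE\<close>: its degree bounds let both quotients be homogenized
  to degree \<open>c - 1\<close>, and its linear factors homogenize to elements of the point
  ideal.\<close>

lemma point_power_lift:
  fixes g :: "'a::field poly poly"
  assumes "vanish P k g" "tdeg g \<le> c"
  shows "\<exists>F\<in>ideal_power (point_ideal (affine_point P)) k. graded F = monom g c"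
  using assms
proof (induction k arbitrary: g c)
  case 0
  then show ?case using graded_lift by force
next
  case (Suc k)
  let ?I = "point_ideal (affine_point P)"
  show ?case
  proof (cases c)
    case 0
    \<comment> \<open>A constant vanishing at a point is zero. The case is separate because it
      leaves no degree to give to the linear factors.\<close>
    have "vanish P 1 g" using Suc.prems(1) by (rule vanish_mono) simp
    then have "bvalue P g = 0" by (simp only: vanish_1_iff)
    moreover have "g = bconst (coeff (coeff g 0) 0)"
    proof (intro poly_eqI)
      fix j i
      show "coeff (coeff g j) i = coeff (coeff (bconst (coeff (coeff g 0) 0)) j) i"
        using Suc.prems(2) 0 unfolding tdeg_le_iff by (cases i; cases j) auto
    qed
    ultimately have "g = 0" by (metis bvalue_generators(1) pCons_0_0)
    then show ?thesis
      by (intro bexI[of _ 0]) (simp_all add: is_ideal_D[OF is_ideal_mult])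
  next
    case (Suc c')
    obtain g1 g2 where g: "g = (bX - bconst (fst P)) * g1 + (bY - bconst (snd P)) * g2"
      "vanish P k g1" "vanish P k g2" "tdeg g1 \<le> tdeg g - 1" "tdeg g2 \<le> tdeg g - 1"
      using vanish_SucE[OF Suc.prems(1)] by metis
    have tg: "tdeg g1 \<le> c'" "tdeg g2 \<le> c'" using g(4,5) Suc.prems(2) Suc by simp_all
    obtain F1 where F1: "F1 \<in> ideal_power ?I k" "graded F1 = monom g1 c'"
      using Suc.IH[OF g(2) tg(1)] by blast
    obtain F2 where F2: "F2 \<in> ideal_power ?I k" "graded F2 = monom g2 c'"
      using Suc.IH[OF g(3) tg(2)] by blast
    have lin: "mpoly_var l - Poly_Mapping.single 0 (affine_vec P l) * mpoly_var 2 \<in> ?I" for l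
      unfolding point_ideal_def
    proof (intro ideal_gen_base CollectI conjI ballI)
      have "mpoly_var l - Poly_Mapping.single 0 (affine_vec P l) * mpoly_var 2 =
          Poly_Mapping.single (Poly_Mapping.single l 1) 1 +
          Poly_Mapping.single (Poly_Mapping.single 2 1) (- affine_vec P l)"
        by (simp add: mpoly_var_def mult_single single_uminus)
      then have "Poly_Mapping.keys (mpoly_var l - Poly_Mapping.single 0 (affine_vec P l) * mpoly_var 2)
          \<subseteq> {Poly_Mapping.single l 1, Poly_Mapping.single 2 1}"
        by (smt (verit) Poly_Mapping.keys_add Un_iff insert_iff keys_single empty_iff subset_iff)
      then show "is_form (mpoly_var l - Poly_Mapping.single 0 (affine_vec P l) * mpoly_var 2)"
        unfolding is_form_def by (intro exI[of _ 1]) auto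
      fix v assume "v \<in> affine_point P"
      then obtain a where v: "v = (\<lambda>j. a * affine_vec P j)" unfolding affine_point_def by auto
      have var: "mpoly_eval (mpoly_var j) v = v j" for j
        unfolding mpoly_eval_eq_mev mpoly_var_def by (subst mev_single[OF id_hom]) simp
      have "mpoly_eval (Poly_Mapping.single 0 c) v = c" for c
        unfolding mpoly_eval_eq_mev by (subst mev_single[OF id_hom]) simp
      then show "mpoly_eval (mpoly_var l - Poly_Mapping.single 0 (affine_vec P l) * mpoly_var 2) v = 0"
        by (simp add: mpoly_eval.hom_minus mpoly_eval.hom_mult var) (simp add: v)
    qed
    have X: "graded (mpoly_var 0 - Poly_Mapping.single 0 (affine_vec P 0) * mpoly_var 2) = monom (bX - bconst (fst P)) 1"
      unfolding graded.hom_minus graded.hom_mult graded_var graded_const mult_monom by (simp add: diff_monom)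
    have Y: "graded (mpoly_var 1 - Poly_Mapping.single 0 (affine_vec P 1) * mpoly_var 2) = monom (bY - bconst (snd P)) 1"
      unfolding graded.hom_minus graded.hom_mult graded_var graded_const mult_monom by (simp add: diff_monom)
    show ?thesis
    proof (intro bexI)
      show "graded ((mpoly_var 0 - Poly_Mapping.single 0 (affine_vec P 0) * mpoly_var 2) * F1 +
          (mpoly_var 1 - Poly_Mapping.single 0 (affine_vec P 1) * mpoly_var 2) * F2) = monom g c"
        unfolding graded.hom_add graded.hom_mult X Y F1(2) F2(2) mult_monom add_monom g(1) Suc
        by simp
      show "(mpoly_var 0 - Poly_Mapping.single 0 (affine_vec P 0) * mpoly_var 2) * F1 +
          (mpoly_var 1 - Poly_Mapping.single 0 (affine_vec P 1) * mpoly_var 2) * F2 \<in> ideal_power ?I (Suc k)"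
        unfolding ideal_power.simps by (intro is_ideal_D(2)[OF is_ideal_mult] ideal_multI lin F1 F2)
    qed
  qed
qed

lemma symbolic_power_graded:
  assumes "\<And>i. i < n \<Longrightarrow> P i = affine_point (u i)" "f \<in> symbolic_power n P k"
  shows "multi_vanish n u k (coeff (graded f) d)"
  unfolding multi_vanish_def
proof (intro allI impI)
  fix i assume "i < n"
  then show "vanish (u i) k (coeff (graded f) d)"
    using assms by (intro ideal_power_graded) (auto simp: symbolic_power_def)
qed

text \<open>The homogenization \<open>F\<close> does not depend on the point: by injectivity of
  \<open>graded\<close>, the lifts obtained at the individual points all equal it.\<close>

lemma symbolic_power_lift:
  fixes g :: "'a::field poly poly"
  assumes P: "\<And>i. i < n \<Longrightarrow> P i = affine_point (u i)"
    and g: "multi_vanish n u k g" "tdeg g \<le> c"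
  shows "\<exists>F\<in>symbolic_power n P k. graded F = monom g c"
proof -
  obtain F where F: "graded F = monom g c" using graded_lift[OF g(2)] by blast
  have "F \<in> ideal_power (point_ideal (P i)) k" if i: "i < n" for i
  proof -
    have "vanish (u i) k g" using g(1) i by (simp add: multi_vanish_def)
    then obtain F' where "F' \<in> ideal_power (point_ideal (affine_point (u i))) k" "graded F' = monom g c"
      using point_power_lift[OF _ g(2)] by blast
    then show ?thesis using graded_inj[of F F'] F P[OF i] by simp
  qed
  then show ?thesis using F by (auto simp: symbolic_power_def)
qed

context interpolating
begin

text \<open>Each of the \<open>t\<close> exposed factors is homogenized to degree exactly
  \<open>\<delta>\<close>, whatever its true degree, and the last cofactor to the remaining degree
  \<open>e - t * \<delta>\<close>, which places it in that power of the irrelevant ideal.\<close>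

lemma power_lift:
  assumes P: "\<And>i. i < n \<Longrightarrow> P i = affine_point (u i)"
    and "t * \<delta> \<le> e" "multi_vanish n u (t * m) g" "tdeg g \<le> e"
  shows "\<exists>F\<in>ideal_mult (ideal_power irrelevant_ideal (e - t * \<delta>)) (ideal_power (symbolic_power n P m) t).
    graded F = monom g e"
  using assms(2-4)
proof (induction t arbitrary: g e)
  case 0
  then obtain F where F: "F \<in> ideal_power irrelevant_ideal e" "graded F = monom g e"
    using graded_lift by blast
  have "F * 1 \<in> ideal_mult (ideal_power irrelevant_ideal e) UNIV"
    by (intro ideal_multI F) simp
  then show ?case using F by (intro bexI[of _ F]) simp_all
next
  case (Suc t)
  let ?A = "ideal_power irrelevant_ideal (e - Suc t * \<delta>)"
  let ?J = "ideal_mult ?A (ideal_power (symbolic_power n P m) (Suc t))"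
  have e: "t * \<delta> \<le> e - \<delta>" "e - \<delta> - t * \<delta> = e - Suc t * \<delta>" "\<delta> + (e - \<delta>) = e"
    using Suc.prems(1) by simp_all
  have "g \<in> products t (e - \<delta>)"
    by (rule power_decompose[OF Suc.prems(2,3,1)])
  then show ?case
    unfolding products_def
  proof (induction rule: add_span.induct)
    case zero
    show ?case by (intro bexI[of _ 0]) (simp_all add: is_ideal_D[OF is_ideal_mult])
  next
    case (insert x y)
    obtain b h where x: "x = b * h" "multi_vanish n u m b" "tdeg b \<le> \<delta>"
      "multi_vanish n u (t * m) h" "tdeg h \<le> e - \<delta>"
      using insert.hyps(1) by blast
    obtain B where B: "B \<in> symbolic_power n P m" "graded B = monom b \<delta>"
      using symbolic_power_lift[OF P x(2,3)] by blast
    obtain H where H: "H \<in> ideal_mult (ideal_power irrelevant_ideal (e - \<delta> - t * \<delta>)) (ideal_power (symbolic_power n P m) t)"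
      "graded H = monom h (e - \<delta>)"
      using Suc.IH[OF e(1) x(4,5)] by blast
    obtain Y where Y: "Y \<in> ?J" "graded Y = monom y e" using insert.IH by blast
    have "B * H \<in> ?J"
      using ideal_mult_left_commute[OF B(1) H(1)] by (simp only: e(2) ideal_power.simps)
    moreover have "graded (B * H) = monom x e"
      unfolding graded.hom_mult B(2) H(2) mult_monom e(3) x(1) ..
    ultimately show ?case
      using Y is_ideal_D(2)[OF is_ideal_mult, of "B * H" _ _ Y]
      by (intro bexI[of _ "B * H + Y"]) (simp_all only: graded.hom_add add_monom)
  qed
qed

text \<open>Components of degree at most \<open>e0\<close> are zero by \<open>nonvanishing\<close>.
  In every other degree \<open>d\<close> one has \<open>d - t * \<delta> \<ge> c\<close>, and this
  is the power left for the irrelevant ideal.\<close>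

theorem symbolic_power_subset:
  assumes P: "\<And>i. i < n \<Longrightarrow> P i = affine_point (u i)"
    and k: "t * m \<le> k" and nv: "nonvanishing n k e0 u" and e0: "t * \<delta> + c \<le> Suc e0"
  shows "symbolic_power n P k \<subseteq>
    ideal_mult (ideal_power irrelevant_ideal c) (ideal_power (symbolic_power n P m) t)"
proof
  fix f assume f: "f \<in> symbolic_power n P k"
  let ?J = "ideal_mult (ideal_power irrelevant_ideal c) (ideal_power (symbolic_power n P m) t)"
  define g where "g d = coeff (graded f) d" for d
  have g: "multi_vanish n u k (g d)" "tdeg (g d) \<le> d" for d
    unfolding g_def using symbolic_power_graded[OF P f] tdeg_coeff_graded by auto
  have "\<exists>F\<in>?J. graded F = monom (g d) d" for d
  proof (cases "d \<le> e0")
    case True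
    then have "g d = 0" using nv g[of d] unfolding nonvanishing_def by auto
    then show ?thesis by (intro bexI[of _ 0]) (simp_all add: is_ideal_D[OF is_ideal_mult])
  next
    case False
    then have d: "t * \<delta> + c \<le> d" using e0 by simp
    obtain F where F: "F \<in> ideal_mult (ideal_power irrelevant_ideal (d - t * \<delta>)) (ideal_power (symbolic_power n P m) t)"
       "graded F = monom (g d) d"
      using power_lift[OF P, of t d "g d"] d g[of d] multi_vanish_mono[OF g(1) k] by auto
    have "F \<in> ?J"
      using ideal_mult_mono[OF F(1) ideal_power_antimono] d by simp
    then show ?thesis using F(2) by blast
  qed
  then obtain F where F: "\<And>d. F d \<in> ?J" "\<And>d. graded (F d) = monom (g d) d" by metis
  define D where "D = degree (graded f)"
  have "graded (\<Sum>d\<le>D. F d) = graded f"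
    unfolding graded.hom_sum F(2) by (simp add: g_def D_def poly_as_sum_of_monoms)
  then have "f = (\<Sum>d\<le>D. F d)" by (intro graded_inj) simp
  moreover have "(\<Sum>d\<le>D. F d) \<in> ?J" by (intro is_ideal_sum is_ideal_mult F)
  ultimately show "f \<in> ?J" by simp
qed

end

section \<open>Generic configurations form an open set\<close>

text \<open>The degree \<open>D\<close> is the same for every point, so that powers of the single
  form \<open>Zprod n\<close> bring two forms to a common degree.\<close>

definition mhom :: "nat \<Rightarrow> nat \<Rightarrow> (nat \<times> 3, 'a::comm_ring_1) mpoly \<Rightarrow> bool" where
  "mhom n D F \<longleftrightarrow> (\<forall>e\<in>Poly_Mapping.keys F. fst ` Poly_Mapping.keys e \<subseteq> {..<n} \<and>
     (\<forall>i<n. (\<Sum>j\<in>UNIV. Poly_Mapping.lookup e (i, j)) = D))"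

lemma mhom_multihomogeneous: "mhom n D F \<Longrightarrow> multihomogeneous n F"
  unfolding mhom_def multihomogeneous_def by (intro exI[of _ "\<lambda>_. D"]) simp

lemma mhom_add: "mhom n D F \<Longrightarrow> mhom n D G \<Longrightarrow> mhom n D (F + G)"
  unfolding mhom_def using Poly_Mapping.keys_add[of F G] by blast

lemma mhom_mult:
  assumes "mhom n D F" "mhom n E G"
  shows "mhom n (D + E) (F * G)"
  unfolding mhom_def
proof
  fix e assume "e \<in> Poly_Mapping.keys (F * G)"
  then obtain a b where ab: "e = a + b" "a \<in> Poly_Mapping.keys F" "b \<in> Poly_Mapping.keys G"
    using keys_mult[of F G] by blast
  have "Poly_Mapping.keys e \<subseteq> Poly_Mapping.keys a \<union> Poly_Mapping.keys b"
    unfolding ab(1) by (rule Poly_Mapping.keys_add)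
  moreover have "fst ` Poly_Mapping.keys a \<subseteq> {..<n}" "fst ` Poly_Mapping.keys b \<subseteq> {..<n}"
    using assms ab unfolding mhom_def by blast+
  ultimately have "fst ` Poly_Mapping.keys e \<subseteq> {..<n}" by blast
  moreover have "\<forall>i<n. (\<Sum>j\<in>UNIV. Poly_Mapping.lookup e (i, j)) = D + E"
    using assms ab unfolding mhom_def by (simp add: lookup_add sum.distrib)
  ultimately show "fst ` Poly_Mapping.keys e \<subseteq> {..<n} \<and> (\<forall>i<n. (\<Sum>j\<in>UNIV. Poly_Mapping.lookup e (i, j)) = D + E)" ..
qed

definition transversal :: "nat \<Rightarrow> (nat \<Rightarrow> 3) \<Rightarrow> (nat \<times> 3, 'a::comm_ring_1) mpoly" where
  "transversal n c = Poly_Mapping.single (\<Sum>i<n. Poly_Mapping.single (i, c i) 1) 1"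

lemma mhom_transversal: "mhom n 1 (transversal n c)"
proof -
  define e where "e = (\<Sum>i<n. Poly_Mapping.single (i, c i) (1 :: nat))"
  have lookup_e: "Poly_Mapping.lookup e (i, j) = (if i < n \<and> j = c i then 1 else 0)" for i j
  proof -
    have "Poly_Mapping.lookup e (i, j) = (\<Sum>i'<n. if i' = i then (if j = c i then 1 else 0) else 0)"
      unfolding e_def lookup_sum by (intro sum.cong) (auto simp: lookup_single when_def)
    then show ?thesis by simp
  qed
  have "fst ` Poly_Mapping.keys e \<subseteq> {..<n}"
    by (auto simp: in_keys_iff lookup_e split: if_splits)
  moreover have "(\<Sum>j\<in>UNIV. Poly_Mapping.lookup e (i, j)) = 1" if "i < n" for i
    using that by (simp add: lookup_e)
  ultimately show ?thesis
    unfolding mhom_def transversal_def e_def[symmetric] by (simp add: when_def)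
qed

lemma eval_transversal: "mpoly_eval (transversal n c) w = (\<Prod>i<n. w (i, c i))"
  unfolding mpoly_eval_eq_mev transversal_def
  by (subst mev_single[OF id_hom]) (simp add: mon_eval_sum)

abbreviation Zprod :: "nat \<Rightarrow> (nat \<times> 3, 'a::comm_ring_1) mpoly" where
  "Zprod n \<equiv> transversal n (\<lambda>_. 2)"

lemma mhom_1: "mhom n 0 1"
  unfolding mhom_def by (simp flip: single_one)

lemma mhom_Zprod_power: "mhom n k (Zprod n ^ k)"
proof (induction k)
  case (Suc k)
  then show ?case using mhom_mult[OF mhom_transversal Suc] by simp
qed (simp add: mhom_1)

definition affine_part :: "(nat \<times> 3 \<Rightarrow> 'a::field) \<Rightarrow> nat \<Rightarrow> 'a \<times> 'a" where
  "affine_part w i = (w (i, 0) / w (i, 2), w (i, 1) / w (i, 2))"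

text \<open>Denominators are cleared by the product of the last coordinates. An affine coordinate
  becomes a \<open>transversal\<close> monomial with one index changed, and summands are padded by
  powers of \<open>Zprod n\<close> to equal degree.\<close>

lemma polyfun_homogenize:
  assumes "polyfun n G"
  shows "\<exists>D F. mhom n D F \<and> (\<forall>w :: nat \<times> 3 \<Rightarrow> 'a::field. (\<forall>i<n. w (i, 2) \<noteq> 0) \<longrightarrow>
    mpoly_eval F w = (\<Prod>i<n. w (i, 2)) ^ D * G (affine_part w))"
  using assms
proof induction
  case (const c)
  have "mhom n 0 (Poly_Mapping.single 0 c)"
    unfolding mhom_def by simp
  moreover have "mpoly_eval (Poly_Mapping.single 0 c) w = c" for w :: "nat \<times> 3 \<Rightarrow> 'a"
    unfolding mpoly_eval_eq_mev by (subst mev_single[OF id_hom]) simp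
  ultimately show ?case by (intro exI[of _ 0] exI[of _ "Poly_Mapping.single 0 c"]) simp
next
  case (fst i)
  have "(\<Prod>i'<n. w (i', if i' = i then 0 else 2)) = (\<Prod>i<n. w (i, 2)) * (w (i, 0) / w (i, 2))"
    if "\<forall>i<n. w (i, 2) \<noteq> 0" for w :: "nat \<times> 3 \<Rightarrow> 'a"
  proof -
    have "(\<Prod>i'\<in>{..<n} - {i}. w (i', if i' = i then 0 else 2)) = (\<Prod>i'\<in>{..<n} - {i}. w (i', 2))"
      by (intro prod.cong) auto
    then show ?thesis
      using fst that by (simp add: prod.remove[of "{..<n}" i])
  qed
  then show ?case
    by (intro exI[of _ 1] exI[of _ "transversal n (\<lambda>i'. if i' = i then 0 else 2)"])
      (simp add: mhom_transversal eval_transversal affine_part_def del: One_nat_def)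
next
  case (snd i)
  have "(\<Prod>i'<n. w (i', if i' = i then 1 else 2)) = (\<Prod>i<n. w (i, 2)) * (w (i, 1) / w (i, 2))"
    if "\<forall>i<n. w (i, 2) \<noteq> 0" for w :: "nat \<times> 3 \<Rightarrow> 'a"
  proof -
    have "(\<Prod>i'\<in>{..<n} - {i}. w (i', if i' = i then 1 else 2)) = (\<Prod>i'\<in>{..<n} - {i}. w (i', 2))"
      by (intro prod.cong) auto
    then show ?thesis
      using snd that by (simp add: prod.remove[of "{..<n}" i])
  qed
  then show ?case
    by (intro exI[of _ 1] exI[of _ "transversal n (\<lambda>i'. if i' = i then 1 else 2)"])
      (simp add: mhom_transversal eval_transversal affine_part_def del: One_nat_def)
next
  case (add F G)
  then obtain D A E B where A: "mhom n D A" "mhom n E B"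
    "\<And>w. (\<forall>i<n. w (i, 2) \<noteq> 0) \<Longrightarrow> mpoly_eval A w = (\<Prod>i<n. w (i, 2)) ^ D * F (affine_part w)"
    "\<And>w. (\<forall>i<n. w (i, 2) \<noteq> 0) \<Longrightarrow> mpoly_eval B w = (\<Prod>i<n. w (i, 2)) ^ E * G (affine_part w)"
    by metis
  have "mhom n (D + E) (A * Zprod n ^ E + B * Zprod n ^ D)"
    using mhom_mult[OF A(1) mhom_Zprod_power[of n E]] mhom_mult[OF A(2) mhom_Zprod_power[of n D]]
    by (intro mhom_add) (simp_all add: add.commute)
  moreover have "mpoly_eval (A * Zprod n ^ E + B * Zprod n ^ D) w =
      (\<Prod>i<n. w (i, 2)) ^ (D + E) * (F (affine_part w) + G (affine_part w))"
    if "\<forall>i<n. w (i, 2) \<noteq> 0" for w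
    unfolding mpoly_eval.hom_add mpoly_eval.hom_mult mpoly_eval.hom_power eval_transversal
      A(3)[OF that] A(4)[OF that] by (simp add: power_add algebra_simps)
  ultimately show ?case by blast
next
  case (mult F G)
  then obtain D A E B where A: "mhom n D A" "mhom n E B"
    "\<And>w. (\<forall>i<n. w (i, 2) \<noteq> 0) \<Longrightarrow> mpoly_eval A w = (\<Prod>i<n. w (i, 2)) ^ D * F (affine_part w)"
    "\<And>w. (\<forall>i<n. w (i, 2) \<noteq> 0) \<Longrightarrow> mpoly_eval B w = (\<Prod>i<n. w (i, 2)) ^ E * G (affine_part w)"
    by metis
  have "mpoly_eval (A * B) w =
      (\<Prod>i<n. w (i, 2)) ^ (D + E) * (F (affine_part w) * G (affine_part w))"
    if "\<forall>i<n. w (i, 2) \<noteq> 0" for w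
    unfolding mpoly_eval.hom_mult A(3)[OF that] A(4)[OF that] by (simp add: power_add algebra_simps)
  then show ?case using mhom_mult[OF A(1,2)] by blast
qed

lemma affine_point_in_plane: "affine_point u \<in> proj_plane"
proof -
  have "affine_vec u \<noteq> (\<lambda>_. 0)"
  proof
    assume "affine_vec u = (\<lambda>_. 0)"
    from fun_cong[OF this, of 2] show False by simp
  qed
  moreover from this have "proj_rel `` {affine_vec u} = affine_point u"
    by (auto simp: proj_rel_def affine_point_def)
  ultimately show ?thesis unfolding proj_plane_def by (auto simp: quotient_def)
qed

lemma proj_plane_affine:
  assumes "p \<in> proj_plane" "v \<in> p" "v 2 \<noteq> (0 :: 'a::field)"
  shows "p = affine_point (v 0 / v 2, v 1 / v 2)"
proof -
  obtain w where w: "w \<noteq> (\<lambda>_. 0)" "p = proj_rel `` {w}"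
    using assms(1) unfolding proj_plane_def by (auto simp: quotient_def)
  then obtain c where c: "c \<noteq> 0" "v = (\<lambda>j. c * w j)" using assms(2) by (auto simp: proj_rel_def)
  let ?a = "affine_vec (v 0 / v 2, v 1 / v 2)"
  have a: "v = (\<lambda>j. v 2 * ?a j)"
  proof
    fix j show "v j = v 2 * ?a j" using exhaust_3'[of j] assms(3) by auto
  qed
  have wa: "w = (\<lambda>j. v 2 / c * ?a j)"
  proof
    fix j have "v j = c * w j" using c by simp
    moreover have "v j = v 2 * ?a j" using a by (rule fun_cong)
    ultimately show "w j = v 2 / c * ?a j" using c(1) by (simp add: field_simps)
  qed
  have ac: "?a = (\<lambda>j. c / v 2 * w j)"
    by (subst wa) (use c(1) assms(3) in simp)
  show ?thesis
  proof
    show "p \<subseteq> affine_point (v 0 / v 2, v 1 / v 2)"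
    proof
      fix x assume "x \<in> p"
      then obtain d where d: "d \<noteq> 0" "x = (\<lambda>j. d * w j)" using w by (auto simp: proj_rel_def)
      have "x = (\<lambda>j. d * (v 2 / c) * ?a j)" unfolding d(2) by (subst wa) (simp add: mult.assoc)
      moreover have "d * (v 2 / c) \<noteq> 0" using d c assms(3) by simp
      ultimately show "x \<in> affine_point (v 0 / v 2, v 1 / v 2)" unfolding affine_point_def by blast
    qed
    show "affine_point (v 0 / v 2, v 1 / v 2) \<subseteq> p"
    proof
      fix x assume "x \<in> affine_point (v 0 / v 2, v 1 / v 2)"
      then obtain d where d: "d \<noteq> 0" "x = (\<lambda>j. d * ?a j)" unfolding affine_point_def by blast
      have "x = (\<lambda>j. d * (c / v 2) * w j)" unfolding d(2) by (subst ac) (simp add: mult.assoc)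
      moreover have "d * (c / v 2) \<noteq> 0" using d c assms(3) by simp
      ultimately have "(w, x) \<in> proj_rel" unfolding proj_rel_def using w(1) by blast
      then show "x \<in> p" unfolding w(2) by (simp only: Image_singleton_iff)
    qed
  qed
qed

text \<open>The extra factor \<open>Zprod n\<close> makes nonvanishing imply that no point lies on
  the line at infinity, so every tuple in the open set comes from an affine configuration.\<close>

theorem for_general_pointsI:
  fixes Q :: "(nat \<Rightarrow> 'a::field \<times> 'a) \<Rightarrow> bool"
  assumes "generic n Q"
    and R: "\<And>P u. (\<And>i. i < n \<Longrightarrow> P i = affine_point (u i)) \<Longrightarrow> Q u \<Longrightarrow> inj_on u {..<n} \<and> R P"
  shows "for_general_points n R"
proof -
  obtain G u0 where G: "polyfun n G" "G u0 \<noteq> 0" "\<And>u. G u \<noteq> 0 \<Longrightarrow> Q u"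
    using assms(1) unfolding generic_def by blast
  obtain D F where F: "mhom n D F"
    "\<And>w. (\<forall>i<n. w (i, 2) \<noteq> 0) \<Longrightarrow> mpoly_eval F w = (\<Prod>i<n. w (i, 2)) ^ D * G (affine_part w)"
    using polyfun_homogenize[OF G(1)] by blast
  define H where "H = F * Zprod n"
  have H: "multihomogeneous n H"
    unfolding H_def by (rule mhom_multihomogeneous[OF mhom_mult[OF F(1) mhom_transversal]])
  have eval_H: "mpoly_eval H w = mpoly_eval F w * (\<Prod>i<n. w (i, 2))" for w
    by (simp add: H_def mpoly_eval.hom_mult eval_transversal)
  define U where "U = {P \<in> plane_tuples n. \<not> vanishes_on_tuple n H P}"
  have "plane_tuples n - U = {P \<in> plane_tuples n. \<forall>F\<in>{H}. vanishes_on_tuple n F P}"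
    by (auto simp: U_def)
  then have "zariski_closed n (plane_tuples n - U)"
    unfolding zariski_closed_def using H by (intro exI[of _ "{H}"]) simp
  then have "zariski_open n U" unfolding zariski_open_def by (auto simp: U_def)
  moreover have "U \<noteq> {}"
  proof -
    define w where "w = (\<lambda>(i, j). affine_vec (u0 i) j)"
    define P where "P = (\<lambda>i\<in>{..<n}. affine_point (u0 i))"
    have "affine_part w = u0" by (auto simp: affine_part_def w_def)
    then have H0: "mpoly_eval H w \<noteq> 0" using F(2)[of w] G(2) by (simp add: eval_H w_def)
    have v: "\<forall>i<n. affine_vec (u0 i) \<in> P i" by (simp add: P_def affine_vec_in_point)
    have "\<not> vanishes_on_tuple n H P"
    proof
      assume "vanishes_on_tuple n H P"
      then have "(\<forall>i<n. affine_vec (u0 i) \<in> P i) \<longrightarrow> mpoly_eval H (\<lambda>(i, j). affine_vec (u0 i) j) = 0"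
        unfolding vanishes_on_tuple_def by (rule spec[where x = "\<lambda>i. affine_vec (u0 i)"])
      then have "mpoly_eval H w = 0" unfolding w_def using v by simp
      with H0 show False by simp
    qed
    moreover have "P \<in> plane_tuples n"
      unfolding plane_tuples_def P_def by (auto simp: affine_point_in_plane)
    ultimately show ?thesis by (auto simp: U_def)
  qed
  moreover have "inj_on P {..<n} \<and> R P" if PU: "P \<in> U" for P
  proof -
    obtain v where v: "\<forall>i<n. v i \<in> P i" "mpoly_eval H (\<lambda>(i, j). v i j) \<noteq> 0"
      using PU unfolding U_def vanishes_on_tuple_def by blast
    define w where "w = (\<lambda>(i, j). v i j)"
    define u where "u = affine_part w"
    have w: "mpoly_eval H w \<noteq> 0" using v(2) by (simp add: w_def)
    then have "(\<Prod>i<n. w (i, 2)) \<noteq> 0" by (auto simp: eval_H)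
    then have w2: "\<forall>i<n. w (i, 2) \<noteq> 0" by (auto simp: prod_zero_iff)
    then have "G u \<noteq> 0" using w F(2)[OF w2] by (auto simp: eval_H u_def)
    then have "Q u" by (rule G(3))
    moreover have P: "P i = affine_point (u i)" if i: "i < n" for i
    proof -
      have "P i \<in> proj_plane" using PU i by (auto simp: U_def plane_tuples_def)
      moreover have "v i \<in> P i" "v i 2 \<noteq> 0" using v(1) w2 i by (auto simp: w_def)
      ultimately show ?thesis
        using proj_plane_affine[of "P i" "v i"] by (simp add: u_def affine_part_def w_def)
    qed
    ultimately have "inj_on u {..<n}" "R P" using R by blast+
    then show ?thesis using P by (auto simp: inj_on_def affine_point_eq_iff)
  qed
  ultimately show ?thesis unfolding for_general_points_def by blast
qed

text \<open>The values \<open>1\<close> at one point and \<open>0\<close> at the others could not be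
  interpolated if two of the points coincided.\<close>

lemma interp_inj_on:
  fixes u :: "nat \<Rightarrow> 'a::field \<times> 'a"
  assumes "interp n m d u" "m \<ge> 1"
  shows "inj_on u {..<n}"
proof (rule inj_onI)
  fix i j assume ij: "i \<in> {..<n}" "j \<in> {..<n}" "u i = u j"
  show "i = j"
  proof (rule ccontr)
    assume "i \<noteq> j"
    obtain f where f: "\<And>l. l < n \<Longrightarrow> vanish (u l) m (f - (if l = i then 1 else 0))"
      using assms(1) unfolding interp_def by (auto dest: spec[of _ "\<lambda>l. if l = i then 1 else 0"])
    have "vanish (u i) m (f - 1)" using f[of i] ij by simp
    moreover have "vanish (u i) m f" using f[of j] ij \<open>i \<noteq> j\<close> by simp
    ultimately have "vanish (u i) m (f - (f - 1))" by (rule vanish_diff[rotated])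
    then have "vanish (u i) m 1" by simp
    then have "vanish (u i) 1 1" using assms(2) by (rule vanish_mono)
    then show False by (simp only: vanish_1_iff) simp
  qed
qed

lemma ideal_mult_trivial: "S \<subseteq> ideal_mult (ideal_power A 0) (ideal_power S 1)"
proof
  fix x assume "x \<in> S"
  then have "1 * (x * 1) \<in> ideal_mult UNIV (ideal_mult S UNIV)" by (intro ideal_multI) auto
  then show "x \<in> ideal_mult (ideal_power A 0) (ideal_power S 1)" by simp
qed

theorem proposition8p1:
  fixes m t n s :: nat
  assumes "m \<ge> 1" and "t \<ge> 1" and "s \<ge> 3" and "n = s ^ 2"
  shows "for_general_points n (\<lambda>P :: nat \<Rightarrow> 'a::alg_closed_field point.
           symbolic_power n P (t * (m + 1))
             \<subseteq> ideal_mult (ideal_power irrelevant_ideal t)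
                          (ideal_power (symbolic_power n P m) t) \<and>
           symbolic_power n P (t * (m + 1) - 1)
             \<subseteq> ideal_power (symbolic_power n P m) t \<and>
           symbolic_power n P (t * (m + 1) - 1)
             \<subseteq> ideal_mult (ideal_power irrelevant_ideal (t - 1))
                          (ideal_power (symbolic_power n P m) t))"
proof -
  define k1 where "k1 = t * (m + 1)"
  define k2 where "k2 = t * (m + 1) - 1"
  have "t * (m + 1) \<ge> 1 * (1 + 1)" using assms by (intro mult_mono) auto
  then have k: "k1 \<ge> 1" "k2 \<ge> 1" "k1 = Suc k2" by (simp_all add: k1_def k2_def)
  define d where "d = m * s + (s div 2 - 1)"
  \<comment> \<open>The last conjunct is the sharper bound, imposed exactly where
    \<open>s * k2\<close> falls one short of the required degree.\<close>
  define Q where "Q u \<longleftrightarrow> interp n m d u \<and> nonvanishing n k1 (s * k1 - 1) u \<and>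
    nonvanishing n k2 (s * k2 - 1) u \<and> (even s \<and> t = 2 \<longrightarrow> nonvanishing n k2 (s * k2) u)"
    for u :: "nat \<Rightarrow> 'a \<times> 'a"
  have "generic n Q"
  proof -
    have "\<exists>u :: nat \<Rightarrow> 'a \<times> 'a. interp n m d u"
      using ex_interp unfolding assms(4) d_def .
    then have 1: "generic n (interp n m d :: (nat \<Rightarrow> 'a \<times> 'a) \<Rightarrow> bool)"
      using generic_interp by blast
    have 2: "generic n (nonvanishing n k (s * k - 1) :: (nat \<Rightarrow> 'a \<times> 'a) \<Rightarrow> bool)" if "k \<ge> 1" for k
      using ex_nonvanishing[OF that, of s] assms generic_nonvanishing by fastforce
    have 3: "generic n (\<lambda>u :: nat \<Rightarrow> 'a \<times> 'a. even s \<and> t = 2 \<longrightarrow> nonvanishing n k2 (s * k2) u)"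
    proof (cases "even s \<and> t = 2")
      case True
      then obtain r where r: "s = 2 * r" by (auto elim: evenE)
      have "\<exists>u :: nat \<Rightarrow> 'a \<times> 'a. nonvanishing n k2 (s * k2) u"
        using ex_odd_nonvanishing[of r k2] assms True r by (simp add: k2_def)
      then show ?thesis using True generic_nonvanishing by fastforce
    qed (auto simp: generic_True)
    show ?thesis
      unfolding Q_def[abs_def] using k by (intro generic_conj 1 2 3)
  qed
  then show ?thesis
  proof (rule for_general_pointsI)
    fix P :: "nat \<Rightarrow> 'a point" and u :: "nat \<Rightarrow> 'a \<times> 'a"
    assume P: "\<And>i. i < n \<Longrightarrow> P i = affine_point (u i)" and u: "Q u"
    have interp: "interp n m d u" using u by (simp add: Q_def)
    have inj: "inj_on u {..<n}" by (rule interp_inj_on[OF interp assms(1)])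
    interpret interpolating n u m d "Suc d"
      by unfold_locales (simp_all add: inj interp)
    let ?S = "symbolic_power n P"
    have half: "2 * (s div 2) \<le> s" "s div 2 \<ge> 1" using assms(3) by auto
    have \<delta>: "Suc d = m * s + s div 2" using half by (simp add: d_def)
    have td: "t * Suc d = s * (t * m) + t * (s div 2)"
      unfolding \<delta> by (simp add: algebra_simps)
    have "?S k1 \<subseteq> ideal_mult (ideal_power irrelevant_ideal t) (ideal_power (?S m) t)"
    proof (rule symbolic_power_subset[OF P])
      show "nonvanishing n k1 (s * k1 - 1) u" using u by (simp add: Q_def)
      show "t * m \<le> k1" by (simp add: k1_def)
      \<comment> \<open>Each of the \<open>t\<close> factors costs \<open>s div 2\<close> for the
        interpolation degree and one for the irrelevant ideal, against a gain of \<open>s\<close>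
        from one additional order.\<close>
      have "t * (s div 2) + t \<le> s * t"
      proof -
        have "t * (s div 2 + 1) \<le> t * s" using half assms(3) by (intro mult_left_mono) linarith+
        then show ?thesis by (simp add: algebra_simps)
      qed
      then have "t * Suc d + t \<le> s * k1" unfolding td k1_def by (simp add: algebra_simps)
      then show "t * Suc d + t \<le> Suc (s * k1 - 1)" by simp
    qed
    moreover have third: "?S k2 \<subseteq> ideal_mult (ideal_power irrelevant_ideal (t - 1)) (ideal_power (?S m) t)"
    proof (cases "t = 1")
      case True
      then show ?thesis using ideal_mult_trivial[of "?S m" irrelevant_ideal] by (simp add: k2_def)
    next
      case False
      then have t: "t \<ge> 2" using assms(2) by simp
      have "k2 = t * m + (t - 1)" using t by (simp add: k2_def algebra_simps)
      then have tm: "t * m \<le> k2" and sk2: "s * k2 = s * (t * m) + s * (t - 1)"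
        by (simp_all add: algebra_simps)
      obtain t' where t': "t = t' + 2" using t by (metis add.commute le_Suc_ex)
      show ?thesis
      proof (cases "even s \<and> t = 2")
        case True
        have "nonvanishing n k2 (s * k2) u" using u True by (simp add: Q_def)
        \<comment> \<open>An equality: both sides are \<open>s * (t * m) + s + 1\<close>, so the
          degree \<open>s * k2\<close> itself has to be excluded.\<close>
        moreover have "t * Suc d + (t - 1) \<le> Suc (s * k2)"
          unfolding td sk2 using True by simp
        ultimately show ?thesis by (intro symbolic_power_subset[OF P tm])
      next
        case no: False
        \<comment> \<open>For \<open>s = 2 * r\<close> this says
          \<open>t - 1 \<le> r * (t - 2)\<close>, true for \<open>r \<ge> 2\<close> and
          \<open>t \<ge> 3\<close>; for \<open>s = 2 * r + 1\<close> it says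
          \<open>t * r \<le> 2 * r * (t - 1)\<close>, true for \<open>t \<ge> 2\<close>.\<close>
        have "t * (s div 2) + (t - 1) \<le> s * (t - 1)"
        proof (cases "even s")
          case True
          then obtain r where r: "s = 2 * r" by (auto elim: evenE)
          have "2 \<le> r" using assms(3) r by simp
          then obtain r' where r': "r = r' + 2" by (metis add.commute le_Suc_ex)
          obtain t'' where "t' = t'' + 1" using no True t' by (cases t') auto
          then show ?thesis by (simp add: r r' t' algebra_simps)
        next
          case False
          then obtain r where r: "s = 2 * r + 1" by (auto elim: oddE)
          obtain r' where r': "r = r' + 1" using assms(3) r by (cases r) auto
          show ?thesis by (simp add: r r' t' algebra_simps)
        qed
        then have "t * Suc d + (t - 1) \<le> s * k2" unfolding td sk2 by simp
        then have "t * Suc d + (t - 1) \<le> Suc (s * k2 - 1)" by simp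
        moreover have "nonvanishing n k2 (s * k2 - 1) u" using u by (simp add: Q_def)
        ultimately show ?thesis by (intro symbolic_power_subset[OF P tm])
      qed
    qed
    moreover have "?S k2 \<subseteq> ideal_power (?S m) t"
      using third ideal_mult_subset_right by blast
    ultimately show "inj_on u {..<n} \<and>
        (?S (t * (m + 1)) \<subseteq> ideal_mult (ideal_power irrelevant_ideal t) (ideal_power (?S m) t) \<and>
         ?S (t * (m + 1) - 1) \<subseteq> ideal_power (?S m) t \<and>
         ?S (t * (m + 1) - 1) \<subseteq> ideal_mult (ideal_power irrelevant_ideal (t - 1)) (ideal_power (?S m) t))"
      using inj unfolding k1_def k2_def by blast
  qed
qed

end
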